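(* Let $n\ge1$, $0\le i\le n-1$, and let $\mathbf k$ be $\mathbb Z$ or an arbitrary field. The set $\{\bar c(T,\sigma):(T,\sigma)\in\mathcal{BT}_{n,i}\}$ is a generating set for the $\mathbf k$-module $\tilde H^{n-3}((\hat 0,[n]^i))$, subject only to the following relations (that is, $\tilde H^{n-3}((\hat 0,[n]^i))$ is the quotient of the free $\mathbf k$-module on the symbols $\bar c(T,\sigma)$, $(T,\sigma)\in\mathcal{BT}_{n,i}$, by the span of these relations): (i) for $\mathrm{col}\in\{\text{blue},\text{red}\}$, $$\bar c(\alpha(\Upsilon_1\overset{\mathrm{col}}{\wedge}\Upsilon_2)\beta)=(-1)^{|I(\Upsilon_1)||I(\Upsilon_2)|}\,\bar c(\alpha(\Upsilon_2\overset{\mathrm{col}}{\wedge}\Upsilon_1)\beta);$$ (ii) for $\mathrm{col}\in\{\text{blue},\text{red}\}$, $$\bar c(\alpha(\Upsilon_1\overset{\mathrm{col}}{\wedge}(\Upsilon_2\overset{\mathrm{col}}{\wedge}\Upsilon_3))\beta)+(-1)^{|I(\Upsilon_3)|}\bar c(\alpha((\Upsilon_1\overset{\mathrm{col}}{\wedge}\Upsilon_2)\overset{\mathrm{col}}{\wedge}\Upsilon_3)\beta)+(-1)^{|I(\Upsilon_1)||I(\Upsilon_2)|}\bar c(\alpha(\Upsilon_2\overset{\mathrm{col}}{\wedge}(\Upsilon_1\overset{\mathrm{col}}{\wedge}\Upsilon_3))\beta)=0;$$ (iii) $$\begin{aligned}&\bar c(\alpha(\Upsilon_1\overset{\text{red}}{\wedge}(\Upsilon_2\overset{\text{blue}}{\wedge}\Upsilon_3))\beta)+\bar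 c(\alpha(\Upsilon_1\overset{\text{blue}}{\wedge}(\Upsilon_2\overset{\text{red}}{\wedge}\Upsilon_3))\beta)\\&+(-1)^{|I(\Upsilon_3)|}\Big(\bar c(\alpha((\Upsilon_1\overset{\text{red}}{\wedge}\Upsilon_2)\overset{\text{blue}}{\wedge}\Upsilon_3)\beta)+\bar c(\alpha((\Upsilon_1\overset{\text{blue}}{\wedge}\Upsilon_2)\overset{\text{red}}{\wedge}\Upsilon_3)\beta)\Big)\\&+(-1)^{|I(\Upsilon_1)||I(\Upsilon_2)|}\Big(\bar c(\alpha(\Upsilon_2\overset{\text{red}}{\wedge}(\Upsilon_1\overset{\text{blue}}{\wedge}\Upsilon_3))\beta)+\bar c(\alpha(\Upsilon_2\overset{\text{blue}}{\wedge}(\Upsilon_1\overset{\text{red}}{\wedge}\Upsilon_3))\beta)\Big)=0.\end{aligned}$$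
   Context: Poset. Let $[n]=\{1,\dots,n\}$. A weighted partition of $[n]$ is a set $\{B_1^{v_1},\dots,B_t^{v_t}\}$ where $\{B_1,\dots,B_t\}$ is a partition of $[n]$ and $v_i\in\{0,1,\dots,|B_i|-1\}$. The poset $\Pi_n^w$ is the set of weighted partitions of $[n]$ ordered by: $\{A_1^{w_1},\dots,A_s^{w_s}\}\le\{B_1^{v_1},\dots,B_t^{v_t}\}$ iff $\{A_j\}$ refines $\{B_k\}$ and whenever $B_k=A_{i_1}\cup\cdots\cup A_{i_l}$, then $v_k-(w_{i_1}+\cdots+w_{i_l})\in\{0,\dots,l-1\}$. Its minimum is $\hat 0=\{\{1\}^0,\dots,\{n\}^0\}$ and its maximal elements are $[n]^i:=\{[n]^i\}$, $0\le i\le n-1$. Cohomology. For a finite poset $P$ the reduced cochain module $C_r(P)$ is the free $\mathbf k$-module on chains $\alpha_0<\cdots<\alpha_r$ ($C_{-1}$ is spanned by the empty chain), with $\delta_r(\alpha_0<\cdots<\alpha_r)=\sum_{i=0}^{r+1}(-1)^i\sum_{\alpha\in(\alpha_{i-1},\alpha_i)}(\alpha_0<\cdots<\alpha_{i-1}<\alpha<\alpha_i<\cdots<\alpha_r)$, where $\alpha_{-1},\alpha_{r+1}$ are an adjoined minimum and maximum of $P$; $\tilde H^r(P)=\ker\delta_r/\operatorname{im}\delta_{r-1}$. Maximal chains are identified with their classes in top cohomology. For a degenerate interval, $\tilde H^r((x,x))=\mathbf k$ if $r=-2$ and $0$ otherwise. Trees. A bicolored binary tree is a complete plane binary tree (every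 internal node has a left and a right child) with each internal node colored red or blue. For a finite set $A$, a labeled bicolored binary tree on $A$ is one whose leaves are labeled bijectively by $A$. $\mathcal{BT}_{n,i}$ is the set of those on $[n]$ (so with $n$ leaves) with exactly $i$ red internal nodes; $(T,\sigma)$ denotes the tree $T$ whose $j$th leaf from left to right is labeled $\sigma(j)$, $\sigma\in\mathfrak S_n$. $\Upsilon_1\overset{\mathrm{col}}{\wedge}\Upsilon_2$ is the labeled bicolored binary tree (on the disjoint union of label sets) with left subtree $\Upsilon_1$, right subtree $\Upsilon_2$ and root color col. $I(\Upsilon)$ is the set of internal nodes of $\Upsilon$. $\alpha(\Upsilon)\beta$ denotes a labeled bicolored binary tree in $\mathcal{BT}_{n,i}$ containing $\Upsilon$ as the full subtree rooted at some node; within one relation, the part $\alpha(\cdot)\beta$ outside is the same in all terms, and $\Upsilon_1,\Upsilon_2,\Upsilon_3$ are arbitrary labeled bicolored binary trees with disjoint leaf label sets. Chains. Put $u(\text{blue})=0$, $u(\text{red})=1$. To $u$-merge two blocks $A^{a},B^{b}$ of a weighted partition means to replace them by $(A\cup B)^{a+b+u}$. Postorder lists the internal nodes of the left subtree (recursively in postorder), then those of the right subtree, then the root. For $(T,\sigma)\in\mathcal{BT}_{n,i}$, $c(T,\sigma)$ is the maximal chain of $[\hat 0,[n]^i]$ starting at $\hat 0$ whose rank $k$ element ($1\le k\le n-1$) is obtained from its rank $k-1$ element by $u(\mathrm{col}_k)$-merging the blocks whose underlying sets are the leaf label sets of the left and right subtrees of the $k$th internal node in postorder, where $\mathrm{col}_k$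 is the color of that node. $\bar c(T,\sigma)=c(T,\sigma)\setminus\{\hat 0,[n]^i\}$ (for $n=1$, read as the generator of $\tilde H^{-2}$). *)

theory Defs
  imports
    Complex_Main
    "HOL-Library.Disjoint_Sets"
    "HOL-Library.Poly_Mapping"
    "HOL-Library.Set_Algebras"
    "HOL-Algebra.Module"
begin

section \<open>Free modules and quotients\<close>

text \<open>The free module on a set \<open>S\<close> consists of the finitely supported functions
  \<open>'a \<Rightarrow>\<^sub>0 'k\<close> whose support lies in \<open>S\<close>.\<close>

definition scale :: "'k::comm_ring_1 \<Rightarrow> ('a \<Rightarrow>\<^sub>0 'k) \<Rightarrow> ('a \<Rightarrow>\<^sub>0 'k)" where
  "scale c f = Poly_Mapping.map ((*) c) f"

lemma lookup_scale [simp]: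
  "Poly_Mapping.lookup (scale c f) x = c * Poly_Mapping.lookup f x"
  by (simp add: scale_def Poly_Mapping.map.rep_eq when_def)

interpretation comb: Modules.module scale
  by unfold_locales
    (auto intro!: poly_mapping_eqI simp: lookup_add algebra_simps)

definition free_on :: "'a set \<Rightarrow> ('a \<Rightarrow>\<^sub>0 'k::comm_ring_1) set" where
  "free_on S = {f. Poly_Mapping.keys f \<subseteq> S}"

abbreviation gen :: "'a \<Rightarrow> ('a \<Rightarrow>\<^sub>0 'k::comm_ring_1)" where
  "gen x \<equiv> Poly_Mapping.single x 1"

definition linear_extension ::
  "('a \<Rightarrow> ('b \<Rightarrow>\<^sub>0 'k::comm_ring_1)) \<Rightarrow> ('a \<Rightarrow>\<^sub>0 'k) \<Rightarrow> ('b \<Rightarrow>\<^sub>0 'k)" where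
  "linear_extension b f =
     (\<Sum>x\<in>Poly_Mapping.keys f. scale (Poly_Mapping.lookup f x) (b x))"

text \<open>The quotient of a submodule \<open>M\<close> by a submodule \<open>N \<subseteq> M\<close>, with the cosets \<open>x + N\<close>
  as elements.  Only the module part of the record matters; its ring
  multiplication and unit are left unspecified.\<close>

definition quotient_module ::
  "('a \<Rightarrow>\<^sub>0 'k::comm_ring_1) set \<Rightarrow> ('a \<Rightarrow>\<^sub>0 'k) set \<Rightarrow> ('k, ('a \<Rightarrow>\<^sub>0 'k) set) module" where
  "quotient_module M N =
     \<lparr>carrier = (\<lambda>x. x +o N) ` M, mult = undefined, one = undefined,
      zero = N, add = (\<lambda>X Y. X + Y), smult = (\<lambda>c X. scale c ` X + N)\<rparr>"

definition is_module_iso ::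
  "('m \<Rightarrow> 'l) \<Rightarrow> ('k, 'm) module \<Rightarrow> ('k, 'l) module \<Rightarrow> bool" where
  "is_module_iso \<phi> M L \<longleftrightarrow>
     bij_betw \<phi> (carrier M) (carrier L) \<and>
     (\<forall>x\<in>carrier M. \<forall>y\<in>carrier M. \<phi> (x \<oplus>\<^bsub>M\<^esub> y) = \<phi> x \<oplus>\<^bsub>L\<^esub> \<phi> y) \<and>
     (\<forall>c. \<forall>x\<in>carrier M. \<phi> (c \<odot>\<^bsub>M\<^esub> x) = c \<odot>\<^bsub>L\<^esub> \<phi> x)"

text \<open>The elements \<open>c g\<close>, \<open>g \<in> G\<close>, generate \<open>L\<close> subject only to the relations \<open>R\<close>, which are
  elements of the free module on the symbols \<open>G\<close>.\<close>

definition presented_by ::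
  "('k, 'l) module \<Rightarrow> 'g set \<Rightarrow> ('g \<Rightarrow> 'l) \<Rightarrow> ('g \<Rightarrow>\<^sub>0 'k::comm_ring_1) set \<Rightarrow> bool" where
  "presented_by L G c R \<longleftrightarrow>
     (\<exists>\<phi>. is_module_iso \<phi> (quotient_module (free_on G) (comb.span R)) L \<and>
          (\<forall>g\<in>G. \<phi> (gen g +o comb.span R) = c g))"


section \<open>Reduced cohomology of finite posets\<close>

text \<open>A poset is given by its carrier \<open>P\<close> and its strict order \<open>lt\<close>.  The chain
  \<open>\<alpha>\<^sub>0 < \<dots> < \<alpha>\<^sub>r\<close> is the list of its \<open>r + 1\<close> elements, for \<open>r \<ge> -1\<close>.\<close>

definition chains :: "'p set \<Rightarrow> ('p \<Rightarrow> 'p \<Rightarrow> bool) \<Rightarrow> int \<Rightarrow> 'p list set" where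
  "chains P lt r = {xs. set xs \<subseteq> P \<and> sorted_wrt lt xs \<and> int (length xs) = r + 1}"

text \<open>A new element inserted at position \<open>j\<close> lies between \<open>xs ! (j - 1)\<close> and \<open>xs ! j\<close>; at either
  end one of these bounds is the adjoined minimum or maximum and imposes no condition.\<close>

definition coboundary_of_chain ::
  "'p set \<Rightarrow> ('p \<Rightarrow> 'p \<Rightarrow> bool) \<Rightarrow> 'p list \<Rightarrow> ('p list \<Rightarrow>\<^sub>0 'k::comm_ring_1)" where
  "coboundary_of_chain P lt xs =
     (\<Sum>j\<le>length xs. scale ((-1) ^ j)
        (\<Sum>\<alpha> | \<alpha> \<in> P \<and> (0 < j \<longrightarrow> lt (xs ! (j - 1)) \<alpha>) \<and> (j < length xs \<longrightarrow> lt \<alpha> (xs ! j)).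
           gen (take j xs @ \<alpha> # drop j xs)))"

definition coboundary ::
  "'p set \<Rightarrow> ('p \<Rightarrow> 'p \<Rightarrow> bool) \<Rightarrow> ('p list \<Rightarrow>\<^sub>0 'k::comm_ring_1) \<Rightarrow> ('p list \<Rightarrow>\<^sub>0 'k)" where
  "coboundary P lt = linear_extension (coboundary_of_chain P lt)"

definition cocycles ::
  "'p set \<Rightarrow> ('p \<Rightarrow> 'p \<Rightarrow> bool) \<Rightarrow> int \<Rightarrow> ('p list \<Rightarrow>\<^sub>0 'k::comm_ring_1) set" where
  "cocycles P lt r = {f \<in> free_on (chains P lt r). coboundary P lt f = 0}"

definition coboundaries ::
  "'p set \<Rightarrow> ('p \<Rightarrow> 'p \<Rightarrow> bool) \<Rightarrow> int \<Rightarrow> ('p list \<Rightarrow>\<^sub>0 'k::comm_ring_1) set" where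
  "coboundaries P lt r = coboundary P lt ` free_on (chains P lt (r - 1))"

definition open_interval :: "'p set \<Rightarrow> ('p \<Rightarrow> 'p \<Rightarrow> bool) \<Rightarrow> 'p \<Rightarrow> 'p \<Rightarrow> 'p set" where
  "open_interval P lt x y = {z \<in> P. lt x z \<and> lt z y}"

text \<open>The degenerate interval \<open>(x,x)\<close> has cohomology \<open>'k\<close> in degree \<open>-2\<close>, with the empty list as
  generator, and zero in all other degrees.\<close>

definition interval_cocycles ::
  "'p set \<Rightarrow> ('p \<Rightarrow> 'p \<Rightarrow> bool) \<Rightarrow> 'p \<Rightarrow> 'p \<Rightarrow> int \<Rightarrow> ('p list \<Rightarrow>\<^sub>0 'k::comm_ring_1) set" where
  "interval_cocycles P lt x y r =
     (if x = y then free_on (if r = -2 then {[]} else {})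
      else cocycles (open_interval P lt x y) lt r)"

definition interval_coboundaries ::
  "'p set \<Rightarrow> ('p \<Rightarrow> 'p \<Rightarrow> bool) \<Rightarrow> 'p \<Rightarrow> 'p \<Rightarrow> int \<Rightarrow> ('p list \<Rightarrow>\<^sub>0 'k::comm_ring_1) set" where
  "interval_coboundaries P lt x y r =
     (if x = y then {0} else coboundaries (open_interval P lt x y) lt r)"

definition interval_cohomology ::
  "'p set \<Rightarrow> ('p \<Rightarrow> 'p \<Rightarrow> bool) \<Rightarrow> 'p \<Rightarrow> 'p \<Rightarrow> int \<Rightarrow>
     ('k::comm_ring_1, ('p list \<Rightarrow>\<^sub>0 'k) set) module" where
  "interval_cohomology P lt x y r =
     quotient_module (interval_cocycles P lt x y r) (interval_coboundaries P lt x y r)"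

definition chain_class ::
  "'p set \<Rightarrow> ('p \<Rightarrow> 'p \<Rightarrow> bool) \<Rightarrow> 'p \<Rightarrow> 'p \<Rightarrow> int \<Rightarrow> 'p list \<Rightarrow>
     ('p list \<Rightarrow>\<^sub>0 'k::comm_ring_1) set" where
  "chain_class P lt x y r xs = gen xs +o interval_coboundaries P lt x y r"


section \<open>Weighted partitions\<close>

type_synonym weighted_partition = "(nat set \<times> nat) set"

definition weighted_partitions :: "nat \<Rightarrow> weighted_partition set" where
  "weighted_partitions n =
     {W. partition_on {1..n} (fst ` W) \<and> inj_on fst W \<and> (\<forall>(B, v)\<in>W. v \<le> card B - 1)}"

definition wp_le :: "nat \<Rightarrow> weighted_partition \<Rightarrow> weighted_partition \<Rightarrow> bool" where
  "wp_le n V W \<longleftrightarrow>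
     refines {1..n} (fst ` V) (fst ` W) \<and>
     (\<forall>(B, v)\<in>W. \<forall>S\<subseteq>V. B = \<Union> (fst ` S) \<longrightarrow>
        int v - (\<Sum>(A, w)\<in>S. int w) \<in> {0..int (card S) - 1})"

definition wp_less :: "nat \<Rightarrow> weighted_partition \<Rightarrow> weighted_partition \<Rightarrow> bool" where
  "wp_less n V W \<longleftrightarrow> wp_le n V W \<and> V \<noteq> W"

definition wp_bot :: "nat \<Rightarrow> weighted_partition" where
  "wp_bot n = (\<lambda>j. ({j}, 0)) ` {1..n}"

definition wp_top :: "nat \<Rightarrow> nat \<Rightarrow> weighted_partition" where
  "wp_top n i = {({1..n}, i)}"


section \<open>Labeled bicolored binary trees and their chains\<close>

datatype color = Blue | Red

datatype 'a btree = Leaf 'a | Node color "'a btree" "'a btree"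

fun leaves :: "'a btree \<Rightarrow> 'a list" where
  "leaves (Leaf a) = [a]"
| "leaves (Node col l r) = leaves l @ leaves r"

fun num_internal :: "'a btree \<Rightarrow> nat" where
  "num_internal (Leaf a) = 0"
| "num_internal (Node col l r) = num_internal l + num_internal r + 1"

fun num_red :: "'a btree \<Rightarrow> nat" where
  "num_red (Leaf a) = 0"
| "num_red (Node col l r) = num_red l + num_red r + (if col = Red then 1 else 0)"

definition labeled_trees :: "nat \<Rightarrow> nat \<Rightarrow> nat btree set" where
  "labeled_trees n i = {T. distinct (leaves T) \<and> set (leaves T) = {1..n} \<and> num_red T = i}"

fun color_weight :: "color \<Rightarrow> nat" where
  "color_weight Blue = 0"
| "color_weight Red = 1"

definition merge :: "nat \<Rightarrow> nat set \<Rightarrow> nat set \<Rightarrow> weighted_partition \<Rightarrow> weighted_partition" where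
  "merge d A B W =
     {(X, w) \<in> W. X \<noteq> A \<and> X \<noteq> B} \<union> {(A \<union> B, a + b + d) | a b. (A, a) \<in> W \<and> (B, b) \<in> W}"

text \<open>For each internal node in postorder: its color and the leaf label sets of its left and right
  subtrees.\<close>

fun postorder :: "'a btree \<Rightarrow> (color \<times> 'a set \<times> 'a set) list" where
  "postorder (Leaf a) = []"
| "postorder (Node col l r) =
     postorder l @ postorder r @ [(col, set (leaves l), set (leaves r))]"

fun merge_chain ::
  "weighted_partition \<Rightarrow> (color \<times> nat set \<times> nat set) list \<Rightarrow> weighted_partition list" where
  "merge_chain W [] = [W]"
| "merge_chain W ((col, A, B) # ms) = W # merge_chain (merge (color_weight col) A B W) ms"

definition tree_chain :: "nat \<Rightarrow> nat btree \<Rightarrow> weighted_partition list" where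
  "tree_chain n T = merge_chain (wp_bot n) (postorder T)"

text \<open>For \<open>n = 1\<close> the list below is empty, i.e. the generator in degree \<open>-2\<close>.\<close>

definition open_tree_chain :: "nat \<Rightarrow> nat \<Rightarrow> nat btree \<Rightarrow> weighted_partition list" where
  "open_tree_chain n i T = filter (\<lambda>x. x \<noteq> wp_bot n \<and> x \<noteq> wp_top n i) (tree_chain n T)"


section \<open>The relations\<close>

text \<open>A context \<open>\<alpha>(\<cdot>)\<beta>\<close> is a tree with a hole in place of one full subtree.\<close>

datatype 'a tree_context =
    Hole
  | In_Left color "'a tree_context" "'a btree"
  | In_Right color "'a btree" "'a tree_context"

fun plug :: "'a tree_context \<Rightarrow> 'a btree \<Rightarrow> 'a btree" where
  "plug Hole t = t"
| "plug (In_Left col C r) t = Node col (plug C t) r"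
| "plug (In_Right col l C) t = Node col l (plug C t)"

abbreviation sgn_pow :: "nat \<Rightarrow> 'k::comm_ring_1" where
  "sgn_pow m \<equiv> (-1) ^ m"

text \<open>All trees within one relation have the same leaf labels and the same number of red nodes, so it
  suffices to require that the first one is in \<open>labeled_trees n i\<close>.\<close>

inductive_set relations :: "nat \<Rightarrow> nat \<Rightarrow> (nat btree \<Rightarrow>\<^sub>0 'k::comm_ring_1) set"
  for n i :: nat where
  swap:
    "gen (plug C (Node col t1 t2))
       - scale (sgn_pow (num_internal t1 * num_internal t2)) (gen (plug C (Node col t2 t1)))
     \<in> relations n i"
  if "plug C (Node col t1 t2) \<in> labeled_trees n i"
| one_color:
    "gen (plug C (Node col t1 (Node col t2 t3)))
       + scale (sgn_pow (num_internal t3)) (gen (plug C (Node col (Node col t1 t2) t3)))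
       + scale (sgn_pow (num_internal t1 * num_internal t2))
           (gen (plug C (Node col t2 (Node col t1 t3))))
     \<in> relations n i"
  if "plug C (Node col t1 (Node col t2 t3)) \<in> labeled_trees n i"
| two_color:
    "gen (plug C (Node Red t1 (Node Blue t2 t3)))
       + gen (plug C (Node Blue t1 (Node Red t2 t3)))
       + scale (sgn_pow (num_internal t3))
           (gen (plug C (Node Blue (Node Red t1 t2) t3))
             + gen (plug C (Node Red (Node Blue t1 t2) t3)))
       + scale (sgn_pow (num_internal t1 * num_internal t2))
           (gen (plug C (Node Red t2 (Node Blue t1 t3)))
             + gen (plug C (Node Blue t2 (Node Red t1 t3))))
     \<in> relations n i"
  if "plug C (Node Red t1 (Node Blue t2 t3)) \<in> labeled_trees n i"

end

theory Submission
  imports Defs "HOL-Library.Multiset"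
begin

text \<open>Every \<open>(n - 3)\<close>-cochain is a cocycle, and the coboundary of a chain with one rank missing is, up
  to sign, the sum of the maximal chains that fill the gap.  So the top cohomology is the free module on
  the maximal chains modulo these sums.  A maximal chain is a sequence of merges, i.e. a linear
  extension of the internal nodes of a labeled bicolored tree whose left and right children are
  chosen arbitrarily; it is sent to this tree, with the sign of the permutation that takes the linear
  extension to the postorder.  The swap relation makes this independent of the choices.  A gap left
  by two merges of disjoint blocks has two fillings, which differ by a transposition; a gap left by
  merging three blocks has three or six, which are the terms of the one-color and of the two-color
  relation.  Hence this map is inverse to \<open>T \<mapsto> c(T)\<close>, and no basis is needed.\<close>

section \<open>Signs of rearrangements\<close>

text \<open>An internal node is recorded as the triple of its color and the leaf sets of its two
  children. A tree is determined by the set of its triples, so trees and sequences of merges are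
  matched by comparing multisets. Signs are the real obstacle. The fillings of a gap, each sorted
  into the postorder of its own tree, have to show the signs of the relations:
  \<open>|I(t1)||I(t2)|\<close> comes from exchanging two blocks of the postorder, and
  \<open>|I(t3)|\<close> from the left comb, where the nodes of \<open>t3\<close> stand between two
  merges that are consecutive in the chain. All other nodes contribute a common factor. Sorting
  stays within linear extensions because in postorder no node has its block contained in the block
  of an earlier node, so the node to be placed next never depends on those it overtakes. The
  one-color and the two-color relation are handled together as a sum over the set
  \<open>{(co, ci), (ci, co)}\<close> of color pairs, which has one element if the colors agree. No
  division occurs, so the argument runs over any commutative ring.\<close>

fun list_sign :: "'a list \<Rightarrow> 'a list \<Rightarrow> 'k::comm_ring_1" where
  "list_sign xs [] = 1"
| "list_sign xs (y # ys) =
     (-1) ^ length (takeWhile (\<lambda>x. x \<noteq> y) xs) * list_sign (remove1 y xs) ys"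

lemma minus_one_power_square [simp]: "(-1) ^ k * (-1) ^ k = (1 :: 'k::comm_ring_1)"
  by (simp flip: power_mult_distrib)

lemma minus_one_power_square_left [simp]: "(-1) ^ k * ((-1) ^ k * x) = (x :: 'k::comm_ring_1)"
  by (simp flip: mult.assoc)

lemma list_sign_Cons:
  assumes "x \<notin> set us"
  shows "list_sign (us @ x # vs) (x # ys) = (-1) ^ length us * list_sign (us @ vs) ys"
proof -
  have "takeWhile (\<lambda>z. z \<noteq> x) (us @ x # vs) = us"
    using assms by (subst takeWhile_append2) auto
  then show ?thesis using assms by (simp add: remove1_append)
qed

text \<open>For distinct lists with the same elements, \<open>list_sign xs ys\<close> is the sign of
  the permutation that takes \<open>xs\<close> to \<open>ys\<close>, computed by extracting the
  elements of \<open>ys\<close> one by one. That recursion favours the head of the target; here a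
  common element is removed at arbitrary positions, with the sign of a cofactor. The sign rules
  below reduce to this.\<close>

lemma list_sign_delete:
  assumes "mset (us @ x # vs) = mset (ws @ x # zs)" and "distinct (us @ x # vs)"
  shows "list_sign (us @ x # vs) (ws @ x # zs) =
    (-1) ^ (length us + length ws) * (list_sign (us @ vs) (ws @ zs) :: 'k::comm_ring_1)"
  using assms
proof (induction ws arbitrary: us vs)
  case Nil
  then have "list_sign (us @ x # vs) (x # zs) = ((-1) ^ length us * list_sign (us @ vs) zs :: 'k)"
    by (intro list_sign_Cons) auto
  then show ?case by simp
next
  case (Cons w ws)
  have d: "distinct ((w # ws) @ x # zs)"
    using mset_eq_imp_distinct_iff[OF Cons.prems(1)] Cons.prems(2) by simp
  have "w \<in> set (us @ x # vs)"
    by (metis Cons.prems(1) append_Cons list.set_intros(1) mset_eq_setD)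
  with d consider "w \<in> set us" | "w \<in> set vs" by auto
  then show ?case
  proof cases
    \<comment> \<open>\<open>w\<close> stands before \<open>x\<close> in the source: its position is
      unaffected by the deletion, while both prefixes lose one element.\<close>
    case 1
    then obtain u1 u2 where u: "us = u1 @ w # u2" by (meson split_list)
    have "list_sign ((u1 @ u2) @ x # vs) (ws @ x # zs) =
      (-1) ^ (length (u1 @ u2) + length ws) * (list_sign ((u1 @ u2) @ vs) (ws @ zs) :: 'k)"
      by (rule Cons.IH) (use Cons.prems u in auto)
    moreover have "list_sign (u1 @ w # (u2 @ x # vs)) (w # ws @ x # zs) =
      (-1) ^ length u1 * (list_sign (u1 @ u2 @ x # vs) (ws @ x # zs) :: 'k)"
      using Cons.prems(2) u by (intro list_sign_Cons) auto
    moreover have "list_sign (u1 @ w # (u2 @ vs)) (w # ws @ zs) =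
      (-1) ^ length u1 * (list_sign (u1 @ u2 @ vs) (ws @ zs) :: 'k)"
      using Cons.prems(2) u by (intro list_sign_Cons) auto
    ultimately show ?thesis using u by (simp add: power_add mult_ac)
  next
    \<comment> \<open>\<open>w\<close> stands after \<open>x\<close>: the deletion shifts its
      position by one, which pays for the one element by which \<open>ws\<close> is shorter.\<close>
    case 2
    then obtain v1 v2 where v: "vs = v1 @ w # v2" by (meson split_list)
    have "list_sign (us @ x # (v1 @ v2)) (ws @ x # zs) =
      (-1) ^ (length us + length ws) * (list_sign (us @ (v1 @ v2)) (ws @ zs) :: 'k)"
      by (rule Cons.IH) (use Cons.prems v in auto)
    moreover have "list_sign ((us @ x # v1) @ w # v2) (w # ws @ x # zs) =
      (-1) ^ length (us @ x # v1) * (list_sign ((us @ x # v1) @ v2) (ws @ x # zs) :: 'k)"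
      using Cons.prems(2) v d by (intro list_sign_Cons) auto
    moreover have "list_sign ((us @ v1) @ w # v2) (w # ws @ zs) =
      (-1) ^ length (us @ v1) * (list_sign ((us @ v1) @ v2) (ws @ zs) :: 'k)"
      using Cons.prems(2) v d by (intro list_sign_Cons) auto
    ultimately show ?thesis using v by (simp add: power_add mult_ac)
  qed
qed

lemma list_sign_self: "distinct xs \<Longrightarrow> list_sign xs xs = 1"
  by (induction xs) auto

text \<open>An element of \<open>as\<close> that is moved past \<open>bs\<close> changes its
  position in the target by \<open>length bs\<close>; deleting it from both lists leaves a shorter
  instance. This is the origin of the sign \<open>|I(t1)||I(t2)|\<close>.\<close>

lemma list_sign_swap_blocks:
  assumes "mset xs = mset (us @ as @ bs @ vs)" and "distinct xs"
  shows "list_sign xs (us @ as @ bs @ vs) =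
    (-1) ^ (length as * length bs) * (list_sign xs (us @ bs @ as @ vs) :: 'k::comm_ring_1)"
  using assms
proof (induction as arbitrary: xs)
  case Nil
  then show ?case by simp
next
  case (Cons a as)
  have "a \<in> set xs" using mset_eq_setD[OF Cons.prems(1)] by simp
  then obtain x1 x2 where x: "xs = x1 @ a # x2" by (meson split_list)
  have "list_sign (x1 @ a # x2) (us @ a # (as @ bs @ vs)) =
    (-1) ^ (length x1 + length us) * (list_sign (x1 @ x2) (us @ (as @ bs @ vs)) :: 'k)"
    using Cons.prems x by (intro list_sign_delete) auto
  moreover have "list_sign (x1 @ a # x2) ((us @ bs) @ a # (as @ vs)) =
    (-1) ^ (length x1 + length (us @ bs)) * (list_sign (x1 @ x2) ((us @ bs) @ (as @ vs)) :: 'k)"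
    using Cons.prems x by (intro list_sign_delete) auto
  moreover have "list_sign (x1 @ x2) (us @ as @ bs @ vs) =
    (-1) ^ (length as * length bs) * (list_sign (x1 @ x2) (us @ bs @ as @ vs) :: 'k)"
    by (rule Cons.IH) (use Cons.prems x in auto)
  ultimately show ?case using x by (simp add: power_add mult_ac)
qed

text \<open>Deleting \<open>x\<close> leaves the same lists on both sides, and its positions in the
  two sources differ by one. Here the source changes, not the target: two orders of the same merges
  are compared with one postorder.\<close>

lemma list_sign_swap_adjacent:
  assumes "mset (us @ x # y # vs) = mset ys" and "distinct ys"
  shows "list_sign (us @ y # x # vs) ys = - (list_sign (us @ x # y # vs) ys :: 'k::comm_ring_1)"
proof -
  have "x \<in> set ys" using mset_eq_setD[OF assms(1)] by auto
  then obtain ws zs where y: "ys = ws @ x # zs" by (meson split_list)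
  have d: "distinct (us @ x # y # vs)"
    using mset_eq_imp_distinct_iff[OF assms(1)] assms(2) by simp
  have "list_sign (us @ x # (y # vs)) (ws @ x # zs) =
    (-1) ^ (length us + length ws) * (list_sign (us @ y # vs) (ws @ zs) :: 'k)"
    using assms y d by (intro list_sign_delete) auto
  moreover have "list_sign ((us @ [y]) @ x # vs) (ws @ x # zs) =
    (-1) ^ (length (us @ [y]) + length ws) * (list_sign ((us @ [y]) @ vs) (ws @ zs) :: 'k)"
    using assms y d by (intro list_sign_delete) auto
  ultimately show ?thesis using y by (simp add: power_add)
qed

section \<open>Postorder and contexts\<close>

text \<open>The block created by a merge; it identifies the node within its tree.\<close>

definition union_of :: "color \<times> 'a set \<times> 'a set \<Rightarrow> 'a set" where
  "union_of m = fst (snd m) \<union> snd (snd m)"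

lemma union_of_simp [simp]: "union_of (c, A, B) = A \<union> B"
  by (simp add: union_of_def)

lemma leaves_nonempty [simp]: "leaves T \<noteq> []"
  by (induction T) auto

lemma length_postorder [simp]: "length (postorder T) = num_internal T"
  by (induction T) auto

lemma postorder_parts:
  assumes "(c, A, B) \<in> set (postorder T)" and "distinct (leaves T)"
  shows "A \<noteq> {}" "B \<noteq> {}" "A \<inter> B = {}" "A \<union> B \<subseteq> set (leaves T)"
  using assms by (induction T) auto

lemma postorder_union_subset: "m \<in> set (postorder T) \<Longrightarrow> union_of m \<subseteq> set (leaves T)"
  by (induction T) auto

lemma postorder_union_nonempty: "m \<in> set (postorder T) \<Longrightarrow> union_of m \<noteq> {}"
  by (induction T) auto

text \<open>Nodes in different subtrees have disjoint nonempty blocks, and an ancestor, which comes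
  later, has a strictly larger one. This order property yields distinctness of the nodes,
  injectivity of \<open>union_of\<close> and, later, the admissibility of the moves that sort a
  linear extension.\<close>

lemma postorder_sorted:
  "distinct (leaves T) \<Longrightarrow> sorted_wrt (\<lambda>x y. \<not> union_of y \<subseteq> union_of x) (postorder T)"
proof (induction T)
  case (Leaf a)
  then show ?case by simp
next
  case (Node c l r)
  have "\<not> union_of y \<subseteq> union_of x"
    if "x \<in> set (postorder l)" "y \<in> set (postorder r)" for x y
    using that Node.prems postorder_union_subset[of x l] postorder_union_subset[of y r]
      postorder_union_nonempty[of y r] by fastforce
  moreover have "\<not> union_of (c, set (leaves l), set (leaves r)) \<subseteq> union_of x"
    if "x \<in> set (postorder l) \<or> x \<in> set (postorder r)" for x
  proof -
    \<comment> \<open>One leaf from each side shows that the block of the root fits into neither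
      subtree.\<close>
    have "hd (leaves l) \<in> set (leaves l)" "hd (leaves l) \<notin> set (leaves r)"
      "hd (leaves r) \<in> set (leaves r)" "hd (leaves r) \<notin> set (leaves l)"
      using Node.prems by (auto simp: disjoint_iff dest: hd_in_set)
    moreover have "union_of x \<subseteq> set (leaves l) \<or> union_of x \<subseteq> set (leaves r)"
      using that postorder_union_subset[of x l] postorder_union_subset[of x r] by argo
    ultimately show ?thesis unfolding union_of_simp by (meson UnI1 UnI2 subsetD)
  qed
  moreover have "sorted_wrt (\<lambda>x y. \<not> union_of y \<subseteq> union_of x) (postorder l)"
    "sorted_wrt (\<lambda>x y. \<not> union_of y \<subseteq> union_of x) (postorder r)"
    using Node by simp_all
  ultimately show ?case
    unfolding postorder.simps sorted_wrt_append sorted_wrt1 set_append list.set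
    by blast
qed

lemma distinct_postorder:
  assumes "distinct (leaves T)"
  shows "distinct (postorder T)"
proof -
  have "postorder T ! i \<noteq> postorder T ! j" if "i < j" "j < length (postorder T)" for i j
    using sorted_wrt_nth_less[OF postorder_sorted[OF assms] that] by auto
  then show ?thesis
    unfolding distinct_conv_nth by (metis linorder_neqE_nat)
qed

lemma inj_union_of_postorder:
  assumes "distinct (leaves T)"
  shows "inj_on union_of (set (postorder T))"
proof (rule inj_onI)
  fix x y
  assume x: "x \<in> set (postorder T)" and y: "y \<in> set (postorder T)" and e: "union_of x = union_of y"
  obtain i where i: "i < length (postorder T)" "x = postorder T ! i"
    using x by (metis in_set_conv_nth)
  obtain j where j: "j < length (postorder T)" "y = postorder T ! j"
    using y by (metis in_set_conv_nth)
  show "x = y"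
    using sorted_wrt_nth_less[OF postorder_sorted[OF assms]] i j e
    by (metis linorder_neqE_nat order_refl)
qed

text \<open>The root is the only node whose block is the whole leaf set, and the nodes of either
  subtree are those whose block lies in the leaf set of that child. So the nodes determine the tree
  recursively, down to single leaves.\<close>

lemma postorder_inject:
  assumes "set (postorder T) = set (postorder T')" and "set (leaves T) = set (leaves T')"
    and "distinct (leaves T)" and "distinct (leaves T')"
  shows "T = T'"
  using assms
proof (induction T arbitrary: T')
  case (Leaf a)
  then show ?case by (cases T') auto
next
  case (Node c l r)
  then obtain c' l' r' where T': "T' = Node c' l' r'" by (cases T') auto
  let ?m = "(c, set (leaves l), set (leaves r))" and ?m' = "(c', set (leaves l'), set (leaves r'))"
  have "?m \<in> set (postorder T')" using Node.prems(1) by auto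
  moreover have "?m' \<in> set (postorder T')" using T' by auto
  moreover have "union_of ?m = union_of ?m'" using Node.prems(2) T' by simp
  ultimately have m: "?m = ?m'"
    using inj_onD[OF inj_union_of_postorder[OF Node.prems(4)]] by blast
  have sub: "set (postorder t) = {m \<in> set (postorder (Node d t u)). union_of m \<subseteq> set (leaves t)}"
    "set (postorder u) = {m \<in> set (postorder (Node d t u)). union_of m \<subseteq> set (leaves u)}"
    if "distinct (leaves (Node d t u))" for d and t u :: "'a btree"
  proof -
    let ?root = "(d, set (leaves t), set (leaves u))"
    have disj: "set (leaves t) \<inter> set (leaves u) = {}" using that by simp
    have "\<not> union_of m \<subseteq> set (leaves t)" if "m \<in> set (postorder u)" for m
      using postorder_union_subset[OF that] postorder_union_nonempty[OF that] disj by blast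
    moreover have "\<not> union_of m \<subseteq> set (leaves u)" if "m \<in> set (postorder t)" for m
      using postorder_union_subset[OF that] postorder_union_nonempty[OF that] disj by blast
    moreover have "\<not> union_of ?root \<subseteq> set (leaves t)" "\<not> union_of ?root \<subseteq> set (leaves u)"
      using disj hd_in_set[OF leaves_nonempty[of t]] hd_in_set[OF leaves_nonempty[of u]]
      unfolding union_of_simp by blast+
    ultimately show
      "set (postorder t) = {m \<in> set (postorder (Node d t u)). union_of m \<subseteq> set (leaves t)}"
      "set (postorder u) = {m \<in> set (postorder (Node d t u)). union_of m \<subseteq> set (leaves u)}"
      using postorder_union_subset[of _ t] postorder_union_subset[of _ u]
      unfolding postorder.simps set_append list.set by blast+
  qed
  have "set (postorder l) = set (postorder l')" "set (postorder r) = set (postorder r')"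
    using sub[OF Node.prems(3)] sub[OF Node.prems(4)[unfolded T']] m Node.prems(1)[unfolded T']
    by (metis prod.inject)+
  then have "l = l'" "r = r'"
    using Node.IH(1)[of l'] Node.IH(2)[of r'] Node.prems(3,4) T' m by simp_all
  then show ?case using m T' by simp
qed

lemma leaves_plug: "\<exists>as bs. \<forall>X. leaves (plug C X) = as @ leaves X @ bs"
proof (induction C)
  case Hole
  show ?case by (rule exI[of _ "[]"], rule exI[of _ "[]"]) simp
next
  case (In_Left c C r)
  then show ?case by (metis append.assoc leaves.simps(2) plug.simps(2))
next
  case (In_Right c l C)
  then show ?case by (metis append.assoc leaves.simps(2) plug.simps(3))
qed

text \<open>The prefix and the suffix depend on \<open>X\<close> only through its leaf set, since
  the ancestors of the hole record leaf sets. The terms of a relation have equal leaf sets, so their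
  postorders differ only in the middle.\<close>

lemma postorder_plug:
  "\<exists>ps qs. \<forall>X. set (leaves X) = L \<longrightarrow> postorder (plug C X) = ps @ postorder X @ qs"
proof (induction C)
  case Hole
  show ?case by (rule exI[of _ "[]"], rule exI[of _ "[]"]) simp
next
  case (In_Left c C r)
  then obtain ps qs where
    IH: "\<And>X. set (leaves X) = L \<Longrightarrow> postorder (plug C X) = ps @ postorder X @ qs" by blast
  obtain as bs where l: "\<forall>X. leaves (plug C X) = as @ leaves X @ bs"
    using leaves_plug[of C] by blast
  show ?case
    by (rule exI[of _ ps],
        rule exI[of _ "qs @ postorder r @ [(c, set as \<union> L \<union> set bs, set (leaves r))]"])
      (auto simp: IH l)
next
  case (In_Right c t C)
  then obtain ps qs where
    IH: "\<And>X. set (leaves X) = L \<Longrightarrow> postorder (plug C X) = ps @ postorder X @ qs" by blast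
  obtain as bs where l: "\<forall>X. leaves (plug C X) = as @ leaves X @ bs"
    using leaves_plug[of C] by blast
  show ?case
    by (rule exI[of _ "postorder t @ ps"],
        rule exI[of _ "qs @ [(c, set (leaves t), set as \<union> L \<union> set bs)]"])
      (auto simp: IH l)
qed

lemma num_red_plug: "num_red (plug C X) + num_red Y = num_red (plug C Y) + num_red X"
  by (induction C) auto

text \<open>Carries membership over from the first term of a relation to the other terms.\<close>

lemma labeled_trees_plug:
  assumes "plug C X \<in> labeled_trees n i" and "mset (leaves Y) = mset (leaves X)"
    and "num_red Y = num_red X"
  shows "plug C Y \<in> labeled_trees n i"
proof -
  obtain as bs where l: "\<forall>X. leaves (plug C X) = as @ leaves X @ bs"
      using leaves_plug[of C] by blast
  have "mset (leaves (plug C Y)) = mset (leaves (plug C X))" using assms(2) by (simp add: l)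
  moreover have "num_red (plug C Y) = num_red (plug C X)"
    using assms(3) num_red_plug[of C X Y] by simp
  ultimately show ?thesis
    using assms(1) mset_eq_imp_distinct_iff[of "leaves (plug C Y)"] mset_eq_setD[of "leaves (plug C Y)"]
    unfolding labeled_trees_def by simp
qed

lemma postorder_find:
  assumes "(c, A, B) \<in> set (postorder T)"
  obtains C l r where "T = plug C (Node c l r)" "set (leaves l) = A" "set (leaves r) = B"
proof -
  have "\<exists>C l r. T = plug C (Node c l r) \<and> set (leaves l) = A \<and> set (leaves r) = B"
    using assms
  proof (induction T)
    case (Leaf a)
    then show ?case by simp
  next
    case (Node d t u)
    then consider "(c, A, B) \<in> set (postorder t)" | "(c, A, B) \<in> set (postorder u)"
      | "c = d" "A = set (leaves t)" "B = set (leaves u)" by auto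
    then show ?case
    proof cases
      case 1
      then show ?thesis using Node.IH(1) by (metis plug.simps(2))
    next
      case 2
      then show ?thesis using Node.IH(2) by (metis plug.simps(3))
    next
      case 3
      then show ?thesis by (metis plug.simps(1))
    qed
  qed
  then show ?thesis using that by blast
qed

section \<open>Weighted partitions\<close>

text \<open>The part of being a weighted partition on which the computations with merges rest. It
  also excludes two elements with the same block and different weights, as blocks are
  nonempty.\<close>

definition disjoint_blocks :: "weighted_partition \<Rightarrow> bool" where
  "disjoint_blocks W \<longleftrightarrow>
     (\<forall>x\<in>W. fst x \<noteq> {}) \<and> (\<forall>x\<in>W. \<forall>y\<in>W. x \<noteq> y \<longrightarrow> fst x \<inter> fst y = {})"

lemma disjoint_blocks_eqI:
  "disjoint_blocks W \<Longrightarrow> x \<in> W \<Longrightarrow> y \<in> W \<Longrightarrow> e \<in> fst x \<Longrightarrow> e \<in> fst y \<Longrightarrow> x = y"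
  unfolding disjoint_blocks_def by blast

lemma disjoint_blocks_subset_eqI:
  "disjoint_blocks W \<Longrightarrow> x \<in> W \<Longrightarrow> y \<in> W \<Longrightarrow> fst x \<subseteq> fst y \<Longrightarrow> x = y"
  unfolding disjoint_blocks_def by blast

lemma weighted_partitions_iff:
  "W \<in> weighted_partitions n \<longleftrightarrow>
     disjoint_blocks W \<and> \<Union> (fst ` W) = {1..n} \<and> (\<forall>x\<in>W. snd x \<le> card (fst x) - 1)"
proof
  assume W: "W \<in> weighted_partitions n"
  have part: "partition_on {1..n} (fst ` W)" and inj: "inj_on fst W"
    using W by (simp_all add: weighted_partitions_def)
  have "fst x \<inter> fst y = {}" if "x \<in> W" "y \<in> W" "x \<noteq> y" for x y
    using disjointD[OF partition_onD2[OF part], of "fst x" "fst y"] inj_onD[OF inj, of x y] that by blast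
  moreover have "fst x \<noteq> {}" if "x \<in> W" for x
    using partition_onD3[OF part] that by (metis imageI)
  moreover have "\<Union> (fst ` W) = {1..n}" using partition_onD1[OF part] by simp
  moreover have "snd x \<le> card (fst x) - 1" if "x \<in> W" for x
    using W that by (auto simp: weighted_partitions_def)
  ultimately show "disjoint_blocks W \<and> \<Union> (fst ` W) = {1..n} \<and> (\<forall>x\<in>W. snd x \<le> card (fst x) - 1)"
    unfolding disjoint_blocks_def by blast
next
  assume W: "disjoint_blocks W \<and> \<Union> (fst ` W) = {1..n} \<and> (\<forall>x\<in>W. snd x \<le> card (fst x) - 1)"
  have "inj_on fst W"
    using W disjoint_blocks_subset_eqI by (metis (no_types, lifting) inj_onI order_refl)
  moreover have "partition_on {1..n} (fst ` W)"
  proof (rule partition_onI)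
    fix p q assume "p \<in> fst ` W" "q \<in> fst ` W" "p \<noteq> q"
    then obtain x y where "x \<in> W" "y \<in> W" "p = fst x" "q = fst y" "x \<noteq> y" by auto
    then show "disjnt p q" using W unfolding disjoint_blocks_def disjnt_def by metis
  next
    show "{} \<notin> fst ` W" using W unfolding disjoint_blocks_def by blast
  qed (use W in simp)
  ultimately show "W \<in> weighted_partitions n"
    using W by (auto simp: weighted_partitions_def)
qed

lemma weighted_partitions_finite:
  assumes "W \<in> weighted_partitions n" shows "finite W"
proof -
  have "finite (fst ` W)" using assms
    by (auto simp: weighted_partitions_def intro: finite_elements)
  then show ?thesis using assms by (auto simp: weighted_partitions_def finite_image_iff)
qed

text \<open>If \<open>V\<close> refines \<open>W\<close> and \<open>y\<close> is a block of
  \<open>W\<close>, this is the fibre over \<open>y\<close>.\<close>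

definition below :: "weighted_partition \<Rightarrow> nat set \<times> nat \<Rightarrow> weighted_partition" where
  "below V y = {x \<in> V. fst x \<subseteq> fst y}"

definition refining :: "weighted_partition \<Rightarrow> weighted_partition \<Rightarrow> bool" where
  "refining V W \<longleftrightarrow> (\<forall>x\<in>V. \<exists>y\<in>W. fst x \<subseteq> fst y)"

lemma Union_below:
  assumes "V \<in> weighted_partitions n" "W \<in> weighted_partitions n" "refining V W" "y \<in> W"
  shows "\<Union> (fst ` below V y) = fst y"
proof
  show "fst y \<subseteq> \<Union> (fst ` below V y)"
  proof
    fix e assume e: "e \<in> fst y"
    then have "e \<in> {1..n}" using assms(2,4) unfolding weighted_partitions_iff by blast
    then obtain x where x: "x \<in> V" "e \<in> fst x"
      using assms(1) unfolding weighted_partitions_iff by blast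
    then obtain y' where y': "y' \<in> W" "fst x \<subseteq> fst y'" using assms(3) unfolding refining_def by blast
    then have "y' = y"
      using disjoint_blocks_eqI[of W y' y e] assms(2,4) e x unfolding weighted_partitions_iff by blast
    then show "e \<in> \<Union> (fst ` below V y)" using x y' unfolding below_def by blast
  qed
qed (auto simp: below_def)

text \<open>The order quantifies over all \<open>S\<close> in \<open>V\<close> whose union is a
  given block of \<open>W\<close>; under refinement the fibre is the only such \<open>S\<close>. The
  integer interval becomes two inequalities of natural numbers without subtraction.\<close>

lemma wp_le_iff:
  assumes V: "V \<in> weighted_partitions n" and W: "W \<in> weighted_partitions n"
  shows "wp_le n V W \<longleftrightarrow> refining V W \<and>
    (\<forall>y\<in>W. sum snd (below V y) \<le> snd y \<and> snd y < sum snd (below V y) + card (below V y))"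
proof -
  have r: "refines {1..n} (fst ` V) (fst ` W) \<longleftrightarrow> refining V W"
    using V W by (auto simp: refines_def refining_def weighted_partitions_def)
  have S: "S \<subseteq> V \<and> fst y = \<Union> (fst ` S) \<longleftrightarrow> S = below V y" if "refining V W" "y \<in> W" for S y
  proof
    assume S: "S \<subseteq> V \<and> fst y = \<Union> (fst ` S)"
    have "x \<in> S" if x: "x \<in> below V y" for x
    proof -
      have "fst x \<noteq> {}" "x \<in> V" "fst x \<subseteq> fst y"
        using x V unfolding below_def weighted_partitions_iff disjoint_blocks_def by auto
      then obtain e where e: "e \<in> fst x" "e \<in> fst y" by blast
      then obtain x' where "x' \<in> S" "e \<in> fst x'" using S by blast
      then show ?thesis
        using disjoint_blocks_eqI[of V x x' e] S V e \<open>x \<in> V\<close> unfolding weighted_partitions_iff by blast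
    qed
    then show "S = below V y" using S unfolding below_def by blast
  next
    assume "S = below V y"
    then show "S \<subseteq> V \<and> fst y = \<Union> (fst ` S)"
      using Union_below[OF V W that] by (auto simp: below_def)
  qed
  have i: "int v - (\<Sum>(A, w)\<in>T. int w) \<in> {0..int (card T) - 1} \<longleftrightarrow>
      sum snd T \<le> v \<and> v < sum snd T + card T" for v :: nat and T :: weighted_partition
  proof -
    have "(\<Sum>(A, w)\<in>T. int w) = int (sum snd T)"
      by (simp add: case_prod_unfold)
    then show ?thesis by (auto simp del: of_nat_sum)
  qed
  have "(\<forall>(B, v)\<in>W. \<forall>S\<subseteq>V. B = \<Union> (fst ` S) \<longrightarrow>
        int v - (\<Sum>(A, w)\<in>S. int w) \<in> {0..int (card S) - 1}) \<longleftrightarrow>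
    (\<forall>y\<in>W. sum snd (below V y) \<le> snd y \<and> snd y < sum snd (below V y) + card (below V y))"
    if "refining V W"
  proof -
    have "(\<forall>S\<subseteq>V. fst y = \<Union> (fst ` S) \<longrightarrow>
        int (snd y) - (\<Sum>(A, w)\<in>S. int w) \<in> {0..int (card S) - 1}) \<longleftrightarrow>
      sum snd (below V y) \<le> snd y \<and> snd y < sum snd (below V y) + card (below V y)"
      if y: "y \<in> W" for y
      using S[OF \<open>refining V W\<close> y] unfolding i by metis
    then show ?thesis by (simp add: case_prod_unfold)
  qed
  then show ?thesis unfolding wp_le_def r by blast
qed

lemma finite_below: "V \<in> weighted_partitions n \<Longrightarrow> finite (below V y)"
  using weighted_partitions_finite by (auto simp: below_def)

text \<open>Fibres compose, so sums of weights and numbers of blocks add up over the intermediate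
  blocks.\<close>

lemma wp_le_trans:
  assumes U: "U \<in> weighted_partitions n" and V: "V \<in> weighted_partitions n"
    and W: "W \<in> weighted_partitions n" and UV: "wp_le n U V" and VW: "wp_le n V W"
  shows "wp_le n U W"
proof -
  note uv = UV[unfolded wp_le_iff[OF U V]] and vw = VW[unfolded wp_le_iff[OF V W]]
  have r: "refining U W" using uv vw unfolding refining_def by (meson order_trans)
  have "sum snd (below U z) \<le> snd z \<and> snd z < sum snd (below U z) + card (below U z)"
    if z: "z \<in> W" for z
  proof -
    have split: "below U z = (\<Union>y\<in>below V z. below U y)"
    proof -
      have "x \<in> (\<Union>y\<in>below V z. below U y)" if x: "x \<in> below U z" for x
      proof -
        have "x \<in> U" using x by (simp add: below_def)
        then obtain y where y: "y \<in> V" "fst x \<subseteq> fst y" using uv unfolding refining_def by blast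
        then obtain z' where z': "z' \<in> W" "fst y \<subseteq> fst z'" using vw unfolding refining_def by blast
        obtain e where "e \<in> fst x"
          using \<open>x \<in> U\<close> U unfolding weighted_partitions_iff disjoint_blocks_def by blast
        then have "z' = z"
          using disjoint_blocks_eqI[of W z' z e] y z z' x W
          unfolding weighted_partitions_iff below_def by blast
        then show ?thesis using y z' \<open>x \<in> U\<close> unfolding below_def by blast
      qed
      then show ?thesis unfolding below_def by blast
    qed
    have disj: "below U y \<inter> below U y' = {}" if "y \<in> below V z" "y' \<in> below V z" "y \<noteq> y'" for y y'
    proof -
      have "fst y \<inter> fst y' = {}"
        using that V unfolding below_def weighted_partitions_iff disjoint_blocks_def by blast
      then have "fst x = {}" if "fst x \<subseteq> fst y" "fst x \<subseteq> fst y'" for x :: "nat set \<times> nat"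
        using that by blast
      moreover have "fst x \<noteq> {}" if "x \<in> U" for x
        using U that unfolding weighted_partitions_iff disjoint_blocks_def by blast
      ultimately show ?thesis unfolding below_def by blast
    qed
    have s: "sum snd (below U z) = (\<Sum>y\<in>below V z. sum snd (below U y))"
      unfolding split by (rule sum.UNION_disjoint) (use finite_below U V disj in auto)
    have c: "card (below U z) = (\<Sum>y\<in>below V z. card (below U y))"
      unfolding split by (rule card_UN_disjoint) (use finite_below U V disj in auto)
    have 1: "(\<Sum>y\<in>below V z. sum snd (below U y)) \<le> sum snd (below V z)"
      using uv by (intro sum_mono) (auto simp: below_def)
    \<comment> \<open>The strict upper bound is used in the form \<open>snd y + 1 \<le> ...\<close>:
      summed over the fibre, the ones count its blocks, and the bounds of the two relations chain
      together.\<close>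
    have "(\<Sum>y\<in>below V z. snd y + 1) \<le> (\<Sum>y\<in>below V z. sum snd (below U y) + card (below U y))"
      by (intro sum_mono) (use uv in \<open>auto simp: below_def Suc_le_eq\<close>)
    then have 2: "sum snd (below V z) + card (below V z) \<le> sum snd (below U z) + card (below U z)"
      by (simp only: sum.distrib s c) simp
    show ?thesis using 1 2 s vw z by fastforce
  qed
  then show ?thesis unfolding wp_le_iff[OF U W] using r by blast
qed

section \<open>Merging two blocks and the covering relation\<close>

definition block_join :: "color \<Rightarrow> nat set \<times> nat \<Rightarrow> nat set \<times> nat \<Rightarrow> nat set \<times> nat" where
  "block_join c x y = (fst x \<union> fst y, snd x + snd y + color_weight c)"

text \<open>\<open>merge\<close> names blocks by their underlying sets, as a tree does. This version
  takes the weighted blocks themselves, so that merging is one deletion and one insertion.\<close>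

definition merge_pair ::
  "color \<Rightarrow> nat set \<times> nat \<Rightarrow> nat set \<times> nat \<Rightarrow> weighted_partition \<Rightarrow> weighted_partition" where
  "merge_pair c x y W = insert (block_join c x y) (W - {x, y})"

lemma fst_block_join [simp]: "fst (block_join c x y) = fst x \<union> fst y"
  by (simp add: block_join_def)

lemma snd_block_join [simp]: "snd (block_join c x y) = snd x + snd y + color_weight c"
  by (simp add: block_join_def)

lemma block_join_commute: "block_join c x y = block_join c y x"
  by (auto simp: block_join_def)

lemma merge_pair_commute: "merge_pair c x y W = merge_pair c y x W"
  by (simp add: merge_pair_def block_join_commute insert_commute)

lemma color_weight_le: "color_weight c \<le> 1"
  by (cases c) auto

text \<open>When blocks are nonempty and disjoint, the underlying set determines the weight, so the
  comprehension in \<open>merge\<close> yields a single block.\<close>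

lemma merge_eq_merge_pair:
  assumes W: "disjoint_blocks W" and "x \<in> W" "y \<in> W"
  shows "merge (color_weight c) (fst x) (fst y) W = merge_pair c x y W"
proof -
  have x: "z = x" if "z \<in> W" "fst z = fst x" for z
    using disjoint_blocks_subset_eqI[OF W that(1) assms(2)] that by simp
  have y: "z = y" if "z \<in> W" "fst z = fst y" for z
    using disjoint_blocks_subset_eqI[OF W that(1) assms(3)] that by simp
  have "{(X, w) \<in> W. X \<noteq> fst x \<and> X \<noteq> fst y} = W - {x, y}"
  proof -
    have "z \<in> {(X, w) \<in> W. X \<noteq> fst x \<and> X \<noteq> fst y} \<longleftrightarrow> z \<in> W - {x, y}" for z
      using x[of z] y[of z] by (cases z) auto
    then show ?thesis unfolding set_eq_iff by blast
  qed
  moreover have "{(fst x \<union> fst y, a + b + color_weight c) | a b. (fst x, a) \<in> W \<and> (fst y, b) \<in> W} =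
      {block_join c x y}"
  proof -
    have "(fst x, a) \<in> W \<longleftrightarrow> a = snd x" "(fst y, a) \<in> W \<longleftrightarrow> a = snd y" for a
      using x[of "(fst x, a)"] y[of "(fst y, a)"] assms by (metis prod.collapse fst_conv snd_conv)+
    then show ?thesis by (simp add: block_join_def)
  qed
  ultimately show ?thesis unfolding merge_def merge_pair_def by simp
qed

lemma block_join_notin:
  assumes "disjoint_blocks W" "x \<in> W" "y \<in> W" "x \<noteq> y"
  shows "block_join c x y \<notin> W"
  using assms disjoint_blocks_subset_eqI[of W x "block_join c x y"]
    disjoint_blocks_subset_eqI[of W y "block_join c x y"] by auto

lemma merge_pair_disjoint_blocks:
  assumes "disjoint_blocks W" "x \<in> W" "y \<in> W"
  shows "disjoint_blocks (merge_pair c x y W)"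
  using assms unfolding disjoint_blocks_def merge_pair_def by (auto 0 3)

lemma merge_pair_weighted_partition:
  assumes W: "W \<in> weighted_partitions n" and x: "x \<in> W" and y: "y \<in> W" and "x \<noteq> y"
  shows "merge_pair c x y W \<in> weighted_partitions n"
proof -
  have "fst x \<noteq> {}" "fst y \<noteq> {}" "fst x \<subseteq> {1..n}" "fst y \<subseteq> {1..n}" "fst x \<inter> fst y = {}"
    "snd x \<le> card (fst x) - 1" "snd y \<le> card (fst y) - 1"
    using assms unfolding weighted_partitions_iff disjoint_blocks_def by auto
  moreover from this have "card (fst x) > 0" "card (fst y) > 0"
    by (meson card_gt_0_iff finite_atLeastAtMost finite_subset)+
  moreover have "card (fst x \<union> fst y) = card (fst x) + card (fst y)"
    using calculation(3-5) by (meson card_Un_disjoint finite_atLeastAtMost finite_subset)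
  \<comment> \<open>\<open>(|A| - 1) + (|B| - 1) + 1 = |A| + |B| - 1\<close>, where positive
    cardinalities make the truncated subtraction exact.\<close>
  ultimately have "snd (block_join c x y) \<le> card (fst (block_join c x y)) - 1"
    using color_weight_le[of c] by simp
  then have w: "\<forall>z\<in>merge_pair c x y W. snd z \<le> card (fst z) - 1"
    using W unfolding weighted_partitions_iff merge_pair_def by blast
  have "\<Union> (fst ` merge_pair c x y W) = \<Union> (fst ` W)"
    unfolding merge_pair_def using x y by auto
  then show ?thesis
    using merge_pair_disjoint_blocks[OF _ x y] W w unfolding weighted_partitions_iff by simp
qed

text \<open>Up to a reflection, the number of blocks serves as the rank function of the
  poset.\<close>

lemma card_merge_pair:
  assumes "W \<in> weighted_partitions n" "x \<in> W" "y \<in> W" "x \<noteq> y"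
  shows "card W = Suc (card (merge_pair c x y W))"
proof -
  have "finite W" using assms weighted_partitions_finite by blast
  moreover have "block_join c x y \<notin> W" using block_join_notin assms unfolding
      weighted_partitions_iff by blast
  moreover have "card (W - {x, y}) = card W - 2" using assms calculation by (simp add: card_Diff_subset)
  moreover have "card W \<ge> 2" using assms calculation card_mono[of W "{x, y}"] by simp
  ultimately show ?thesis unfolding merge_pair_def by simp
qed

lemma wp_less_merge_pair:
  assumes V: "V \<in> weighted_partitions n" and x: "x \<in> V" and y: "y \<in> V" and xy: "x \<noteq> y"
  shows "wp_less n V (merge_pair c x y V)"
proof -
  let ?W = "merge_pair c x y V"
  have D: "disjoint_blocks V" using V unfolding weighted_partitions_iff by blast
  have W: "?W \<in> weighted_partitions n" using merge_pair_weighted_partition[OF assms] .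
  have r: "refining V ?W" unfolding refining_def merge_pair_def
    by (auto 0 3)
  have "sum snd (below V z) \<le> snd z \<and> snd z < sum snd (below V z) + card (below V z)"
    if z: "z \<in> ?W" for z
  proof (cases "z = block_join c x y")
    case True
    have "w = x \<or> w = y" if w: "w \<in> V" "fst w \<subseteq> fst x \<union> fst y" for w
    proof -
      obtain e where "e \<in> fst w" using w D unfolding disjoint_blocks_def by blast
      then show ?thesis using disjoint_blocks_eqI[OF D w(1) x] disjoint_blocks_eqI[OF D w(1) y] w by blast
    qed
    then have "below V z = {x, y}" using x y True by (auto simp: below_def)
    then show ?thesis using xy True color_weight_le[of c] by simp
  next
    case False
    then have "z \<in> V" using z by (auto simp: merge_pair_def)
    then have "below V z = {z}"
      unfolding below_def using disjoint_blocks_subset_eqI[OF D] by blast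
    then show ?thesis by simp
  qed
  then have "wp_le n V ?W" using r by (simp add: wp_le_iff[OF V W])
  moreover have "V \<noteq> ?W" using card_merge_pair[OF assms] by (metis n_not_Suc_n)
  ultimately show ?thesis by (simp add: wp_less_def)
qed

text \<open>Let \<open>p\<close> send a block of \<open>V\<close> to the block of \<open>W\<close>
  around it. It is onto, and if it were injective, the weights would agree as well and
  \<open>V = W\<close>; hence the number of blocks drops. If it drops by one, exactly one fibre has
  two blocks, and the weight condition leaves 0 or 1 as excess weight, which is the color of a
  merge.\<close>

lemma wp_less_card:
  assumes V: "V \<in> weighted_partitions n" and W: "W \<in> weighted_partitions n" and VW: "wp_less n V W"
  shows "card W < card V"
    and "card V = Suc (card W) \<Longrightarrow> \<exists>c. \<exists>x\<in>V. \<exists>y\<in>V. x \<noteq> y \<and> W = merge_pair c x y V"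
proof -
  have r: "refining V W" and
    wt: "\<And>y. y \<in> W \<Longrightarrow> sum snd (below V y) \<le> snd y \<and> snd y < sum snd (below V y) + card (below V y)"
    and ne: "V \<noteq> W"
    using VW unfolding wp_less_def wp_le_iff[OF V W] by blast+
  have DV: "disjoint_blocks V" and DW: "disjoint_blocks W" using V W unfolding
      weighted_partitions_iff by blast+
  have fin: "finite V" "finite W" using weighted_partitions_finite V W by blast+
  obtain p where p: "\<And>x. x \<in> V \<Longrightarrow> p x \<in> W \<and> fst x \<subseteq> fst (p x)"
    using r unfolding refining_def by metis
  have fib: "below V y = {x \<in> V. p x = y}" if "y \<in> W" for y
  proof -
    have "p x = y" if x: "x \<in> V" "fst x \<subseteq> fst y" for x
    proof -
      obtain e where "e \<in> fst x" using x DV unfolding disjoint_blocks_def by blast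
      then show ?thesis using disjoint_blocks_eqI[OF DW _ \<open>y \<in> W\<close>, of "p x" e] p[OF x(1)] x by blast
    qed
    then show ?thesis unfolding below_def using p by blast
  qed
  have surj: "p ` V = W"
  proof -
    have "y \<in> p ` V" if y: "y \<in> W" for y
    proof -
      \<comment> \<open>An empty fibre would require a weight \<open>v\<close> with
        \<open>0 \<le> v < 0\<close>.\<close>
      have "below V y \<noteq> {}" using wt[OF y] by force
      then obtain x where "x \<in> V" "p x = y" using fib[OF y] by blast
      then show ?thesis by blast
    qed
    then show ?thesis using p by blast
  qed
  have single: "p x = x" if x: "x \<in> V" and f: "below V (p x) = {x}" for x
  proof -
    have "fst (p x) = fst x" using Union_below[OF V W r, of "p x"] p[OF x] f by simp
    moreover have "snd (p x) = snd x" using wt[of "p x"] p[OF x] f by simp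
    ultimately show ?thesis by (simp add: prod_eq_iff)
  qed
  have ninj: "\<not> inj_on p V"
  proof
    assume i: "inj_on p V"
    have "p x = x" if x: "x \<in> V" for x
    proof -
      have "{z \<in> V. p z = p x} = {x}" using inj_onD[OF i] x by blast
      then show ?thesis using single[OF x] fib p[OF x] by simp
    qed
    then show False using surj ne by auto
  qed
  then show "card W < card V"
    using surj fin card_image_le[of V p] inj_on_iff_eq_card[of V p] by fastforce
  from ninj obtain x y where xy: "x \<in> V" "y \<in> V" "x \<noteq> y" "p x = p y"
    unfolding inj_on_def by blast
  assume c: "card V = Suc (card W)"
  have s': "p ` (V - {y}) = W"
  proof -
    have "p z \<in> p ` (V - {y})" if "z \<in> V" for z
      using imageI[of x "V - {y}" p] imageI[of z "V - {y}" p] that xy by (cases "z = y") auto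
    then show ?thesis using surj by blast
  qed
  \<comment> \<open>A surjection between finite sets of equal size; so \<open>x\<close> and
    \<open>y\<close> form the only nontrivial fibre.\<close>
  have i: "inj_on p (V - {y})"
    using s' c fin xy by (intro eq_card_imp_inj_on) auto
  have fz: "below V (p x) = {x, y}"
  proof -
    have "z = x \<or> z = y" if "z \<in> V" "p z = p x" for z
      using inj_onD[OF i, of z x] that xy by blast
    then show ?thesis using fib[of "p x"] p xy by auto
  qed
  have pz: "fst (p x) = fst x \<union> fst y" using Union_below[OF V W r, of "p x"] p xy fz by auto
  have "snd x + snd y \<le> snd (p x)" "snd (p x) < snd x + snd y + 2"
    using wt[of "p x"] p xy fz by auto
  then have "\<exists>c. snd (p x) = snd x + snd y + color_weight c"
    by (metis add.right_neutral add_2_eq_Suc' add_Suc_right color_weight.simps le_neq_implies_less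
        less_SucE less_antisym not_less One_nat_def)
  then obtain d where d: "p x = block_join d x y" using pz by (auto simp: prod_eq_iff)
  have o: "p z = z" if "z \<in> V - {x, y}" for z
  proof -
    have "p z \<noteq> p x" using that inj_onD[OF i, of z x] xy by blast
    then have "u = z" if "u \<in> V" "p u = p z" for u
      using that \<open>z \<in> V - {x, y}\<close> inj_onD[OF i, of u z] xy by (cases "u = y") auto
    then have "{u \<in> V. p u = p z} = {z}" using that by blast
    then have "below V (p z) = {z}" using fib[of "p z"] p[of z] that by simp
    then show ?thesis using single that by blast
  qed
  have "V - {y} = insert x (V - {x, y})" using xy by auto
  then have "W = insert (p x) (p ` (V - {x, y}))" using s' by (metis image_insert)
  also have "p ` (V - {x, y}) = V - {x, y}" using o by auto
  finally have "W = merge_pair d x y V" using d by (simp add: merge_pair_def)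
  then show "\<exists>c. \<exists>x\<in>V. \<exists>y\<in>V. x \<noteq> y \<and> W = merge_pair c x y V" using xy by blast
qed

text \<open>Strictness survives because the number of blocks decreases strictly.\<close>

lemma wp_less_trans:
  assumes "U \<in> weighted_partitions n" "V \<in> weighted_partitions n" "W \<in> weighted_partitions n"
    and "wp_less n U V" "wp_less n V W"
  shows "wp_less n U W"
  using assms wp_le_trans[of U n V W] wp_less_card(1)[of U n V] wp_less_card(1)[of V n W]
  unfolding wp_less_def by fastforce

section \<open>Elements between a weighted partition and one two ranks above\<close>

text \<open>A block of \<open>V\<close> inside the union of two blocks is one of them, so the union
  determines the pair; the weight then determines the color.\<close>

lemma block_join_inject:
  assumes D: "disjoint_blocks V" and V: "x \<in> V" "y \<in> V" "a \<in> V" "b \<in> V"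
    and ne: "x \<noteq> y" "a \<noteq> b" and eq: "block_join c x y = block_join d a b"
  shows "{x, y} = {a, b} \<and> c = d"
proof -
  have f: "fst x \<union> fst y = fst a \<union> fst b" using arg_cong[OF eq, of fst] by simp
  have in2: "u = v \<or> u = w" if "u \<in> V" "v \<in> V" "w \<in> V" "fst u \<subseteq> fst v \<union> fst w" for u v w
  proof -
    have "fst u \<noteq> {}" using D that(1) unfolding disjoint_blocks_def by blast
    then obtain e where "e \<in> fst u" by blast
    then show ?thesis
      using disjoint_blocks_eqI[OF D that(1,2), of e] disjoint_blocks_eqI[OF D that(1,3), of e] that(4)
      by blast
  qed
  have "x = a \<or> x = b" "y = a \<or> y = b"
    using f V by (intro in2; auto)+
  then have s: "{x, y} = {a, b}" using ne by auto
  then have "snd x + snd y = snd a + snd b" using ne by (auto simp: doubleton_eq_iff)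
  then have "color_weight c = color_weight d" using arg_cong[OF eq, of snd] by simp
  then have "c = d" by (cases c; cases d) auto
  then show ?thesis using s by simp
qed

lemma merge_pair_inject:
  assumes D: "disjoint_blocks V" and V: "x \<in> V" "y \<in> V" "a \<in> V" "b \<in> V"
    and ne: "x \<noteq> y" "a \<noteq> b" and eq: "merge_pair c x y V = merge_pair d a b V"
  shows "{x, y} = {a, b} \<and> c = d"
proof (rule block_join_inject[OF D V ne])
  have "block_join c x y \<in> merge_pair d a b V" using eq by (auto simp: merge_pair_def)
  moreover have "block_join c x y \<notin> V" using block_join_notin D V ne by blast
  ultimately show "block_join c x y = block_join d a b" by (auto simp: merge_pair_def)
qed

definition between :: "nat \<Rightarrow> weighted_partition \<Rightarrow> weighted_partition \<Rightarrow> weighted_partition set" where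
  "between n V U = {\<alpha> \<in> weighted_partitions n. wp_less n V \<alpha> \<and> wp_less n \<alpha> U}"

lemma merge_pair_nested:
  assumes "disjoint_blocks V" "x \<in> V" "y \<in> V" "e \<in> V" "x \<noteq> y" "e \<noteq> x" "e \<noteq> y"
  shows "merge_pair d e (block_join c x y) (merge_pair c x y V) =
    insert (block_join d e (block_join c x y)) (V - {x, y, e})"
  using block_join_notin[of V x y c] assms by (auto simp: merge_pair_def)

lemma merge_pair_separate:
  assumes "disjoint_blocks V" "x \<in> V" "y \<in> V" "z \<in> V" "w \<in> V" "x \<noteq> y" "z \<noteq> w" "{x, y} \<inter> {z, w} = {}"
  shows "merge_pair d z w (merge_pair c x y V) =
    insert (block_join c x y) (insert (block_join d z w) (V - {x, y, z, w}))"
  using block_join_notin[of V x y c] assms by (auto simp: merge_pair_def)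

lemma block_join_nested_notin:
  assumes D: "disjoint_blocks V" and xy: "x \<in> V" "y \<in> V" "x \<noteq> y"
  shows "block_join d e (block_join c x y) \<notin> V"
proof
  assume t: "block_join d e (block_join c x y) \<in> V"
  have "x = block_join d e (block_join c x y)" using disjoint_blocks_subset_eqI[OF D xy(1) t] by auto
  moreover have "y = block_join d e (block_join c x y)" using disjoint_blocks_subset_eqI[OF D xy(2)
      t] by auto
  ultimately show False using xy(3) by simp
qed

text \<open>The differences \<open>V - U\<close> and \<open>U - V\<close> distinguish the two kinds
  of intervals of length two: four blocks become two, or three become one. They depend on the end
  points only, so the kind is common to all elements in between.\<close>

lemma two_steps_cases:
  assumes D: "disjoint_blocks V" and xy: "x \<in> V" "y \<in> V" "x \<noteq> y"
    and zw: "z \<in> merge_pair c x y V" "w \<in> merge_pair c x y V" "z \<noteq> w"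
    and U: "U = merge_pair d z w (merge_pair c x y V)"
  obtains (separate) "z \<in> V" "w \<in> V" "{x, y} \<inter> {z, w} = {}"
      "V - U = {x, y, z, w}" "U - V = {block_join c x y, block_join d z w}" "block_join c x y \<noteq>
          block_join d z w"
  | (nested) e where "e \<in> V" "e \<noteq> x" "e \<noteq> y" "V - U = {x, y, e}"
      "U - V = {block_join d e (block_join c x y)}"
      "(z = block_join c x y \<and> w = e) \<or> (z = e \<and> w = block_join c x y)"
proof (cases "z = block_join c x y \<or> w = block_join c x y")
  case True
  then obtain e where e: "(z = block_join c x y \<and> w = e) \<or> (z = e \<and> w = block_join c x y)" by blast
  then have eV: "e \<in> V" "e \<noteq> x" "e \<noteq> y" using zw by (auto simp: merge_pair_def)
  have "U = merge_pair d e (block_join c x y) (merge_pair c x y V)"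
    using e U merge_pair_commute by metis
  then have U': "U = insert (block_join d e (block_join c x y)) (V - {x, y, e})"
    using merge_pair_nested[OF D xy(1,2) eV(1) xy(3) eV(2,3)] by simp
  have n: "block_join d e (block_join c x y) \<notin> V" using block_join_nested_notin[OF D xy] .
  have "V - U = {x, y, e}" "U - V = {block_join d e (block_join c x y)}" using U' n xy eV by auto
  then show ?thesis using nested[OF eV _ _ e] by blast
next
  case False
  then have zw': "z \<in> V" "w \<in> V" "{x, y} \<inter> {z, w} = {}" using zw by (auto simp: merge_pair_def)
  have U': "U = insert (block_join c x y) (insert (block_join d z w) (V - {x, y, z, w}))"
    using merge_pair_separate[OF D xy(1,2) zw'(1,2) xy(3) zw(3) zw'(3)] U by simp
  have n: "block_join c x y \<notin> V" "block_join d z w \<notin> V"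
    using block_join_notin D xy zw' zw by blast+
  have "block_join c x y \<noteq> block_join d z w"
    using block_join_inject[OF D xy(1,2) zw'(1,2) xy(3) zw(3)] zw' by blast
  moreover have "V - U = {x, y, z, w}" "U - V = {block_join c x y, block_join d z w}"
    using U' n xy zw' by auto
  ultimately show ?thesis using separate[OF zw'] by blast
qed

lemma between_cover:
  assumes V: "V \<in> weighted_partitions n" and U: "U \<in> weighted_partitions n"
    and c: "card V = Suc (Suc (card U))" and \<alpha>: "\<alpha> \<in> between n V U"
  obtains c x y d z w where "x \<in> V" "y \<in> V" "x \<noteq> y" "\<alpha> = merge_pair c x y V"
    "z \<in> \<alpha>" "w \<in> \<alpha>" "z \<noteq> w" "U = merge_pair d z w \<alpha>"
proof -
  have a: "\<alpha> \<in> weighted_partitions n" "wp_less n V \<alpha>" "wp_less n \<alpha> U"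
    using \<alpha> by (auto simp: between_def)
  have "card \<alpha> < card V" "card U < card \<alpha>" using wp_less_card(1) a V U by blast+
  then have "card V = Suc (card \<alpha>)" "card \<alpha> = Suc (card U)" using c by auto
  then show ?thesis using wp_less_card(2)[OF V a(1,2)] wp_less_card(2)[OF a(1) U a(3)] that by metis
qed

text \<open>When three blocks become one, only the sum of the two color weights is visible; it
  determines the colors as an unordered pair. Hence the index set
  \<open>{(co, ci), (ci, co)}\<close>.\<close>

lemma color_weight_add_eq_iff:
  "color_weight p + color_weight q = color_weight c + color_weight d \<longleftrightarrow>
     (p, q) \<in> {(c, d), (d, c)}"
  by (cases p; cases q; cases c; cases d) auto

lemma merge_pair_between:
  assumes V: "V \<in> weighted_partitions n" and xy: "x \<in> V" "y \<in> V" "x \<noteq> y"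
    and zw: "z \<in> merge_pair c x y V" "w \<in> merge_pair c x y V" "z \<noteq> w"
  shows "merge_pair c x y V \<in> between n V (merge_pair d z w (merge_pair c x y V))"
  using merge_pair_weighted_partition[OF V xy] wp_less_merge_pair[OF V xy]
    wp_less_merge_pair[OF merge_pair_weighted_partition[OF V xy] zw]
  by (simp add: between_def)

text \<open>Any two of the three blocks may be merged first, with either of the two colors;
  \<open>U\<close> then forces the second merge. The color \<open>p\<close> of that merge does not
  occur in the element itself. It is carried along because the terms of the relations depend on both
  colors.\<close>

lemma between_nested:
  assumes V: "V \<in> weighted_partitions n" and abe: "a \<in> V" "b \<in> V" "e \<in> V" "a \<noteq> b" "a \<noteq> e" "b \<noteq> e"
    and U: "U = insert (block_join co a (block_join ci b e)) (V - {a, b, e})"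
  shows "between n V U =
    (\<Union>(p, q)\<in>{(co, ci), (ci, co)}. {merge_pair q b e V, merge_pair q a b V, merge_pair q a e V})"
    (is "_ = ?R")
proof
  have D: "disjoint_blocks V" using V unfolding weighted_partitions_iff by blast
  \<comment> \<open>One claim for all arrangements \<open>x\<close>, \<open>y\<close>,
    \<open>w\<close> of the three blocks.\<close>
  have fl: "merge_pair q x y V \<in> between n V U"
    if "{x, y, w} = {a, b, e}" "x \<noteq> y" "x \<noteq> w" "y \<noteq> w" "(p, q) \<in> {(co, ci), (ci, co)}" for x y w p q
  proof -
    have "{x, y, w} \<subseteq> V" unfolding that(1) using abe by simp
    then have xyw: "x \<in> V" "y \<in> V" "w \<in> V" by simp_all
    have "block_join p w (block_join q x y) = block_join co a (block_join ci b e)"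
    proof -
      have "fst x \<union> fst y \<union> fst w = fst a \<union> fst b \<union> fst e"
        using arg_cong[OF that(1), of "\<lambda>s. \<Union> (fst ` s)"] by auto
      \<comment> \<open>Applying \<open>sum snd\<close> to the equality of three-element sets avoids
        a distinction by arrangement.\<close>
      moreover have "snd x + snd y + snd w = snd a + snd b + snd e"
        using arg_cong[OF that(1), of "sum snd"] that(2-4) abe(4-6) by (simp add: add.assoc)
      moreover have "color_weight p + color_weight q = color_weight co + color_weight ci"
        using that(5) color_weight_add_eq_iff by blast
      ultimately show ?thesis by (auto simp: prod_eq_iff)
    qed
    then have "U = merge_pair p w (block_join q x y) (merge_pair q x y V)"
      using merge_pair_nested[OF D xyw that(2)] that U by metis
    then show ?thesis
      using merge_pair_between[OF V xyw(1,2) that(2), of w q "block_join q x y" p]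
        block_join_notin[OF D xyw(1,2) that(2), of q] xyw that by (auto simp: merge_pair_def)
  qed
  have "?R \<subseteq> between n V U"
  proof -
    have "{merge_pair q b e V, merge_pair q a b V, merge_pair q a e V} \<subseteq> between n V U"
      if "(p, q) \<in> {(co, ci), (ci, co)}" for p q
      using fl[of b e a p q] fl[of a b e p q] fl[of a e b p q] that abe by (auto simp: insert_commute)
    then show ?thesis by (intro UN_least) (metis (no_types, lifting) case_prod_beta prod.collapse)
  qed
  then show "?R \<subseteq> between n V U" .
  have t: "block_join co a (block_join ci b e) \<notin> V" using block_join_nested_notin[OF D abe(2,3,6)] .
  have VU: "V - U = {a, b, e}" and UV: "U - V = {block_join co a (block_join ci b e)}"
    using U t abe by auto
  have fin: "finite V" using weighted_partitions_finite[OF V] .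
  have "card V = Suc (Suc (card U))"
  proof -
    have "card (V - {a, b, e}) = card V - 3" using abe fin by (simp add: card_Diff_subset)
    moreover have "card {a, b, e} \<le> card V" using abe fin by (intro card_mono) auto
    then have "card V \<ge> 3" using abe by simp
    moreover have "card U = Suc (card (V - {a, b, e}))" using U t fin by simp
    ultimately show ?thesis by simp
  qed
  moreover have "U \<in> weighted_partitions n"
  proof -
    have "U = merge_pair co a (block_join ci b e) (merge_pair ci b e V)"
      using merge_pair_nested[OF D abe(2,3,1,6,4,5)] U by (simp add: insert_commute)
    moreover have "merge_pair ci b e V \<in> weighted_partitions n"
      using merge_pair_weighted_partition[OF V abe(2,3,6)] .
    moreover have "block_join ci b e \<notin> V" using block_join_notin D abe by blast
    moreover have "a \<in> merge_pair ci b e V" "block_join ci b e \<in> merge_pair ci b e V"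
      "a \<noteq> block_join ci b e"
      using calculation(3) abe by (auto simp: merge_pair_def)
    ultimately show ?thesis using merge_pair_weighted_partition by simp
  qed
  ultimately show "between n V U \<subseteq> ?R"
  proof (intro subsetI)
    fix \<alpha> assume c: "card V = Suc (Suc (card U))" and UW: "U \<in> weighted_partitions n"
      and "\<alpha> \<in> between n V U"
    then obtain c x y d z w where x: "x \<in> V" "y \<in> V" "x \<noteq> y" "\<alpha> = merge_pair c x y V"
      and z: "z \<in> merge_pair c x y V" "w \<in> merge_pair c x y V" "z \<noteq> w"
        "U = merge_pair d z w (merge_pair c x y V)"
      using between_cover[OF V UW c] by metis
    from D x(1-3) z show "\<alpha> \<in> ?R"
    proof (cases rule: two_steps_cases)
      case separate
      \<comment> \<open>Impossible: \<open>U - V\<close> would have two elements, but it has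
        one.\<close>
      then show ?thesis using UV by (metis doubleton_eq_iff insert_absorb2)
    next
      case (nested f)
      have s: "{x, y, f} = {a, b, e}" using nested VU by simp
      have "block_join d f (block_join c x y) = block_join co a (block_join ci b e)" using nested UV by auto
      then have "snd f + (snd x + snd y) + (color_weight d + color_weight c) =
          snd a + (snd b + snd e) + (color_weight co + color_weight ci)"
        by (auto simp: block_join_def)
      moreover have "snd x + snd y + snd f = snd a + snd b + snd e"
        using arg_cong[OF s, of "sum snd"] x nested abe by (simp add: add.assoc)
      ultimately have "color_weight d + color_weight c = color_weight co + color_weight ci" by simp
      then have "(d, c) \<in> {(co, ci), (ci, co)}" using color_weight_add_eq_iff by blast
      moreover have "\<alpha> \<in> {merge_pair c b e V, merge_pair c a b V, merge_pair c a e V}"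
      proof -
        have "x \<in> {a, b, e}" "y \<in> {a, b, e}" using s by blast+
        then show ?thesis using x merge_pair_commute[of c x y V] by auto
      qed
      ultimately show ?thesis by blast
    qed
  qed
qed

text \<open>No filling is counted twice: merges of different pairs of blocks or with different
  colors give different elements, and the two color pairs, if distinct, have distinct second
  components.\<close>

lemma sum_between_nested:
  fixes f :: "weighted_partition \<Rightarrow> 'b::comm_monoid_add"
  assumes V: "V \<in> weighted_partitions n" and abe: "a \<in> V" "b \<in> V" "e \<in> V" "a \<noteq> b" "a \<noteq> e" "b \<noteq> e"
    and U: "U = insert (block_join co a (block_join ci b e)) (V - {a, b, e})"
  shows "(\<Sum>\<alpha>\<in>between n V U. f \<alpha>) =
    (\<Sum>(p, q)\<in>{(co, ci), (ci, co)}.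
       f (merge_pair q b e V) + f (merge_pair q a b V) + f (merge_pair q a e V))"
proof -
  have D: "disjoint_blocks V" using V unfolding weighted_partitions_iff by blast
  have ne: "{b, e} \<noteq> {a, b}" "{b, e} \<noteq> {a, e}" "{a, b} \<noteq> {a, e}"
    using abe by (auto simp: doubleton_eq_iff)
  let ?S = "\<lambda>q. {merge_pair q b e V, merge_pair q a b V, merge_pair q a e V}"
  have col: "q = q'" if "?S q \<inter> ?S q' \<noteq> {}" for q q'
    using that merge_pair_inject[OF D] abe by blast
  have d3: "merge_pair q b e V \<noteq> merge_pair q a b V" "merge_pair q b e V \<noteq> merge_pair q a e V"
    "merge_pair q a b V \<noteq> merge_pair q a e V" for q
    using merge_pair_inject[OF D] abe ne by blast+
  have "(\<Sum>\<alpha>\<in>between n V U. f \<alpha>) = (\<Sum>pq\<in>{(co, ci), (ci, co)}. \<Sum>\<alpha>\<in>?S (snd pq). f \<alpha>)"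
    unfolding between_nested[OF assms] case_prod_unfold
  proof (rule sum.UNION_disjoint)
    show "\<forall>i\<in>{(co, ci), (ci, co)}. \<forall>j\<in>{(co, ci), (ci, co)}.
        i \<noteq> j \<longrightarrow> ?S (snd i) \<inter> ?S (snd j) = {}"
      using col by (metis empty_iff insert_iff snd_conv)
  qed auto
  moreover have "(\<Sum>\<alpha>\<in>?S q. f \<alpha>) =
      f (merge_pair q b e V) + f (merge_pair q a b V) + f (merge_pair q a e V)" for q
    using d3 by (simp add: add.assoc)
  ultimately show ?thesis by (simp add: case_prod_unfold)
qed

text \<open>Each of the two new blocks of \<open>U\<close> fixes its own pair and its own color. So
  the colors cannot be exchanged, and only the order of the two merges is free.\<close>

lemma between_separate:
  assumes V: "V \<in> weighted_partitions n" and ab: "a \<in> V" "b \<in> V" "a \<noteq> b"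
    and eh: "e \<in> V" "h \<in> V" "e \<noteq> h" and sep: "{a, b} \<inter> {e, h} = {}"
    and U: "U = insert (block_join c a b) (insert (block_join d e h) (V - {a, b, e, h}))"
  shows "between n V U = {merge_pair c a b V, merge_pair d e h V}"
    and "merge_pair c a b V \<noteq> merge_pair d e h V"
proof -
  have D: "disjoint_blocks V" using V unfolding weighted_partitions_iff by blast
  have U1: "U = merge_pair d e h (merge_pair c a b V)"
    using merge_pair_separate[OF D ab(1,2) eh(1,2) ab(3) eh(3) sep] U by simp
  have U2: "U = merge_pair c a b (merge_pair d e h V)"
    using merge_pair_separate[OF D eh(1,2) ab(1,2) eh(3) ab(3)] sep U
    by (simp add: insert_commute Int_commute)
  have in1: "e \<in> merge_pair c a b V" "h \<in> merge_pair c a b V"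
    "a \<in> merge_pair d e h V" "b \<in> merge_pair d e h V"
    using ab eh sep by (auto simp: merge_pair_def)
  have UW: "U \<in> weighted_partitions n"
    unfolding U1 using V ab eh in1 by (intro merge_pair_weighted_partition) auto
  have nj: "block_join c a b \<noteq> block_join d e h"
    using block_join_inject[OF D ab(1,2) eh(1,2) ab(3) eh(3)] sep by blast
  have n: "block_join c a b \<notin> V" "block_join d e h \<notin> V" using block_join_notin D ab eh by blast+
  have UV: "U - V = {block_join c a b, block_join d e h}" using U n by blast
  show "merge_pair c a b V \<noteq> merge_pair d e h V"
    using merge_pair_inject[OF D ab(1,2) eh(1,2) ab(3) eh(3)] sep by blast
  show "between n V U = {merge_pair c a b V, merge_pair d e h V}"
  proof
    show "{merge_pair c a b V, merge_pair d e h V} \<subseteq> between n V U"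
      using merge_pair_between[OF V ab in1(1,2) eh(3), of d]
        merge_pair_between[OF V eh in1(3,4) ab(3), of c] U1 U2 by auto
    have "card V = Suc (Suc (card U))"
      unfolding U1 using card_merge_pair[OF V ab, of c]
        card_merge_pair[OF merge_pair_weighted_partition[OF V ab] in1(1,2) eh(3), of d] by simp
    show "between n V U \<subseteq> {merge_pair c a b V, merge_pair d e h V}"
    proof
      fix \<alpha> assume "\<alpha> \<in> between n V U"
      then obtain c' x y d' z w where x: "x \<in> V" "y \<in> V" "x \<noteq> y" "\<alpha> = merge_pair c' x y V"
        and z: "z \<in> merge_pair c' x y V" "w \<in> merge_pair c' x y V" "z \<noteq> w"
          "U = merge_pair d' z w (merge_pair c' x y V)"
        using between_cover[OF V UW \<open>card V = _\<close>] by metis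
      from D x(1-3) z show "\<alpha> \<in> {merge_pair c a b V, merge_pair d e h V}"
      proof (cases rule: two_steps_cases)
        case separate
        then have "block_join c' x y = block_join c a b \<or> block_join c' x y = block_join d e h"
            using UV by auto
        then have "({x, y} = {a, b} \<and> c' = c) \<or> ({x, y} = {e, h} \<and> c' = d)"
          using block_join_inject[OF D x(1,2) ab(1,2) x(3) ab(3)] block_join_inject[OF D x(1,2)
              eh(1,2) x(3) eh(3)]
          by blast
        then show ?thesis
          using x(4) merge_pair_commute[of c' x y V] unfolding doubleton_eq_iff by auto
      next
        case (nested f)
        then show ?thesis using UV nj by (metis doubleton_eq_iff insert_absorb2)
      qed
    qed
  qed
qed

section \<open>Maximal chains as sequences of merges\<close>

text \<open>\<open>merge\<close> is total, but it is the intended operation only if \<open>A\<close>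
  and \<open>B\<close> are the underlying sets of two different blocks.\<close>

fun valid_steps :: "weighted_partition \<Rightarrow> (color \<times> nat set \<times> nat set) list \<Rightarrow> bool" where
  "valid_steps W [] \<longleftrightarrow> True"
| "valid_steps W ((c, A, B) # ms) \<longleftrightarrow>
     (\<exists>x\<in>W. \<exists>y\<in>W. x \<noteq> y \<and> A = fst x \<and> B = fst y) \<and>
     valid_steps (merge (color_weight c) A B W) ms"

fun apply_steps ::
  "weighted_partition \<Rightarrow> (color \<times> nat set \<times> nat set) list \<Rightarrow> weighted_partition" where
  "apply_steps W [] = W"
| "apply_steps W ((c, A, B) # ms) = apply_steps (merge (color_weight c) A B W) ms"

lemma apply_steps_append: "apply_steps W (ms @ ms') = apply_steps (apply_steps W ms) ms'"
  by (induction W ms rule: apply_steps.induct) auto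

lemma valid_steps_append:
  "valid_steps W (ms @ ms') \<longleftrightarrow> valid_steps W ms \<and> valid_steps (apply_steps W ms) ms'"
  by (induction W ms rule: apply_steps.induct) auto

lemma valid_step_merge_pair:
  assumes "W \<in> weighted_partitions n" and "valid_steps W ((c, A, B) # ms)"
  obtains x y where "x \<in> W" "y \<in> W" "x \<noteq> y" "A = fst x" "B = fst y"
    "merge (color_weight c) A B W = merge_pair c x y W"
    "merge (color_weight c) A B W \<in> weighted_partitions n"
    "valid_steps (merge_pair c x y W) ms"
proof -
  have D: "disjoint_blocks W" using assms(1) unfolding weighted_partitions_iff by blast
  obtain x y where x: "x \<in> W" "y \<in> W" "x \<noteq> y" "A = fst x" "B = fst y"
    and v: "valid_steps (merge (color_weight c) A B W) ms"
    using assms(2) by auto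
  have m: "merge (color_weight c) A B W = merge_pair c x y W"
    using merge_eq_merge_pair[OF D x(1,2)] x(4,5) by simp
  show ?thesis
    using that[OF x m] m v merge_pair_weighted_partition[OF assms(1) x(1-3)] by metis
qed

lemma valid_steps_Cons_iff:
  assumes "disjoint_blocks W" "x \<in> W" "y \<in> W" "x \<noteq> y"
  shows "valid_steps W ((c, fst x, fst y) # ms) \<longleftrightarrow> valid_steps (merge_pair c x y W) ms"
    and "apply_steps W ((c, fst x, fst y) # ms) = apply_steps (merge_pair c x y W) ms"
  using assms merge_eq_merge_pair[OF assms(1-3)] by auto

lemma apply_steps_weighted_partition:
  "W \<in> weighted_partitions n \<Longrightarrow> valid_steps W ms \<Longrightarrow>
     apply_steps W ms \<in> weighted_partitions n \<and> card (apply_steps W ms) + length ms = card W"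
proof (induction ms arbitrary: W)
  case Nil
  then show ?case by simp
next
  case (Cons m ms)
  obtain c A B where m: "m = (c, A, B)" by (cases m)
  obtain x y where x: "x \<in> W" "y \<in> W" "x \<noteq> y"
    and e: "merge (color_weight c) A B W = merge_pair c x y W"
    and w: "merge (color_weight c) A B W \<in> weighted_partitions n"
    and v: "valid_steps (merge_pair c x y W) ms"
    using Cons.prems valid_step_merge_pair unfolding m by metis
  then show ?case using Cons.IH[of "merge_pair c x y W"] card_merge_pair[OF Cons.prems(1) x] m by simp
qed

lemma length_merge_chain [simp]: "length (merge_chain W ms) = Suc (length ms)"
  by (induction W ms rule: merge_chain.induct) auto

lemma merge_chain_nth:
  "k \<le> length ms \<Longrightarrow> merge_chain W ms ! k = apply_steps W (take k ms)"
proof (induction W ms arbitrary: k rule: merge_chain.induct)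
  case (2 W c A B ms)
  then show ?case by (cases k) auto
qed auto

lemma merge_chain_eq: "merge_chain W ms = map (\<lambda>k. apply_steps W (take k ms)) [0..<Suc (length ms)]"
  by (rule nth_equalityI) (auto simp: merge_chain_nth simp del: upt_Suc)

lemma hd_merge_chain: "merge_chain W ms = W # tl (merge_chain W ms)"
  by (induction W ms rule: merge_chain.induct) auto

lemma merge_chain_sorted:
  "W \<in> weighted_partitions n \<Longrightarrow> valid_steps W ms \<Longrightarrow>
     sorted_wrt (wp_less n) (merge_chain W ms) \<and> set (merge_chain W ms) \<subseteq> weighted_partitions n"
proof (induction ms arbitrary: W)
  case Nil
  then show ?case by simp
next
  case (Cons m ms)
  obtain c A B where m: "m = (c, A, B)" by (cases m)
  obtain x y where x: "x \<in> W" "y \<in> W" "x \<noteq> y"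
    and e: "merge (color_weight c) A B W = merge_pair c x y W"
    and w: "merge (color_weight c) A B W \<in> weighted_partitions n"
    and v: "valid_steps (merge_pair c x y W) ms"
    using Cons.prems valid_step_merge_pair unfolding m by metis
  let ?W = "merge_pair c x y W"
  have IH: "sorted_wrt (wp_less n) (merge_chain ?W ms)" "set (merge_chain ?W ms) \<subseteq> weighted_partitions n"
    using Cons.IH[of ?W] w v e by simp_all
  have 1: "wp_less n W ?W" using wp_less_merge_pair[OF Cons.prems(1) x] .
  have "wp_less n W z" if z: "z \<in> set (merge_chain ?W ms)" for z
  proof (cases "z = ?W")
    case False
    then have "z \<in> set (tl (merge_chain ?W ms))"
      using z hd_merge_chain[of ?W ms] by (metis set_ConsD)
    then have "wp_less n ?W z"
      using IH(1) hd_merge_chain[of ?W ms] by (metis sorted_wrt.simps(2))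
    then show ?thesis using wp_less_trans[of W n ?W z] 1 z IH(2) Cons.prems(1) w e by auto
  qed (use 1 in simp)
  then show ?case using IH m e Cons.prems(1) by simp
qed

section \<open>Step sequences from the bottom to \<open>wp_top n i\<close> and their chains\<close>

lemma wp_bot_weighted_partition: "wp_bot n \<in> weighted_partitions n"
  unfolding weighted_partitions_iff by (auto simp: wp_bot_def disjoint_blocks_def)

lemma card_wp_bot: "card (wp_bot n) = n"
  unfolding wp_bot_def by (subst card_image) (auto intro: inj_onI)

lemma wp_top_weighted_partition:
  "1 \<le> n \<Longrightarrow> i \<le> n - 1 \<Longrightarrow> wp_top n i \<in> weighted_partitions n"
  unfolding weighted_partitions_iff by (auto simp: wp_top_def disjoint_blocks_def)

lemma card_wp_top: "card (wp_top n i) = 1"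
  by (simp add: wp_top_def)

lemma wp_bot_less_wp_top:
  assumes "2 \<le> n" "i \<le> n - 1"
  shows "wp_less n (wp_bot n) (wp_top n i)"
proof -
  have "below (wp_bot n) ({1..n}, i) = wp_bot n" by (auto simp: below_def wp_bot_def)
  moreover have "sum snd (wp_bot n) = 0" by (auto simp: wp_bot_def intro!: sum.neutral)
  moreover have "refining (wp_bot n) (wp_top n i)"
    by (auto simp: refining_def wp_bot_def wp_top_def)
  ultimately have "wp_le n (wp_bot n) (wp_top n i)"
    using assms wp_le_iff[OF wp_bot_weighted_partition wp_top_weighted_partition, of n i]
    by (simp add: card_wp_bot wp_top_def del: One_nat_def)
  moreover have "wp_bot n \<noteq> wp_top n i"
    using card_wp_bot[of n] card_wp_top[of n i] assms by auto
  ultimately show ?thesis by (simp add: wp_less_def)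
qed

definition step_lists :: "nat \<Rightarrow> nat \<Rightarrow> (color \<times> nat set \<times> nat set) list set" where
  "step_lists n i = {ms. valid_steps (wp_bot n) ms \<and> apply_steps (wp_bot n) ms = wp_top n i}"

lemma length_step_lists: "ms \<in> step_lists n i \<Longrightarrow> Suc (length ms) = n"
  using apply_steps_weighted_partition[OF wp_bot_weighted_partition, of n ms]
  by (simp add: step_lists_def card_wp_bot card_wp_top)

text \<open>The end points are removed by position, not by comparison as in
  \<open>open_tree_chain\<close>; for the chain of a labeled tree with \<open>2 \<le> n\<close> the
  results agree.\<close>

definition inner :: "nat \<Rightarrow> (color \<times> nat set \<times> nat set) list \<Rightarrow> weighted_partition list" where
  "inner n ms = butlast (tl (merge_chain (wp_bot n) ms))"

lemma merge_chain_inner: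
  assumes "ms \<in> step_lists n i" and "2 \<le> n"
  shows "merge_chain (wp_bot n) ms = wp_bot n # inner n ms @ [wp_top n i]"
proof -
  have l: "Suc (length ms) = n" using length_step_lists[OF assms(1)] .
  let ?t = "tl (merge_chain (wp_bot n) ms)"
  have "length ?t > 0" using l assms(2) by simp
  then have "?t \<noteq> []" by force
  moreover have "last ?t = wp_top n i"
  proof -
    have "last ?t = last (merge_chain (wp_bot n) ms)" using \<open>?t \<noteq> []\<close> by (simp add: last_tl)
    also have "\<dots> = merge_chain (wp_bot n) ms ! length ms"
      by (metis diff_Suc_1 last_conv_nth length_0_conv length_merge_chain nat.distinct(1))
    also have "\<dots> = wp_top n i" using assms(1) by (simp add: merge_chain_nth step_lists_def)
    finally show ?thesis .
  qed
  ultimately have "?t = inner n ms @ [wp_top n i]"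
    unfolding inner_def by (metis append_butlast_last_id)
  then show ?thesis using hd_merge_chain by metis
qed

lemma length_inner: "ms \<in> step_lists n i \<Longrightarrow> length (inner n ms) = n - 2"
  using length_step_lists[of ms n i] by (simp add: inner_def)

lemma inner_nth:
  assumes "ms \<in> step_lists n i" "Suc k < length ms"
  shows "inner n ms ! k = apply_steps (wp_bot n) (take (Suc k) ms)"
  using assms by (simp add: inner_def nth_butlast nth_tl merge_chain_nth)

lemma decreasing_length:
  assumes "set ys \<subseteq> weighted_partitions n" "sorted_wrt (wp_less n) ys" "ys \<noteq> []" "card (last ys) = 1"
  shows "length ys \<le> card (hd ys)"
  using assms
proof (induction ys)
  case (Cons y ys)
  show ?case
  proof (cases "ys = []")
    case False
    then have "length ys \<le> card (hd ys)" using Cons by simp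
    moreover have "card (hd ys) < card y"
      using Cons.prems False by (intro wp_less_card(1)[of y n]) auto
    ultimately show ?thesis by simp
  qed (use Cons in simp)
qed simp

text \<open>The chain has as many elements as its first element has blocks, and its last element has
  one block. By \<open>decreasing_length\<close> no rank is skipped, so every step merges two
  blocks.\<close>

lemma saturated_chain_steps:
  assumes "set (W # ys) \<subseteq> weighted_partitions n" "sorted_wrt (wp_less n) (W # ys)"
    "card (last (W # ys)) = 1" "card W = length (W # ys)"
  shows "\<exists>ms. valid_steps W ms \<and> merge_chain W ms = W # ys"
  using assms
proof (induction ys arbitrary: W)
  case Nil
  then show ?case by (intro exI[of _ "[]"]) simp
next
  case (Cons V ys)
  have V: "V \<in> weighted_partitions n" and W: "W \<in> weighted_partitions n" and WV: "wp_less n W V"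
    using Cons.prems by auto
  have "length (V # ys) \<le> card V"
    using Cons.prems by (intro decreasing_length[of "V # ys" n, simplified list.sel]) auto
  moreover have "card V < card W" using wp_less_card(1)[OF W V WV] .
  ultimately have c: "card W = Suc (card V)" "card V = length (V # ys)" using Cons.prems(4) by auto
  obtain d x y where x: "x \<in> W" "y \<in> W" "x \<noteq> y" and VW: "V = merge_pair d x y W"
    using wp_less_card(2)[OF W V WV c(1)] by blast
  obtain ms where ms: "valid_steps V ms" "merge_chain V ms = V # ys"
    using Cons.IH[of V] Cons.prems c by auto
  have "merge (color_weight d) (fst x) (fst y) W = V"
    using merge_eq_merge_pair[of W x y d] W x VW unfolding weighted_partitions_iff by simp
  then have "valid_steps W ((d, fst x, fst y) # ms) \<and> merge_chain W ((d, fst x, fst y) # ms) = W # V # ys"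
    using ms x by auto
  then show ?case by blast
qed

text \<open>Equality of steps up to exchanging the two children, which is all that a chain leaves
  undetermined.\<close>

definition flip_eq :: "color \<times> nat set \<times> nat set \<Rightarrow> color \<times> nat set \<times> nat set \<Rightarrow> bool" where
  "flip_eq m m' \<longleftrightarrow> fst m = fst m' \<and> (snd m = snd m' \<or> snd m = prod.swap (snd m'))"

text \<open>By \<open>merge_pair_inject\<close>, consecutive elements of the chain determine the
  unordered pair of merged blocks and the color.\<close>

lemma merge_chain_flip_eq:
  "W \<in> weighted_partitions n \<Longrightarrow> valid_steps W ms \<Longrightarrow> valid_steps W ms' \<Longrightarrow>
     merge_chain W ms = merge_chain W ms' \<Longrightarrow> list_all2 flip_eq ms ms'"
proof (induction ms arbitrary: W ms')
  case Nil
  then have "length ms' = 0" by (metis length_merge_chain list.size(3) nat.inject)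
  then show ?case by simp
next
  case (Cons m ms)
  obtain c A B where m: "m = (c, A, B)" by (cases m)
  have "length ms' = Suc (length ms)" using Cons.prems(4) by (metis length_Cons length_merge_chain
      nat.inject)
  then obtain c' A' B' ns where ms': "ms' = (c', A', B') # ns" by (metis length_Suc_conv prod_cases3)
  obtain x y where x: "x \<in> W" "y \<in> W" "x \<noteq> y" "A = fst x" "B = fst y"
    and e: "merge (color_weight c) A B W = merge_pair c x y W"
    and w: "merge (color_weight c) A B W \<in> weighted_partitions n"
    and v: "valid_steps (merge_pair c x y W) ms"
    using Cons.prems(1,2) valid_step_merge_pair unfolding m by metis
  obtain x' y' where x': "x' \<in> W" "y' \<in> W" "x' \<noteq> y'" "A' = fst x'" "B' = fst y'"
    and e': "merge (color_weight c') A' B' W = merge_pair c' x' y' W"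
    and v': "valid_steps (merge_pair c' x' y' W) ns"
    using Cons.prems(1,3) valid_step_merge_pair unfolding ms' by metis
  have q: "merge_chain (merge_pair c x y W) ms = merge_chain (merge_pair c' x' y' W) ns"
    using Cons.prems(4) m ms' e e' by simp
  then have eq: "merge_pair c x y W = merge_pair c' x' y' W"
    by (metis hd_merge_chain list.inject)
  have D: "disjoint_blocks W" using Cons.prems(1) unfolding weighted_partitions_iff by blast
  have "{x, y} = {x', y'} \<and> c = c'" using merge_pair_inject[OF D x(1,2) x'(1,2) x(3) x'(3) eq] .
  then have "flip_eq m (c', A', B')"
    using m x x' by (auto simp: flip_eq_def doubleton_eq_iff)
  moreover have "list_all2 flip_eq ms ns"
    using Cons.IH[of "merge_pair c x y W" ns] w e v v' q eq by simp
  ultimately show ?case by (simp add: ms')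
qed

text \<open>Stated for any \<open>W\<close> that contains the singletons of \<open>T\<close> with
  weight 0, because the right subtree is processed after the left one has been contracted.\<close>

lemma tree_steps:
  assumes "W \<in> weighted_partitions n" "distinct (leaves T)" "\<forall>a\<in>set (leaves T). ({a}, 0) \<in> W"
  shows "valid_steps W (postorder T) \<and> apply_steps W (postorder T) =
    insert (set (leaves T), num_red T) (W - (\<lambda>a. ({a}, 0)) ` set (leaves T))"
  using assms
proof (induction T arbitrary: W)
  case (Leaf a)
  then show ?case by auto
next
  case (Node c l r)
  let ?sl = "(\<lambda>a. ({a}, 0)) ` set (leaves l)" and ?sr = "(\<lambda>a. ({a}, 0)) ` set (leaves r)"
  let ?x = "(set (leaves l), num_red l)" and ?y = "(set (leaves r), num_red r)"
  have disj: "set (leaves l) \<inter> set (leaves r) = {}" using Node.prems by simp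
  have D: "disjoint_blocks W" using Node.prems(1) unfolding weighted_partitions_iff by blast
  define W1 where "W1 = insert ?x (W - ?sl)"
  have 1: "valid_steps W (postorder l)" "apply_steps W (postorder l) = W1"
    using Node.IH(1)[of W] Node.prems by (simp_all add: W1_def)
  have W1: "W1 \<in> weighted_partitions n"
    using apply_steps_weighted_partition[OF Node.prems(1) 1(1)] 1(2) by simp
  have "\<forall>a\<in>set (leaves r). ({a}, 0) \<in> W1"
    using Node.prems(3) disj by (auto simp: W1_def)
  then have 2: "valid_steps W1 (postorder r)" "apply_steps W1 (postorder r) = insert ?y (W1 - ?sr)"
    using Node.IH(2)[of W1] Node.prems(2) W1 by simp_all
  define W2 where "W2 = insert ?y (W1 - ?sr)"
  have W2: "W2 \<in> weighted_partitions n"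
    using apply_steps_weighted_partition[OF W1 2(1)] 2(2) by (simp add: W2_def)
  then have D2: "disjoint_blocks W2" unfolding weighted_partitions_iff by blast
  have "?x \<notin> ?sr" using disj by auto
  then have in2: "?x \<in> W2" "?y \<in> W2" by (auto simp: W1_def W2_def)
  have ne: "?x \<noteq> ?y" using disj by (auto simp: prod_eq_iff)
  \<comment> \<open>A remaining block of \<open>W\<close> that shares a label with a subtree would
    be a singleton of that subtree, and these have been removed.\<close>
  have notin: "z \<notin> W - ?sl - ?sr" if zxy: "z = ?x \<or> z = ?y" for z
  proof
    assume z: "z \<in> W - ?sl - ?sr"
    obtain a where a: "a \<in> fst z" "a \<in> set (leaves l) \<union> set (leaves r)"
      using zxy hd_in_set[OF leaves_nonempty[of l]] hd_in_set[OF leaves_nonempty[of r]]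
      by (metis UnI1 UnI2 fst_conv)
    then have "({a}, 0) \<in> W" using Node.prems(3) by auto
    then have "z = ({a}, 0)" using disjoint_blocks_eqI[OF D, of z "({a}, 0)" a] z a by simp
    then show False using z a(2) by auto
  qed
  have "W2 = insert ?y (insert ?x (W - ?sl - ?sr))"
    using \<open>?x \<notin> ?sr\<close> by (auto simp: W1_def W2_def)
  then have "merge_pair c ?x ?y W2 = insert (block_join c ?x ?y) (W - ?sl - ?sr)"
    using notin by (auto simp: merge_pair_def)
  moreover have "block_join c ?x ?y = (set (leaves (Node c l r)), num_red (Node c l r))"
    by (cases c) (auto simp: block_join_def)
  moreover have "W - ?sl - ?sr = W - (\<lambda>a. ({a}, 0)) ` set (leaves (Node c l r))"
    by auto
  moreover have "valid_steps W2 [(c, fst ?x, fst ?y)]" "apply_steps W2 [(c, fst ?x, fst ?y)] =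
      merge_pair c ?x ?y W2"
    using valid_steps_Cons_iff[OF D2 in2 ne, of c "[]"] by simp_all
  ultimately show ?case
    using 1 2 by (simp add: valid_steps_append apply_steps_append flip: W2_def)
qed

lemma postorder_step_lists:
  assumes "T \<in> labeled_trees n i"
  shows "postorder T \<in> step_lists n i"
proof -
  have T: "distinct (leaves T)" "set (leaves T) = {1..n}" "num_red T = i"
    using assms by (auto simp: labeled_trees_def)
  have "\<forall>a\<in>set (leaves T). ({a}, 0) \<in> wp_bot n" using T by (auto simp: wp_bot_def)
  from tree_steps[OF wp_bot_weighted_partition T(1) this] show ?thesis
    using T unfolding step_lists_def wp_top_def by (auto simp: wp_bot_def)
qed

text \<open>A valid sequence grows a forest: its trees are the current blocks, its internal nodes
  are the steps, and the weight of a block is the number of red nodes. A further step joins two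
  trees. The trees form a list, so that disjointness of their leaf sets is distinctness of one
  concatenation.\<close>

lemma steps_forest:
  "valid_steps (wp_bot n) ms \<Longrightarrow>
   \<exists>Ts. mset (concat (map postorder Ts)) = mset ms \<and> distinct (concat (map leaves Ts)) \<and>
     set (concat (map leaves Ts)) = {1..n} \<and>
     apply_steps (wp_bot n) ms = set (map (\<lambda>T. (set (leaves T), num_red T)) Ts)"
proof (induction ms rule: rev_induct)
  case Nil
  show ?case
    by (rule exI[of _ "map Leaf [1..<Suc n]"]) (auto simp: wp_bot_def comp_def simp del: upt_Suc)
next
  case (snoc m ms)
  let ?e = "\<lambda>T. (set (leaves T), num_red T)"
  obtain Ts where Ts: "mset (concat (map postorder Ts)) = mset ms" "distinct (concat (map leaves Ts))"
    "set (concat (map leaves Ts)) = {1..n}" "apply_steps (wp_bot n) ms = set (map ?e Ts)"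
    using snoc by (auto simp: valid_steps_append)
  define W where "W = apply_steps (wp_bot n) ms"
  have W: "W \<in> weighted_partitions n"
    using apply_steps_weighted_partition[OF wp_bot_weighted_partition] snoc.prems
    by (auto simp: W_def valid_steps_append)
  then have D: "disjoint_blocks W" unfolding weighted_partitions_iff by blast
  obtain c A B where m: "m = (c, A, B)" by (cases m)
  have "valid_steps W [(c, A, B)]" using snoc.prems by (simp add: W_def valid_steps_append m)
  then obtain x y where x: "x \<in> W" "y \<in> W" "x \<noteq> y" "A = fst x" "B = fst y"
    "merge (color_weight c) A B W = merge_pair c x y W"
    using valid_step_merge_pair[OF W] by metis
  obtain t1 where t1: "t1 \<in> set Ts" "x = ?e t1" using x(1) Ts(4) by (auto simp: W_def)
  obtain t2 where t2: "t2 \<in> set Ts" "y = ?e t2" using x(2) Ts(4) by (auto simp: W_def)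
  obtain rest where rest: "mset Ts = mset (t1 # t2 # rest)"
  proof -
    obtain us vs where uv: "Ts = us @ t1 # vs" using t1(1) by (meson split_list)
    then have "t2 \<in> set (us @ vs)" using t1 t2 x(3) by auto
    then obtain ws zs where wz: "us @ vs = ws @ t2 # zs" by (meson split_list)
    have "mset Ts = add_mset t1 (mset (us @ vs))" by (simp add: uv)
    then have "mset Ts = mset (t1 # t2 # (ws @ zs))" unfolding wz by simp
    then show ?thesis using that by blast
  qed
  \<comment> \<open>Moves \<open>t1\<close> and \<open>t2\<close> to the front; polymorphic in
    \<open>f\<close>, because it is used for the leaves and for the nodes.\<close>
  have perm: "mset (concat (map f Ts)) = mset (f t1 @ f t2 @ concat (map f rest))" for f :: "nat
      btree \<Rightarrow> 'z list"
  proof -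
    have "mset (concat (map f Ts)) = \<Sum>\<^sub># (image_mset (\<lambda>T. mset (f T)) (mset Ts))"
      by (induction Ts) auto
    moreover have "mset (concat (map f (t1 # t2 # rest))) =
        \<Sum>\<^sub># (image_mset (\<lambda>T. mset (f T)) (mset (t1 # t2 # rest)))"
      by (induction rest) auto
    ultimately show ?thesis using rest by simp
  qed
  have dl: "distinct (leaves t1 @ leaves t2 @ concat (map leaves rest))"
    using mset_eq_imp_distinct_iff[OF perm[of leaves]] Ts(2) by simp
  have sl: "set (leaves t1 @ leaves t2 @ concat (map leaves rest)) = {1..n}"
    using mset_eq_setD[OF perm[of leaves]] Ts(3) by simp
  have sT: "W = insert x (insert y (?e ` set rest))"
    using Ts(4) mset_eq_setD[OF rest] t1 t2 by (auto simp: W_def)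
  have "x \<notin> ?e ` set rest" "y \<notin> ?e ` set rest"
  proof -
    have "fst x \<inter> set (leaves u) = {}" "fst y \<inter> set (leaves u) = {}" if "u \<in> set rest" for u
    proof -
      have "set (leaves u) \<subseteq> set (concat (map leaves rest))" using that by auto
      then show "fst x \<inter> set (leaves u) = {}" "fst y \<inter> set (leaves u) = {}"
        using dl unfolding distinct_append set_append t1(2) t2(2) fst_conv by blast+
    qed
    moreover have "fst x \<noteq> {}" "fst y \<noteq> {}" using t1 t2 by simp_all
    ultimately show "x \<notin> ?e ` set rest" "y \<notin> ?e ` set rest" by fastforce+
  qed
  then have "merge_pair c x y W = insert (block_join c x y) (?e ` set rest)"
    using sT by (auto simp: merge_pair_def)
  moreover have "block_join c x y = ?e (Node c t1 t2)" using t1 t2 by (cases c) (auto simp: block_join_def)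
  ultimately have r: "apply_steps (wp_bot n) (ms @ [m]) = set (map ?e (Node c t1 t2 # rest))"
    using x(6) by (simp add: apply_steps_append m flip: W_def)
  have "mset (concat (map postorder (Node c t1 t2 # rest))) = mset (ms @ [m])"
    using perm[of postorder] Ts(1) t1 t2 x m by simp
  then show ?case
    using dl sl r by (intro exI[of _ "Node c t1 t2 # rest"]) (auto simp: Un_assoc)
qed

text \<open>At the top all trees of the forest have the label set \<open>{1..n}\<close>; two of them
  could not be disjoint, so there is only one.\<close>

lemma step_lists_tree:
  assumes "ms \<in> step_lists n i" "1 \<le> n"
  shows "\<exists>T\<in>labeled_trees n i. mset (postorder T) = mset ms"
proof -
  obtain Ts where Ts: "mset (concat (map postorder Ts)) = mset ms" "distinct (concat (map leaves Ts))"
    "set (concat (map leaves Ts)) = {1..n}"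
    "wp_top n i = set (map (\<lambda>T. (set (leaves T), num_red T)) Ts)"
    using steps_forest[of n ms] assms by (auto simp: step_lists_def)
  have all: "set (leaves T) = {1..n} \<and> num_red T = i" if "T \<in> set Ts" for T
  proof -
    have "(set (leaves T), num_red T) \<in> wp_top n i" unfolding Ts(4) using that by simp
    then show ?thesis by (simp add: wp_top_def)
  qed
  obtain T Ts' where T: "Ts = T # Ts'" using Ts(4) by (cases Ts) (auto simp: wp_top_def)
  have "Ts' = []"
  proof (cases Ts')
    case (Cons U us)
    then have "set (leaves T) \<inter> set (leaves U) = {}" using Ts(2) T by auto
    then show ?thesis using all[of T] all[of U] T Cons assms(2) by auto
  qed
  then show ?thesis using Ts all[of T] T by (intro bexI[of _ T]) (auto simp: labeled_trees_def)
qed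

section \<open>Presentations of quotients of free modules\<close>

lemma linear_extension_sum:
  assumes "finite A" "Poly_Mapping.keys f \<subseteq> A"
  shows "linear_extension b f = (\<Sum>x\<in>A. scale (Poly_Mapping.lookup f x) (b x))"
  unfolding linear_extension_def
  by (rule sum.mono_neutral_left) (use assms in \<open>auto simp: in_keys_iff\<close>)

lemma linear_extension_add:
  "linear_extension b (f + g) = linear_extension b f + linear_extension b g"
proof -
  let ?A = "Poly_Mapping.keys f \<union> Poly_Mapping.keys g"
  have "linear_extension b (f + g) = (\<Sum>x\<in>?A. scale (Poly_Mapping.lookup (f + g) x) (b x))"
    by (rule linear_extension_sum) (use Poly_Mapping.keys_add[of f g] in auto)
  also have "\<dots> = linear_extension b f + linear_extension b g"
    by (simp add: linear_extension_sum[of ?A] lookup_add comb.scale_left_distrib sum.distrib)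
  finally show ?thesis .
qed

lemma linear_extension_scale: "linear_extension b (scale c f) = scale c (linear_extension b f)"
proof -
  have "linear_extension b (scale c f) =
      (\<Sum>x\<in>Poly_Mapping.keys f. scale (Poly_Mapping.lookup (scale c f) x) (b x))"
    by (rule linear_extension_sum) (auto simp: in_keys_iff)
  also have "\<dots> = scale c (linear_extension b f)"
    by (simp add: linear_extension_def comb.scale_sum_right)
  finally show ?thesis .
qed

lemma linear_extension_gen [simp]: "linear_extension b (gen x :: 'a \<Rightarrow>\<^sub>0 'k::comm_ring_1) = b x"
  by (subst linear_extension_sum[of "{x}"]) auto

lemma linear_extension_zero [simp]: "linear_extension b 0 = 0"
  by (simp add: linear_extension_def)

lemma linear_extension_uminus: "linear_extension b (- f) = - linear_extension b f"
  using linear_extension_scale[of b "-1" f] by simp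

lemma linear_extension_diff:
  "linear_extension b (f - g) = linear_extension b f - linear_extension b g"
  using linear_extension_add[of b f "- g"] by (simp add: linear_extension_uminus)

lemma linear_extension_sum_distrib:
  "linear_extension b (\<Sum>x\<in>A. f x) = (\<Sum>x\<in>A. linear_extension b (f x))"
  by (induction A rule: infinite_finite_induct) (auto simp: linear_extension_add)

lemma subspace_free_on: "comb.subspace (free_on S :: ('a \<Rightarrow>\<^sub>0 'k::comm_ring_1) set)"
proof (rule comb.subspaceI)
  fix x y :: "'a \<Rightarrow>\<^sub>0 'k" assume "x \<in> free_on S" "y \<in> free_on S"
  then show "x + y \<in> free_on S"
    using Poly_Mapping.keys_add[of x y] by (auto simp: free_on_def)
next
  fix c and x :: "'a \<Rightarrow>\<^sub>0 'k" assume "x \<in> free_on S"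
  then show "scale c x \<in> free_on S"
    by (auto simp: free_on_def in_keys_iff subset_iff) (metis mult_zero_right)
qed (simp add: free_on_def)

lemma gen_in_free_on: "x \<in> S \<Longrightarrow> gen x \<in> free_on S"
  by (simp add: free_on_def)

lemma free_on_decompose: "f = (\<Sum>x\<in>Poly_Mapping.keys f. scale (Poly_Mapping.lookup f x) (gen x))"
  by (rule poly_mapping_eqI) (auto simp: lookup_sum lookup_single when_def in_keys_iff if_distrib
      cong: if_cong)

lemma free_on_induct:
  assumes "f \<in> free_on S" "comb.subspace V" "\<And>x. x \<in> S \<Longrightarrow> gen x \<in> V"
  shows "f \<in> V"
  by (subst free_on_decompose) (use assms in \<open>auto intro!: comb.subspace_sum comb.subspace_scale
      simp: free_on_def\<close>)

lemma subspace_linear_preimage: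
  "comb.subspace V \<Longrightarrow> comb.subspace {f. linear_extension b f \<in> V}"
  unfolding comb.subspace_def by (auto simp: linear_extension_add linear_extension_scale)

lemma subspace_linear_image:
  "comb.subspace V \<Longrightarrow> comb.subspace (linear_extension b ` V)"
  unfolding comb.subspace_def
  by (auto simp flip: linear_extension_add linear_extension_scale intro!: imageI)
    (metis imageI linear_extension_zero)

lemma linear_extension_free_on:
  assumes "f \<in> free_on S" "\<And>x. x \<in> S \<Longrightarrow> b x \<in> V" "comb.subspace V"
  shows "linear_extension b f \<in> V"
  unfolding linear_extension_def
  using assms by (auto intro!: comb.subspace_sum comb.subspace_scale simp: free_on_def)

lemma coset_mem_iff: "y \<in> x +o N \<longleftrightarrow> y - x \<in> N" for x :: "'a \<Rightarrow>\<^sub>0 'k::comm_ring_1"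
  by (force simp: elt_set_plus_def)

lemma coset_eq_iff:
  assumes "comb.subspace N" shows "x +o N = y +o N \<longleftrightarrow> x - y \<in> N"
proof
  assume "x +o N = y +o N"
  moreover have "x \<in> x +o N" using comb.subspace_0[OF assms] by (simp add: coset_mem_iff)
  ultimately show "x - y \<in> N" by (simp add: coset_mem_iff)
next
  assume d: "x - y \<in> N"
  have "z - x \<in> N \<longleftrightarrow> z - y \<in> N" for z
    using comb.subspace_add[OF assms _ d, of "z - x"] comb.subspace_diff[OF assms _ d, of "z - y"] by auto
  then show "x +o N = y +o N" by (auto simp: coset_mem_iff)
qed

lemma coset_add:
  assumes "comb.subspace N" shows "(x +o N) + (y +o N) = (x + y) +o N"
proof -
  have "N + N = N"
    using comb.subspace_add[OF assms] comb.subspace_0[OF assms]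
    by (auto elim!: set_plus_elim) (metis add.right_neutral set_plus_intro)
  then show ?thesis by (simp add: set_plus_rearrange)
qed

text \<open>Scaling by a nonunit, such as 0, may shrink \<open>N\<close>; the added \<open>N\<close>
  restores the full coset.\<close>

lemma coset_scale:
  assumes "comb.subspace N" shows "scale c ` (x +o N) + N = scale c x +o N"
proof
  show "scale c ` (x +o N) + N \<subseteq> scale c x +o N"
  proof
    fix z assume "z \<in> scale c ` (x +o N) + N"
    then obtain w m where w: "w - x \<in> N" "m \<in> N" "z = scale c w + m"
      by (auto elim!: set_plus_elim simp: coset_mem_iff)
    then have "z - scale c x = scale c (w - x) + m" by (simp add: comb.scale_right_diff_distrib)
    then show "z \<in> scale c x +o N"
      using comb.subspace_add[OF assms comb.subspace_scale[OF assms w(1)] w(2)] by (simp add: coset_mem_iff)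
  qed
  show "scale c x +o N \<subseteq> scale c ` (x +o N) + N"
  proof
    fix z assume "z \<in> scale c x +o N"
    then have "z - scale c x \<in> N" by (simp add: coset_mem_iff)
    moreover have "scale c x \<in> scale c ` (x +o N)"
      using comb.subspace_0[OF assms] by (simp add: coset_mem_iff)
    ultimately show "z \<in> scale c ` (x +o N) + N"
      using set_plus_intro[of "scale c x" _ "z - scale c x"] by fastforce
  qed
qed

text \<open>\<open>c\<close> and \<open>\<psi>\<close> descend to the quotients because each sends
  the relations on its side into those on the other, and the induced maps are mutually inverse
  because they are so on generators. For \<open>2 \<le> n\<close> this is applied with
  \<open>H\<close> the maximal chains and \<open>D\<close> the coboundaries.\<close>

lemma presented_by_quotient:
  fixes c :: "'g \<Rightarrow> 'h" and \<psi> :: "'h \<Rightarrow> ('g \<Rightarrow>\<^sub>0 'k::comm_ring_1)"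
  assumes R: "R \<subseteq> free_on G" and D: "comb.subspace D"
    and c: "\<And>g. g \<in> G \<Longrightarrow> c g \<in> H" and \<psi>: "\<And>h. h \<in> H \<Longrightarrow> \<psi> h \<in> free_on G"
    and cR: "\<And>r. r \<in> R \<Longrightarrow> linear_extension (\<lambda>g. gen (c g)) r \<in> D"
    and \<psi>D: "\<And>d. d \<in> D \<Longrightarrow> linear_extension \<psi> d \<in> comb.span R"
    and c\<psi>: "\<And>h. h \<in> H \<Longrightarrow> linear_extension (\<lambda>g. gen (c g)) (\<psi> h) - gen h \<in> D"
    and \<psi>c: "\<And>g. g \<in> G \<Longrightarrow> \<psi> (c g) - gen g \<in> comb.span R"
  shows "presented_by (quotient_module (free_on H) D) G (\<lambda>g. gen (c g) +o D) R"
proof -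
  define L where "L = linear_extension (\<lambda>g. gen (c g) :: 'h \<Rightarrow>\<^sub>0 'k)"
  define P where "P = linear_extension \<psi>"
  let ?N = "comb.span R"
  note Nsub = comb.subspace_span[of R]
  have LN: "L r \<in> D" if "r \<in> ?N" for r
    using comb.span_minimal[OF _ subspace_linear_preimage[OF D]] cR that unfolding L_def by blast
  have LH: "L f \<in> free_on H" if "f \<in> free_on G" for f
    unfolding L_def by (rule linear_extension_free_on[OF that])
      (auto intro: gen_in_free_on c subspace_free_on)
  have PG: "P f \<in> free_on G" if "f \<in> free_on H" for f
    unfolding P_def by (rule linear_extension_free_on[OF that]) (auto intro: \<psi> subspace_free_on)
  \<comment> \<open>The vectors that satisfy the claim form a submodule, so the generators
    suffice.\<close>
  have LP: "L (P h) - h \<in> D" if "h \<in> free_on H" for h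
  proof -
    have "comb.subspace {h. L (P h) - h \<in> D}"
    proof (rule comb.subspaceI)
      fix x y assume "x \<in> {h. L (P h) - h \<in> D}" "y \<in> {h. L (P h) - h \<in> D}"
      then show "x + y \<in> {h. L (P h) - h \<in> D}"
        using comb.subspace_add[OF D, of "L (P x) - x" "L (P y) - y"]
        by (simp add: L_def P_def linear_extension_add algebra_simps)
    next
      fix k x assume "x \<in> {h. L (P h) - h \<in> D}"
      then show "scale k x \<in> {h. L (P h) - h \<in> D}"
        using comb.subspace_scale[OF D, of "L (P x) - x" k]
        by (simp add: L_def P_def linear_extension_scale comb.scale_right_diff_distrib)
    qed (simp add: L_def P_def comb.subspace_0[OF D])
    then have "h \<in> {h. L (P h) - h \<in> D}"
      by (rule free_on_induct[OF that]) (simp add: c\<psi> L_def P_def)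
    then show ?thesis by simp
  qed
  have PL: "P (L g) - g \<in> ?N" if "g \<in> free_on G" for g
  proof -
    have "comb.subspace {h. P (L h) - h \<in> ?N}"
    proof (rule comb.subspaceI)
      fix x y assume "x \<in> {h. P (L h) - h \<in> ?N}" "y \<in> {h. P (L h) - h \<in> ?N}"
      then show "x + y \<in> {h. P (L h) - h \<in> ?N}"
        using comb.subspace_add[OF Nsub, of "P (L x) - x" "P (L y) - y"]
        by (simp add: L_def P_def linear_extension_add algebra_simps)
    next
      fix k x assume "x \<in> {h. P (L h) - h \<in> ?N}"
      then show "scale k x \<in> {h. P (L h) - h \<in> ?N}"
        using comb.subspace_scale[OF Nsub, of "P (L x) - x" k]
        by (simp add: L_def P_def linear_extension_scale comb.scale_right_diff_distrib)
    qed (simp add: L_def P_def comb.subspace_0[OF Nsub])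
    then have "g \<in> {h. P (L h) - h \<in> ?N}"
      by (rule free_on_induct[OF that]) (simp add: \<psi>c L_def P_def)
    then show ?thesis by simp
  qed
  \<comment> \<open>A map on cosets without a choice of representatives; adding \<open>D\<close>
    completes the image, since \<open>L\<close> need not map a coset onto a coset.\<close>
  define \<phi> where "\<phi> X = L ` X + D" for X
  have \<phi>: "\<phi> (x +o ?N) = L x +o D" for x
  proof
    show "\<phi> (x +o ?N) \<subseteq> L x +o D"
    proof
      fix z assume "z \<in> \<phi> (x +o ?N)"
      then obtain w d where w: "w - x \<in> ?N" "d \<in> D" "z = L w + d"
        by (auto simp: \<phi>_def coset_mem_iff elim!: set_plus_elim)
      then have "z - L x = L (w - x) + d" by (simp add: L_def linear_extension_diff)
      then show "z \<in> L x +o D"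
        using comb.subspace_add[OF D LN[OF w(1)] w(2)] by (simp add: coset_mem_iff)
    qed
    show "L x +o D \<subseteq> \<phi> (x +o ?N)"
    proof
      fix z assume "z \<in> L x +o D"
      then have "z - L x \<in> D" by (simp add: coset_mem_iff)
      moreover have "L x \<in> L ` (x +o ?N)"
        using comb.subspace_0[OF Nsub] by (simp add: coset_mem_iff)
      ultimately show "z \<in> \<phi> (x +o ?N)"
        using set_plus_intro[of "L x" _ "z - L x"] unfolding \<phi>_def by fastforce
    qed
  qed
  have "is_module_iso \<phi> (quotient_module (free_on G) ?N) (quotient_module (free_on H) D)"
    unfolding is_module_iso_def
  proof (intro conjI ballI allI)
    show "bij_betw \<phi> (carrier (quotient_module (free_on G) ?N)) (carrier (quotient_module (free_on H) D))"
      unfolding bij_betw_def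
    proof
      show "inj_on \<phi> (carrier (quotient_module (free_on G) ?N))"
      proof (rule inj_onI)
        fix X Y assume "X \<in> carrier (quotient_module (free_on G) ?N)"
          "Y \<in> carrier (quotient_module (free_on G) ?N)" and e: "\<phi> X = \<phi> Y"
        then obtain x y where x: "x \<in> free_on G" "y \<in> free_on G" "X = x +o ?N" "Y = y +o ?N"
          by (auto simp: quotient_module_def)
        then have "L (x - y) \<in> D"
          using e by (simp add: \<phi> coset_eq_iff[OF D] L_def linear_extension_diff)
        then have "P (L (x - y)) \<in> ?N" using \<psi>D by (simp add: P_def)
        moreover have "P (L (x - y)) - (x - y) \<in> ?N"
          by (rule PL) (rule comb.subspace_diff[OF subspace_free_on x(1,2)])
        ultimately have "x - y \<in> ?N" using comb.span_diff by fastforce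
        then show "X = Y" using x coset_eq_iff[OF Nsub] by simp
      qed
      show "\<phi> ` carrier (quotient_module (free_on G) ?N) = carrier (quotient_module (free_on H) D)"
      proof
        show "\<phi> ` carrier (quotient_module (free_on G) ?N) \<subseteq> carrier (quotient_module (free_on H) D)"
          using LH by (auto simp: quotient_module_def \<phi>)
        show "carrier (quotient_module (free_on H) D) \<subseteq> \<phi> ` carrier (quotient_module (free_on G) ?N)"
        proof
          fix Y assume "Y \<in> carrier (quotient_module (free_on H) D)"
          then obtain h where h: "h \<in> free_on H" "Y = h +o D" by (auto simp: quotient_module_def)
          then have "Y = \<phi> (P h +o ?N)" using LP[OF h(1)] by (simp add: \<phi> coset_eq_iff[OF D] flip:
              coset_eq_iff)
            (metis coset_eq_iff[OF D])
          then show "Y \<in> \<phi> ` carrier (quotient_module (free_on G) ?N)"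
            using PG[OF h(1)] by (auto simp: quotient_module_def)
        qed
      qed
    qed
  next
    fix X Y assume "X \<in> carrier (quotient_module (free_on G) ?N)" "Y \<in> carrier (quotient_module
        (free_on G) ?N)"
    then show "\<phi> (X \<oplus>\<^bsub>quotient_module (free_on G) ?N\<^esub> Y) = \<phi> X \<oplus>\<^bsub>quotient_module (free_on H) D\<^esub> \<phi> Y"
      by (auto simp: quotient_module_def coset_add[OF Nsub] coset_add[OF D] \<phi> L_def linear_extension_add)
  next
    fix k X assume "X \<in> carrier (quotient_module (free_on G) ?N)"
    then show "\<phi> (k \<odot>\<^bsub>quotient_module (free_on G) ?N\<^esub> X) = k \<odot>\<^bsub>quotient_module (free_on H) D\<^esub> \<phi> X"
      by (auto simp: quotient_module_def coset_scale[OF Nsub] coset_scale[OF D] \<phi> L_def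
          linear_extension_scale)
  qed
  moreover have "\<phi> (gen g +o ?N) = gen (c g) +o D" for g
    by (simp add: \<phi> L_def)
  ultimately show ?thesis unfolding presented_by_def by blast
qed

section \<open>Coboundaries of chains with one missing rank\<close>

lemma take_steps:
  assumes "ms \<in> step_lists n i"
  shows "apply_steps (wp_bot n) (take k ms) \<in> weighted_partitions n"
    and "k \<le> length ms \<Longrightarrow> card (apply_steps (wp_bot n) (take k ms)) + k = n"
proof -
  have "valid_steps (wp_bot n) (take k ms)"
    using assms valid_steps_append[of "wp_bot n" "take k ms" "drop k ms"] by (simp add: step_lists_def)
  from apply_steps_weighted_partition[OF wp_bot_weighted_partition this]
  show "apply_steps (wp_bot n) (take k ms) \<in> weighted_partitions n"
    and "k \<le> length ms \<Longrightarrow> card (apply_steps (wp_bot n) (take k ms)) + k = n"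
    by (simp_all add: card_wp_bot)
qed

abbreviation proper_part :: "nat \<Rightarrow> nat \<Rightarrow> weighted_partition set" where
  "proper_part n i \<equiv> open_interval (weighted_partitions n) (wp_less n) (wp_bot n) (wp_top n i)"

lemma sorted_wrt_inner:
  assumes "ms \<in> step_lists n i" "2 \<le> n"
  shows "sorted_wrt (wp_less n) (inner n ms)" "set (inner n ms) \<subseteq> proper_part n i"
proof -
  have v: "valid_steps (wp_bot n) ms" using assms(1) by (simp add: step_lists_def)
  have "sorted_wrt (wp_less n) (wp_bot n # inner n ms @ [wp_top n i])"
    and "set (wp_bot n # inner n ms @ [wp_top n i]) \<subseteq> weighted_partitions n"
    using merge_chain_sorted[OF wp_bot_weighted_partition v] merge_chain_inner[OF assms] by simp_all
  then show "sorted_wrt (wp_less n) (inner n ms)" "set (inner n ms) \<subseteq> proper_part n i"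
    by (auto simp: sorted_wrt_append open_interval_def)
qed

lemma inner_in_chains:
  assumes "ms \<in> step_lists n i" "2 \<le> n"
  shows "inner n ms \<in> chains (proper_part n i) (wp_less n) (int n - 3)"
  using sorted_wrt_inner[OF assms] length_inner[OF assms(1)] assms(2) by (auto simp: chains_def)

lemma chains_extend:
  assumes xs: "set xs \<subseteq> proper_part n i" "sorted_wrt (wp_less n) xs" and n: "2 \<le> n" "i \<le> n - 1"
  shows "sorted_wrt (wp_less n) (wp_bot n # xs @ [wp_top n i])"
    and "set (wp_bot n # xs @ [wp_top n i]) \<subseteq> weighted_partitions n"
  using assms wp_bot_less_wp_top[OF n] wp_bot_weighted_partition wp_top_weighted_partition[of n i]
  by (auto simp: sorted_wrt_append open_interval_def)

lemma chains_imp_inner: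
  assumes xs: "xs \<in> chains (proper_part n i) (wp_less n) (int n - 3)" and n: "2 \<le> n" "i \<le> n - 1"
  shows "\<exists>ms\<in>step_lists n i. inner n ms = xs"
proof -
  have x: "set xs \<subseteq> proper_part n i" "sorted_wrt (wp_less n) xs" "length xs = n - 2"
    using xs n by (auto simp: chains_def)
  have "\<exists>ms. valid_steps (wp_bot n) ms \<and> merge_chain (wp_bot n) ms = wp_bot n # xs @ [wp_top n i]"
  proof (rule saturated_chain_steps)
    show "card (wp_bot n) = length (wp_bot n # xs @ [wp_top n i])"
      using x(3) n by (simp add: card_wp_bot)
  qed (use chains_extend[OF x(1,2) n] in \<open>simp_all add: card_wp_top\<close>)
  then obtain ms where ms: "valid_steps (wp_bot n) ms" "merge_chain (wp_bot n) ms = wp_bot n # xs @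
      [wp_top n i]"
    by blast
  have "apply_steps (wp_bot n) ms = merge_chain (wp_bot n) ms ! length ms"
    by (simp add: merge_chain_nth)
  also have "\<dots> = last (merge_chain (wp_bot n) ms)"
    by (metis diff_Suc_1 last_conv_nth length_0_conv length_merge_chain nat.distinct(1))
  also have "\<dots> = wp_top n i" by (simp add: ms(2))
  finally have "ms \<in> step_lists n i" using ms(1) by (simp add: step_lists_def)
  moreover have "inner n ms = xs" by (simp add: inner_def ms(2))
  ultimately show ?thesis by blast
qed

lemma open_tree_chain_eq_inner:
  assumes T: "T \<in> labeled_trees n i" and n: "2 \<le> n"
  shows "open_tree_chain n i T = inner n (postorder T)"
proof -
  let ?ms = "postorder T"
  have ms: "?ms \<in> step_lists n i" using postorder_step_lists[OF T] .
  have "x \<noteq> wp_bot n \<and> x \<noteq> wp_top n i" if "x \<in> set (inner n ?ms)" for x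
    using sorted_wrt_inner(2)[OF ms n] that by (auto simp: open_interval_def wp_less_def)
  then show ?thesis
    unfolding open_tree_chain_def tree_chain_def merge_chain_inner[OF ms n]
    by (simp add: filter_id_conv)
qed

text \<open>Adding the bottom and the top to \<open>xs\<close> absorbs the boundary cases of the
  definition: an insertion at position \<open>j\<close> fills the gap between the entries
  \<open>j\<close> and \<open>j + 1\<close> of the extended list.\<close>

lemma coboundary_of_chain_between:
  assumes xs: "set xs \<subseteq> proper_part n i" "sorted_wrt (wp_less n) xs" and n: "2 \<le> n" "i \<le> n - 1"
  shows "coboundary_of_chain (proper_part n i) (wp_less n) xs =
    (\<Sum>j\<le>length xs. scale ((-1) ^ j)
      (\<Sum>\<alpha>\<in>between n ((wp_bot n # xs @ [wp_top n i]) ! j) ((wp_bot n # xs @ [wp_top n i]) ! Suc j).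
        gen (take j xs @ \<alpha> # drop j xs)))"
proof -
  let ?f = "wp_bot n # xs @ [wp_top n i]"
  note s = chains_extend[OF assms]
  have "{\<alpha> \<in> proper_part n i. (0 < j \<longrightarrow> wp_less n (xs ! (j - 1)) \<alpha>) \<and> (j < length xs \<longrightarrow> wp_less n \<alpha>
      (xs ! j))} =
      between n (?f ! j) (?f ! Suc j)" (is "?A = ?B") if j: "j \<le> length xs" for j
  proof -
    have lo: "0 < j \<Longrightarrow> ?f ! j = xs ! (j - 1)" "j = 0 \<Longrightarrow> ?f ! j = wp_bot n"
      using j by (auto simp: nth_append nth_Cons')
    have hi: "j < length xs \<Longrightarrow> ?f ! Suc j = xs ! j" "\<not> j < length xs \<Longrightarrow> ?f ! Suc j = wp_top n i"
      using j by (auto simp: nth_append)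
    have "j < length ?f" "Suc j < length ?f" using j by simp_all
    then have W: "?f ! j \<in> weighted_partitions n" "?f ! Suc j \<in> weighted_partitions n"
      using s(2) nth_mem by blast+
    have b: "0 < j \<Longrightarrow> wp_less n (wp_bot n) (?f ! j)"
      using sorted_wrt_nth_less[OF s(1), of 0 j] j by simp
    have t: "j < length xs \<Longrightarrow> wp_less n (?f ! Suc j) (wp_top n i)"
      using sorted_wrt_nth_less[OF s(1), of "Suc j" "Suc (length xs)"] j by (simp add: nth_append)
    have "\<alpha> \<in> ?A \<longleftrightarrow> \<alpha> \<in> ?B" for \<alpha>
    proof
      assume "\<alpha> \<in> ?A"
      then show "\<alpha> \<in> ?B"
        unfolding between_def open_interval_def using lo hi by (cases "j = 0"; cases "j < length xs") auto
    next
      assume a: "\<alpha> \<in> ?B"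
      then have a': "\<alpha> \<in> weighted_partitions n" "wp_less n (?f ! j) \<alpha>" "wp_less n \<alpha> (?f ! Suc j)"
        by (auto simp: between_def)
      have "wp_less n (wp_bot n) \<alpha>"
        using a' b lo(2) wp_less_trans[OF wp_bot_weighted_partition W(1) a'(1)] by (cases "j = 0") auto
      moreover have "wp_less n \<alpha> (wp_top n i)"
      proof (cases "j < length xs")
        case True
        then show ?thesis
          using wp_less_trans[OF a'(1) W(2) wp_top_weighted_partition a'(3)] t n by simp
      next
        case False
        then show ?thesis using a'(3) hi(2) by simp
      qed
      ultimately show "\<alpha> \<in> ?A"
        using a' lo(1) hi(1) unfolding open_interval_def by auto
    qed
    then show ?thesis by blast
  qed
  then show ?thesis unfolding coboundary_of_chain_def by (intro sum.cong) auto
qed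

lemma between_empty:
  assumes "V \<in> weighted_partitions n" "U \<in> weighted_partitions n" "card V \<le> Suc (card U)"
  shows "between n V U = {}"
proof -
  have "False" if "\<alpha> \<in> between n V U" for \<alpha>
    using that wp_less_card(1)[OF assms(1), of \<alpha>] wp_less_card(1)[of \<alpha>, OF _ assms(2)] assms(3)
    by (fastforce simp: between_def)
  then show ?thesis by blast
qed

text \<open>The coboundary, up to sign, of the chain obtained by deleting the \<open>k\<close>th element of \<open>inner n ms\<close>.\<close>

definition gap_sum ::
  "nat \<Rightarrow> (color \<times> nat set \<times> nat set) list \<Rightarrow> nat \<Rightarrow> (weighted_partition list \<Rightarrow>\<^sub>0 'k::comm_ring_1)" where
  "gap_sum n ms k =
     (\<Sum>\<alpha>\<in>between n (apply_steps (wp_bot n) (take k ms)) (apply_steps (wp_bot n) (take (Suc (Suc k)) ms)).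
        gen ((inner n ms)[k := \<alpha>]))"

text \<open>Only the gap left by the deleted element spans two ranks, so only the term
  \<open>j = k\<close> survives. As \<open>inner n ms\<close> starts at rank 1, its entry
  \<open>k\<close> lies between the results of \<open>k\<close> and of \<open>k + 2\<close>
  steps.\<close>

lemma coboundary_gap:
  assumes ms: "ms \<in> step_lists n i" and n: "2 \<le> n" "i \<le> n - 1"
    and xs: "set xs \<subseteq> proper_part n i" "sorted_wrt (wp_less n) xs"
    and k: "k \<le> length xs" "inner n ms = take k xs @ \<alpha> # drop k xs"
  shows "(\<Sum>\<beta>\<in>between n ((wp_bot n # xs @ [wp_top n i]) ! k) ((wp_bot n # xs @ [wp_top n i]) ! Suc k).
      gen (take k xs @ \<beta> # drop k xs)) = (gap_sum n ms k :: _ \<Rightarrow>\<^sub>0 'k::comm_ring_1)"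
    and "coboundary_of_chain (proper_part n i) (wp_less n) xs =
      scale ((-1) ^ k) (gap_sum n ms k :: _ \<Rightarrow>\<^sub>0 'k)"
proof -
  let ?f = "wp_bot n # xs @ [wp_top n i]"
  let ?W = "\<lambda>l. apply_steps (wp_bot n) (take l ms)"
  have len: "Suc (length ms) = n" "length xs = n - 3" "3 \<le> n"
    using length_step_lists[OF ms] length_inner[OF ms] k arg_cong[OF k(2), of length] by auto
  have g: "wp_bot n # take k xs @ \<alpha> # drop k xs @ [wp_top n i] = map ?W [0..<n]"
    using merge_chain_inner[OF ms n(1)] len unfolding merge_chain_eq k(2) by simp
  \<comment> \<open>Beyond the gap the index falls behind the number of steps by one.\<close>
  have f: "?f ! l = ?W (if l \<le> k then l else Suc l)" if l: "l < n - 1" for l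
  proof -
    have "?f ! l = (wp_bot n # take k xs @ \<alpha> # drop k xs @ [wp_top n i]) ! (if l \<le> k then l else Suc l)"
      using k(1) l len by (auto simp: nth_Cons' nth_append)
    also have "\<dots> = ?W (if l \<le> k then l else Suc l)"
      unfolding g using l by (subst nth_map) auto
    finally show ?thesis .
  qed
  have upd: "(inner n ms)[k := \<beta>] = take k xs @ \<beta> # drop k xs" for \<beta>
    using k by (simp add: list_update_append)
  have fk: "?f ! k = ?W k" "?f ! Suc k = ?W (Suc (Suc k))"
    using f[of k] f[of "Suc k"] k(1) len by simp_all
  show 1: "(\<Sum>\<beta>\<in>between n (?f ! k) (?f ! Suc k). gen (take k xs @ \<beta> # drop k xs)) =
      (gap_sum n ms k :: _ \<Rightarrow>\<^sub>0 'k)"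
    unfolding gap_sum_def upd fk ..
  have e: "between n (?f ! j) (?f ! Suc j) = {}" if j: "j \<le> length xs" "j \<noteq> k" for j
  proof (rule between_empty)
    have "?f ! j = ?W (if j \<le> k then j else Suc j)" "?f ! Suc j = ?W (Suc (if j \<le> k then j else Suc j))"
      using f[of j] f[of "Suc j"] j len by auto
    moreover have "Suc (if j \<le> k then j else Suc j) \<le> length ms" using j k(1) len by auto
    ultimately show "?f ! j \<in> weighted_partitions n" "?f ! Suc j \<in> weighted_partitions n"
      "card (?f ! j) \<le> Suc (card (?f ! Suc j))"
      using take_steps[OF ms, of "if j \<le> k then j else Suc j"]
        take_steps[OF ms, of "Suc (if j \<le> k then j else Suc j)"] by simp_all
  qed
  have "coboundary_of_chain (proper_part n i) (wp_less n) xs =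
      (\<Sum>j\<le>length xs. if j = k then scale ((-1) ^ k) (gap_sum n ms k :: _ \<Rightarrow>\<^sub>0 'k) else 0)"
    unfolding coboundary_of_chain_between[OF xs n]
  proof (rule sum.cong[OF refl])
    fix j assume "j \<in> {..length xs}"
    then have j: "j \<le> length xs" by simp
    show "scale ((-1) ^ j) (\<Sum>\<beta>\<in>between n (?f ! j) (?f ! Suc j). gen (take j xs @ \<beta> # drop j xs)) =
        (if j = k then scale ((-1) ^ k) (gap_sum n ms k :: _ \<Rightarrow>\<^sub>0 'k) else 0)"
    proof (cases "j = k")
      case True
      show ?thesis unfolding True 1 by simp
    next
      case False
      show ?thesis unfolding e[OF j False] using False by simp
    qed
  qed
  then show "coboundary_of_chain (proper_part n i) (wp_less n) xs =
      scale ((-1) ^ k) (gap_sum n ms k :: _ \<Rightarrow>\<^sub>0 'k)"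
    using k(1) by simp
qed

text \<open>Deleting entry \<open>k\<close> gives a chain one degree lower whose coboundary is the
  gap sum up to sign; the sign is removed by scaling.\<close>

lemma gap_sum_coboundary:
  assumes ms: "ms \<in> step_lists n i" and n: "2 \<le> n" "i \<le> n - 1" and k: "Suc k < length ms"
  shows "(gap_sum n ms k :: _ \<Rightarrow>\<^sub>0 'k::comm_ring_1) \<in> coboundaries (proper_part n i) (wp_less n) (int n - 3)"
proof -
  let ?i = "inner n ms"
  define xs where "xs = take k ?i @ drop (Suc k) ?i"
  have len: "k < length ?i" using k length_step_lists[OF ms] length_inner[OF ms] by simp
  have i: "?i = take k ?i @ ?i ! k # drop (Suc k) ?i" using len by (rule id_take_nth_drop)
  have "sorted_wrt (wp_less n) (take k ?i @ ?i ! k # drop (Suc k) ?i)"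
    "set (take k ?i @ ?i ! k # drop (Suc k) ?i) \<subseteq> proper_part n i"
    using sorted_wrt_inner[OF ms n(1)] i by simp_all
  then have x: "set xs \<subseteq> proper_part n i" "sorted_wrt (wp_less n) xs"
    by (auto simp: xs_def sorted_wrt_append)
  have "k \<le> length xs" "take k xs = take k ?i" "drop k xs = drop (Suc k) ?i" "length xs = n - 3" "3 \<le> n"
    using len length_inner[OF ms] by (auto simp: xs_def)
  note t = this
  then have i': "?i = take k xs @ ?i ! k # drop k xs" using i by simp
  have xc: "xs \<in> chains (proper_part n i) (wp_less n) (int n - 3 - 1)"
    using t x by (simp add: chains_def)
  have "coboundary_of_chain (proper_part n i) (wp_less n) xs =
      scale ((-1) ^ k) (gap_sum n ms k :: _ \<Rightarrow>\<^sub>0 'k)"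
    by (rule coboundary_gap(2)[OF ms n x t(1) i'])
  then have "(gap_sum n ms k :: _ \<Rightarrow>\<^sub>0 'k) = coboundary (proper_part n i) (wp_less n) (scale ((-1) ^
      k) (gen xs))"
    by (simp add: coboundary_def linear_extension_scale comb.scale_scale)
  moreover have "scale ((-1) ^ k) (gen xs) \<in> free_on (chains (proper_part n i) (wp_less n) (int n - 3 - 1))"
    by (intro comb.subspace_scale[OF subspace_free_on] gen_in_free_on xc)
  ultimately show ?thesis unfolding coboundaries_def by blast
qed

text \<open>If some gap can be filled, filling it gives a maximal chain, hence a step sequence, and
  \<open>coboundary_gap\<close> applies. Otherwise the coboundary vanishes; this alternative spares
  a proof that one gap can always be filled.\<close>

lemma coboundary_of_chain_gap_sum:
  assumes xs: "xs \<in> chains (proper_part n i) (wp_less n) (int n - 3 - 1)" and n: "2 \<le> n" "i \<le> n - 1"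
  shows "(coboundary_of_chain (proper_part n i) (wp_less n) xs :: _ \<Rightarrow>\<^sub>0 'k::comm_ring_1) = 0 \<or>
    (\<exists>ms\<in>step_lists n i. \<exists>k. Suc k < length ms \<and>
       coboundary_of_chain (proper_part n i) (wp_less n) xs =
         scale ((-1) ^ k) (gap_sum n ms k :: _ \<Rightarrow>\<^sub>0 'k))"
proof -
  let ?f = "wp_bot n # xs @ [wp_top n i]"
  have x: "set xs \<subseteq> proper_part n i" "sorted_wrt (wp_less n) xs" "int (length xs) = int n - 3"
    using xs by (auto simp: chains_def)
  show ?thesis
  proof (cases "\<exists>j\<le>length xs. between n (?f ! j) (?f ! Suc j) \<noteq> {}")
    case False
    then show ?thesis unfolding coboundary_of_chain_between[OF x(1,2) n]
      by (intro disjI1 sum.neutral) (auto simp del: nth_Cons_Suc append_Cons)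
  next
    case True
    then obtain j \<alpha> where j: "j \<le> length xs" "\<alpha> \<in> between n (?f ! j) (?f ! Suc j)" by blast
    note s = chains_extend[OF x(1,2) n]
    let ?x = "take j xs @ \<alpha> # drop j xs"
    have a: "\<alpha> \<in> weighted_partitions n" "wp_less n (?f ! j) \<alpha>" "wp_less n \<alpha> (?f ! Suc j)"
      using j(2) by (auto simp: between_def)
    have W: "?f ! l \<in> weighted_partitions n" if "l < length ?f" for l
      using that by (intro subsetD[OF s(2)] nth_mem)
    have lo: "wp_less n (?f ! l) \<alpha>" if "l \<le> j" for l
      using that a wp_less_trans[OF W[of l] W[of j] a(1)] sorted_wrt_nth_less[OF s(1), of l j] j(1)
      by (cases "l = j") auto
    have hi: "wp_less n \<alpha> (?f ! l)" if "Suc j \<le> l" "l < length ?f" for l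
      using that a wp_less_trans[OF a(1) W[of "Suc j"] W[of l]] sorted_wrt_nth_less[OF s(1), of "Suc
          j" l] j(1)
      by (cases "l = Suc j") auto
    have "wp_less n z \<alpha>" if "z \<in> set (take j xs)" for z
    proof -
      obtain l where "l < j" "z = xs ! l" using \<open>z \<in> _\<close> j(1) by (auto simp: in_set_conv_nth)
      then show ?thesis using lo[of "Suc l"] j(1) by (simp add: nth_append)
    qed
    moreover have "wp_less n \<alpha> z" if "z \<in> set (drop j xs)" for z
    proof -
      obtain l where "l < length (drop j xs)" "z = drop j xs ! l"
        using \<open>z \<in> _\<close> by (metis in_set_conv_nth)
      then have "j + l < length xs" "z = xs ! (j + l)" using j(1) by simp_all
      then show ?thesis using hi[of "Suc (j + l)"] by (simp add: nth_append)
    qed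
    moreover have "sorted_wrt (wp_less n) (take j xs @ drop j xs)" using x(2) by simp
    ultimately have "sorted_wrt (wp_less n) ?x"
      unfolding sorted_wrt_append by auto
    moreover have "\<alpha> \<in> proper_part n i"
      using a(1) lo[of 0] hi[of "Suc (length xs)"] j(1) by (simp add: open_interval_def nth_append)
    then have "set ?x \<subseteq> proper_part n i"
      using x(1) set_take_subset[of j xs] set_drop_subset[of j xs] by auto
    ultimately have "?x \<in> chains (proper_part n i) (wp_less n) (int n - 3)"
      using x(3) j(1) by (auto simp: chains_def)
    then obtain ms where ms: "ms \<in> step_lists n i" "inner n ms = ?x"
      using chains_imp_inner n by blast
    have "Suc j < length ms"
      using length_step_lists[OF ms(1)] x(3) j(1) by linarith
    then show ?thesis using coboundary_gap(2)[OF ms(1) n x(1,2) j(1) ms(2)] ms(1) by blast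
  qed
qed

section \<open>Gaps left by two consecutive merges\<close>

lemma step_lists_split:
  "ms1 @ ms @ ms2 \<in> step_lists n i \<longleftrightarrow>
    valid_steps (wp_bot n) ms1 \<and> valid_steps (apply_steps (wp_bot n) ms1) ms \<and>
    valid_steps (apply_steps (apply_steps (wp_bot n) ms1) ms) ms2 \<and>
    apply_steps (apply_steps (apply_steps (wp_bot n) ms1) ms) ms2 = wp_top n i"
  by (simp add: step_lists_def valid_steps_append apply_steps_append)

text \<open>Two pairs of steps with the same joint effect give chains that differ only in the
  element between them. Its position is \<open>length ms1\<close>, because \<open>inner\<close>
  omits the bottom.\<close>

lemma inner_update:
  assumes 1: "ms1 @ [m1, m2] @ ms2 \<in> step_lists n i" and 2: "valid_steps (apply_steps (wp_bot n)
      ms1) [m1', m2']"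
    and e: "apply_steps (apply_steps (wp_bot n) ms1) [m1', m2'] = apply_steps (apply_steps (wp_bot
        n) ms1) [m1, m2]"
  shows "ms1 @ [m1', m2'] @ ms2 \<in> step_lists n i"
    and "inner n (ms1 @ [m1', m2'] @ ms2) =
      (inner n (ms1 @ [m1, m2] @ ms2))[length ms1 := apply_steps (apply_steps (wp_bot n) ms1) [m1']]"
proof -
  let ?ms = "ms1 @ [m1, m2] @ ms2" and ?ms' = "ms1 @ [m1', m2'] @ ms2"
  show 2: "?ms' \<in> step_lists n i"
    using 1 2 e unfolding step_lists_split by metis
  show "inner n ?ms' = (inner n ?ms)[length ms1 := apply_steps (apply_steps (wp_bot n) ms1) [m1']]"
  proof (rule nth_equalityI)
    show "length (inner n ?ms') =
        length ((inner n ?ms)[length ms1 := apply_steps (apply_steps (wp_bot n) ms1) [m1']])"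
      using length_inner[OF 1] length_inner[OF 2] by simp
  next
    fix l assume "l < length (inner n ?ms')"
    then have l: "Suc l < length ?ms" "l < length (inner n ?ms)"
      using length_inner[OF 2] length_step_lists[OF 2] length_inner[OF 1] by simp_all
    then have i: "inner n ?ms' ! l = apply_steps (wp_bot n) (take (Suc l) ?ms')"
      "inner n ?ms ! l = apply_steps (wp_bot n) (take (Suc l) ?ms)"
      using inner_nth[OF 1] inner_nth[OF 2] by simp_all
    consider "l < length ms1" | "l = length ms1" | "l > length ms1" by linarith
    then show "inner n ?ms' ! l =
        (inner n ?ms)[length ms1 := apply_steps (apply_steps (wp_bot n) ms1) [m1']] ! l"
    proof cases
      case 1
      then show ?thesis using i by simp
    next
      case 2
      then show ?thesis using i l by (simp add: apply_steps_append)
    next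
      case 3
      then obtain d where "Suc l = length ms1 + Suc (Suc d)"
        by (metis Suc_lessE add_Suc_right less_iff_Suc_add)
      then have "take (Suc l) ?ms' = ms1 @ [m1', m2'] @ take d ms2"
        "take (Suc l) ?ms = ms1 @ [m1, m2] @ take d ms2" by simp_all
      then show ?thesis using 3 i e by (simp add: apply_steps_append del: append_Cons)
    qed
  qed
qed

lemma step_lists_middle:
  assumes "ms1 @ [m1, m2] @ ms2 \<in> step_lists n i"
  shows "apply_steps (wp_bot n) ms1 \<in> weighted_partitions n"
    and "valid_steps (apply_steps (wp_bot n) ms1) [m1, m2]"
  using assms apply_steps_weighted_partition[OF wp_bot_weighted_partition, of n ms1]
  unfolding step_lists_split by blast+

lemma gap_sum_middle:
  "gap_sum n (ms1 @ [m1, m2] @ ms2) (length ms1) =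
    (\<Sum>\<alpha>\<in>between n (apply_steps (wp_bot n) ms1) (apply_steps (apply_steps (wp_bot n) ms1) [m1, m2]).
        gen ((inner n (ms1 @ [m1, m2] @ ms2))[length ms1 := \<alpha>]))"
proof -
  have "take (length ms1) (ms1 @ [m1, m2] @ ms2) = ms1"
    "take (Suc (Suc (length ms1))) (ms1 @ [m1, m2] @ ms2) = ms1 @ [m1, m2]" by simp_all
  then show ?thesis unfolding gap_sum_def by (simp only: apply_steps_append)
qed

declare valid_steps.simps(2) [simp del] apply_steps.simps(2) [simp del]

text \<open>By \<open>sep\<close> the second merge does not use the block made by the first, so the
  two commute. Together with \<open>gap_sum_coboundary\<close>, transposing them changes the sign
  modulo coboundaries.\<close>

lemma gap_sum_separate:
  assumes ms: "ms1 @ [(c, A, B), (d, E, F)] @ ms2 \<in> step_lists n i"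
    and sep: "A \<union> B \<noteq> E" "A \<union> B \<noteq> F"
  shows "ms1 @ [(d, E, F), (c, A, B)] @ ms2 \<in> step_lists n i"
    and "gap_sum n (ms1 @ [(c, A, B), (d, E, F)] @ ms2) (length ms1) =
      gen (inner n (ms1 @ [(c, A, B), (d, E, F)] @ ms2)) +
      (gen (inner n (ms1 @ [(d, E, F), (c, A, B)] @ ms2)) :: _ \<Rightarrow>\<^sub>0 'k::comm_ring_1)"
proof -
  define V where "V = apply_steps (wp_bot n) ms1"
  let ?ms = "ms1 @ [(c, A, B), (d, E, F)] @ ms2" and ?ms' = "ms1 @ [(d, E, F), (c, A, B)] @ ms2"
  have V: "V \<in> weighted_partitions n" "valid_steps V [(c, A, B), (d, E, F)]"
    using step_lists_middle[OF ms] by (simp_all add: V_def)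
  have D: "disjoint_blocks V" using V unfolding weighted_partitions_iff by blast
  obtain a b where ab: "a \<in> V" "b \<in> V" "a \<noteq> b" "A = fst a" "B = fst b"
    "valid_steps (merge_pair c a b V) [(d, E, F)]" "merge_pair c a b V \<in> weighted_partitions n"
    using valid_step_merge_pair[OF V] by metis
  obtain e h where eh: "e \<in> merge_pair c a b V" "h \<in> merge_pair c a b V" "e \<noteq> h" "E = fst e" "F = fst h"
    using valid_step_merge_pair[OF ab(7,6)] by metis
  have "e \<noteq> block_join c a b" "h \<noteq> block_join c a b" using sep ab eh by auto
  then have eh': "e \<in> V" "h \<in> V" "{a, b} \<inter> {e, h} = {}" using eh by (auto simp: merge_pair_def)
  have D1: "disjoint_blocks (merge_pair c a b V)" "disjoint_blocks (merge_pair d e h V)"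
    using merge_pair_disjoint_blocks[OF D] ab eh' by blast+
  have in2: "a \<in> merge_pair d e h V" "b \<in> merge_pair d e h V" using ab eh' by (auto simp: merge_pair_def)
  have U1: "apply_steps V [(c, A, B), (d, E, F)] =
      insert (block_join c a b) (insert (block_join d e h) (V - {a, b, e, h}))"
    unfolding ab(4,5) eh(4,5)
    using valid_steps_Cons_iff(2)[OF D ab(1-3)] valid_steps_Cons_iff(2)[OF D1(1) eh(1-3)]
      merge_pair_separate[OF D ab(1,2) eh'(1,2) ab(3) eh(3) eh'(3)] by simp
  have U2: "apply_steps V [(d, E, F), (c, A, B)] = apply_steps V [(c, A, B), (d, E, F)]"
    unfolding U1 unfolding ab(4,5) eh(4,5)
    using valid_steps_Cons_iff(2)[OF D eh'(1,2) eh(3)] valid_steps_Cons_iff(2)[OF D1(2) in2 ab(3)]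
      merge_pair_separate[OF D eh'(1,2) ab(1,2) eh(3) ab(3)] eh'(3)
    by (simp add: Int_commute insert_commute)
  have v2: "valid_steps V [(d, E, F), (c, A, B)]"
    unfolding ab(4,5) eh(4,5)
    using valid_steps_Cons_iff(1)[OF D eh'(1,2) eh(3)] valid_steps_Cons_iff(1)[OF D1(2) in2 ab(3)] by simp
  have s: "apply_steps V [(c, A, B)] = merge_pair c a b V" "apply_steps V [(d, E, F)] = merge_pair d e h V"
    unfolding ab(4,5) eh(4,5)
    using valid_steps_Cons_iff(2)[OF D ab(1-3), of c "[]"] valid_steps_Cons_iff(2)[OF D eh'(1,2)
        eh(3), of d "[]"]
    by simp_all
  show "?ms' \<in> step_lists n i"
    using inner_update(1)[OF ms, of "(d, E, F)" "(c, A, B)"] v2 U2 by (simp add: V_def)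
  have u: "inner n ?ms' = (inner n ?ms)[length ms1 := merge_pair d e h V]"
    "inner n ?ms = (inner n ?ms)[length ms1 := merge_pair c a b V]"
    using inner_update(2)[OF ms, of "(d, E, F)" "(c, A, B)"] v2 U2
      inner_update(2)[OF ms, of "(c, A, B)" "(d, E, F)"] V(2) s by (simp_all add: V_def)
  show "gap_sum n ?ms (length ms1) = gen (inner n ?ms) + (gen (inner n ?ms') :: _ \<Rightarrow>\<^sub>0 'k)"
    unfolding gap_sum_middle V_def[symmetric]
      between_separate(1)[OF V(1) ab(1-3) eh'(1,2) eh(3) eh'(3) U1]
    using between_separate(2)[OF V(1) ab(1-3) eh'(1,2) eh(3) eh'(3) U1] u by simp
qed

text \<open>\<open>X1\<close>, \<open>X2\<close> and \<open>X3\<close> first merge \<open>B\<close>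
  with \<open>E\<close>, \<open>A\<close> with \<open>B\<close> and \<open>A\<close> with
  \<open>E\<close>, with the children in the order in which they appear in the relations;
  \<open>q\<close> is the color of the first merge and \<open>p\<close> that of the second.\<close>

lemma gap_sum_nested:
  assumes ms: "ms1 @ [(ci, B, E), (co, A, B \<union> E)] @ ms2 \<in> step_lists n i"
  defines "X1 \<equiv> \<lambda>p q. ms1 @ [(q, B, E), (p, A, B \<union> E)] @ ms2"
    and "X2 \<equiv> \<lambda>p q. ms1 @ [(q, A, B), (p, A \<union> B, E)] @ ms2"
    and "X3 \<equiv> \<lambda>p q. ms1 @ [(q, A, E), (p, B, A \<union> E)] @ ms2"
  shows "(p, q) \<in> {(co, ci), (ci, co)} \<Longrightarrow>
      X1 p q \<in> step_lists n i \<and> X2 p q \<in> step_lists n i \<and> X3 p q \<in> step_lists n i"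
    and "gap_sum n (ms1 @ [(ci, B, E), (co, A, B \<union> E)] @ ms2) (length ms1) =
      (\<Sum>(p, q)\<in>{(co, ci), (ci, co)}.
         gen (inner n (X1 p q)) + gen (inner n (X2 p q)) + (gen (inner n (X3 p q)) :: _ \<Rightarrow>\<^sub>0
             'k::comm_ring_1))"
proof -
  define V where "V = apply_steps (wp_bot n) ms1"
  let ?ms = "ms1 @ [(ci, B, E), (co, A, B \<union> E)] @ ms2"
  have V: "V \<in> weighted_partitions n" "valid_steps V [(ci, B, E), (co, A, B \<union> E)]"
    using step_lists_middle[OF ms] by (simp_all add: V_def)
  have D: "disjoint_blocks V" using V unfolding weighted_partitions_iff by blast
  obtain b e where be: "b \<in> V" "e \<in> V" "b \<noteq> e" "B = fst b" "E = fst e"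
    "valid_steps (merge_pair ci b e V) [(co, A, B \<union> E)]" "merge_pair ci b e V \<in> weighted_partitions n"
    using valid_step_merge_pair[OF V] by metis
  obtain a w where aw: "a \<in> merge_pair ci b e V" "w \<in> merge_pair ci b e V" "a \<noteq> w" "A = fst a" "B \<union>
      E = fst w"
    using valid_step_merge_pair[OF be(7,6)] by metis
  have Dm: "disjoint_blocks (merge_pair ci b e V)"
    using be(7) unfolding weighted_partitions_iff by blast
  \<comment> \<open>Blocks with the same underlying set coincide, so the child
    \<open>B \<union> E\<close> is the block just made.\<close>
  have "block_join ci b e \<in> merge_pair ci b e V" by (simp add: merge_pair_def)
  moreover have "fst w \<subseteq> fst (block_join ci b e)" using aw(5) be(4,5) by simp
  ultimately have "w = block_join ci b e" using disjoint_blocks_subset_eqI[OF Dm aw(2)] by blast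
  then have a: "a \<in> V" "a \<noteq> b" "a \<noteq> e" using aw by (auto simp: merge_pair_def)
  \<comment> \<open>Covers both positions of the new block among the children: \<open>X2\<close> has
    it on the left, \<open>X1\<close> and \<open>X3\<close> on the right.\<close>
  have gen_step: "valid_steps V [(q, fst x, fst y), (p, fst z, fst x \<union> fst y)] \<and>
      apply_steps V [(q, fst x, fst y), (p, fst z, fst x \<union> fst y)] =
        insert (block_join p z (block_join q x y)) (V - {x, y, z}) \<and>
      valid_steps V [(q, fst x, fst y), (p, fst x \<union> fst y, fst z)] \<and>
      apply_steps V [(q, fst x, fst y), (p, fst x \<union> fst y, fst z)] =
        insert (block_join p z (block_join q x y)) (V - {x, y, z}) \<and>
      apply_steps V [(q, fst x, fst y)] = merge_pair q x y V"
    if "x \<in> V" "y \<in> V" "z \<in> V" "x \<noteq> y" "z \<noteq> x" "z \<noteq> y" for p q x y z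
  proof -
    have D': "disjoint_blocks (merge_pair q x y V)" using merge_pair_disjoint_blocks[OF D that(1,2)] .
    have in': "z \<in> merge_pair q x y V" "block_join q x y \<in> merge_pair q x y V" "z \<noteq> block_join q x y"
      using that block_join_notin[OF D that(1,2,4), of q] by (auto simp: merge_pair_def)
    note 1 = valid_steps_Cons_iff[OF D that(1,2,4), of q]
    note 2 = valid_steps_Cons_iff[OF D' in', of p "[]", unfolded fst_block_join valid_steps.simps(1)
        apply_steps.simps(1)]
    note 3 = valid_steps_Cons_iff[OF D' in'(2,1) in'(3)[symmetric], of p "[]",
        unfolded fst_block_join valid_steps.simps(1) apply_steps.simps(1) merge_pair_commute[of p
            "block_join q x y" z]]
    show ?thesis
      unfolding 1 using 2 3 merge_pair_nested[OF D that] by simp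
  qed
  have U: "apply_steps V [(ci, B, E), (co, A, B \<union> E)] =
      insert (block_join co a (block_join ci b e)) (V - {a, b, e})"
    using gen_step[OF be(1,2) a(1) be(3) a(2,3)] be aw by (simp add: insert_commute)
  have pq: "block_join p a (block_join q b e) = block_join co a (block_join ci b e)"
    "block_join p e (block_join q a b) = block_join co a (block_join ci b e)"
    "block_join p b (block_join q a e) = block_join co a (block_join ci b e)"
    if "(p, q) \<in> {(co, ci), (ci, co)}" for p q
    using that by (auto simp: block_join_def)
  have X: "X1 p q \<in> step_lists n i" "X2 p q \<in> step_lists n i" "X3 p q \<in> step_lists n i"
    "inner n (X1 p q) = (inner n ?ms)[length ms1 := merge_pair q b e V]"
    "inner n (X2 p q) = (inner n ?ms)[length ms1 := merge_pair q a b V]"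
    "inner n (X3 p q) = (inner n ?ms)[length ms1 := merge_pair q a e V]"
    if c: "(p, q) \<in> {(co, ci), (ci, co)}" for p q
    unfolding X1_def X2_def X3_def be(4,5) aw(4)
    using inner_update[OF ms, of "(q, B, E)" "(p, A, B \<union> E)"] inner_update[OF ms, of "(q, A, B)"
        "(p, A \<union> B, E)"]
      inner_update[OF ms, of "(q, A, E)" "(p, B, A \<union> E)"]
      gen_step[OF be(1,2) a(1) be(3) a(2,3), of q p] gen_step[OF a(1) be(1,2) a(2) a(3)[symmetric]
          be(3)[symmetric], of q p]
      gen_step[OF a(1) be(2,1) a(3) a(2)[symmetric] be(3), of q p]
      pq[OF c] U be(4,5) aw(4)
    by (simp_all add: insert_commute flip: V_def)
  show "(p, q) \<in> {(co, ci), (ci, co)} \<Longrightarrow>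
      X1 p q \<in> step_lists n i \<and> X2 p q \<in> step_lists n i \<and> X3 p q \<in> step_lists n i"
    by (intro conjI X)
  show "gap_sum n ?ms (length ms1) =
      (\<Sum>(p, q)\<in>{(co, ci), (ci, co)}.
         gen (inner n (X1 p q)) + gen (inner n (X2 p q)) + (gen (inner n (X3 p q)) :: _ \<Rightarrow>\<^sub>0 'k))"
    unfolding gap_sum_middle V_def[symmetric]
      sum_between_nested[OF V(1) a(1) be(1,2) a(2,3) be(3) U]
    by (intro sum.cong refl) (use X in \<open>auto simp only: case_prod_unfold prod.collapse fst_conv snd_conv\<close>)
qed

section \<open>Trees of maximal chains\<close>

lemma merge_commute: "merge d A B W = merge d B A W"
proof -
  have "{(X, w) \<in> W. X \<noteq> A \<and> X \<noteq> B} = {(X, w) \<in> W. X \<noteq> B \<and> X \<noteq> A}" by blast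
  moreover have "{(A \<union> B, a + b + d) | a b. (A, a) \<in> W \<and> (B, b) \<in> W} =
      {(B \<union> A, a + b + d) | a b. (B, a) \<in> W \<and> (A, b) \<in> W}"
    by (metis (no_types, opaque_lifting) Un_commute add.commute)
  ultimately show ?thesis unfolding merge_def by simp
qed

lemma flip_step:
  "merge_chain W (ps @ (c, A, B) # qs) = merge_chain W (ps @ (c, B, A) # qs)"
  "valid_steps W (ps @ (c, A, B) # qs) \<longleftrightarrow> valid_steps W (ps @ (c, B, A) # qs)"
  "apply_steps W (ps @ (c, A, B) # qs) = apply_steps W (ps @ (c, B, A) # qs)"
proof -
  show "merge_chain W (ps @ (c, A, B) # qs) = merge_chain W (ps @ (c, B, A) # qs)"
    by (induction W ps rule: merge_chain.induct) (simp_all add: merge_commute[of _ A B])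
  show "valid_steps W (ps @ (c, A, B) # qs) \<longleftrightarrow> valid_steps W (ps @ (c, B, A) # qs)"
  proof -
    have "(\<exists>x\<in>V. \<exists>y\<in>V. x \<noteq> y \<and> A = fst x \<and> B = fst y) \<longleftrightarrow>
        (\<exists>x\<in>V. \<exists>y\<in>V. x \<noteq> y \<and> B = fst x \<and> A = fst y)" for V :: weighted_partition
      by metis
    then show ?thesis
      by (simp add: valid_steps_append valid_steps.simps(2) merge_commute[of _ A B])
  qed
  show "apply_steps W (ps @ (c, A, B) # qs) = apply_steps W (ps @ (c, B, A) # qs)"
    by (simp add: apply_steps_append apply_steps.simps(2) merge_commute[of _ A B])
qed

lemma step_lists_flip:
  "ps @ (c, A, B) # qs \<in> step_lists n i \<longleftrightarrow> ps @ (c, B, A) # qs \<in> step_lists n i"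
  unfolding step_lists_def mem_Collect_eq flip_step(2,3)[of _ ps c A B qs] ..

lemma inner_flip: "inner n (ps @ (c, A, B) # qs) = inner n (ps @ (c, B, A) # qs)"
  unfolding inner_def flip_step(1)[of _ ps c A B qs] ..

lemma gap_sum_flip: "gap_sum n (ps @ (c, A, B) # qs) k = gap_sum n (ps @ (c, B, A) # qs) k"
proof -
  have "apply_steps W (take j (ps @ (c, A, B) # qs)) = apply_steps W (take j (ps @ (c, B, A) # qs))" for W j
  proof (cases "j \<le> length (ps @ (c, A, B) # qs)")
    case True
    then show ?thesis
      using merge_chain_nth[of j "ps @ (c, A, B) # qs" W] merge_chain_nth[of j "ps @ (c, B, A) # qs" W]
        flip_step(1)[of W ps c A B qs] by simp
  next
    case False
    then show ?thesis using flip_step(3)[of W ps c A B qs] by simp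
  qed
  then show ?thesis unfolding gap_sum_def inner_flip[of n ps c A B qs] by simp
qed

text \<open>The pair is adjacent in the source, whereas \<open>vs\<close> separates it in the
  target; for the left comb this gives \<open>(-1) ^ num_internal t3\<close>. The remaining factor
  does not depend on the pair, so the terms of a relation can share it.\<close>

lemma list_sign_pair:
  assumes "mset (ms1 @ [x, y] @ ms2) = mset (us @ x # vs @ y # ws)" "distinct (ms1 @ [x, y] @ ms2)"
  shows "list_sign (ms1 @ [x, y] @ ms2) (us @ x # vs @ y # ws) =
    (-1) ^ length vs * (list_sign (ms1 @ ms2) (us @ vs @ ws) :: 'k::comm_ring_1)"
proof -
  have "list_sign (ms1 @ x # (y # ms2)) (us @ x # (vs @ y # ws)) =
      (-1) ^ (length ms1 + length us) * (list_sign (ms1 @ (y # ms2)) (us @ (vs @ y # ws)) :: 'k)"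
    using assms by (intro list_sign_delete) auto
  moreover have "list_sign (ms1 @ y # ms2) ((us @ vs) @ y # ws) =
      (-1) ^ (length ms1 + length (us @ vs)) * (list_sign (ms1 @ ms2) ((us @ vs) @ ws) :: 'k)"
    using assms by (intro list_sign_delete) auto
  ultimately show ?thesis by (simp add: power_add mult_ac)
qed

lemma labeled_trees_distinct_postorder: "T \<in> labeled_trees n i \<Longrightarrow> distinct (postorder T)"
  by (simp add: labeled_trees_def distinct_postorder)

lemma labeled_trees_postorder_inject:
  assumes "T \<in> labeled_trees n i" "T' \<in> labeled_trees n i" "mset (postorder T) = mset (postorder T')"
  shows "T = T'"
  using assms by (intro postorder_inject) (auto simp: labeled_trees_def dest: mset_eq_setD)

text \<open>Reversing a step exchanges the children of the corresponding node. In the postorder this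
  exchanges the two blocks of nodes below it, which produces the sign of the swap relation.\<close>

lemma flip_tree:
  assumes T: "T \<in> labeled_trees n i" "mset (postorder T) = mset (ps @ (c, A, B) # qs)"
  shows "\<exists>T'\<in>labeled_trees n i. mset (postorder T') = mset (ps @ (c, B, A) # qs) \<and>
    scale (list_sign (ps @ (c, A, B) # qs) (postorder T)) (gen T) -
    scale (list_sign (ps @ (c, B, A) # qs) (postorder T')) (gen T')
      \<in> comb.span (relations n i :: (nat btree \<Rightarrow>\<^sub>0 'k::comm_ring_1) set)"
proof -
  have "(c, A, B) \<in> set (postorder T)" using mset_eq_setD[OF T(2)] by simp
  then obtain C l r where C: "T = plug C (Node c l r)" "set (leaves l) = A" "set (leaves r) = B"
    by (rule postorder_find)
  let ?T' = "plug C (Node c r l)"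
  have T': "?T' \<in> labeled_trees n i"
    by (rule labeled_trees_plug[OF T(1)[unfolded C(1)]]) auto
  obtain us vs where "\<And>X. set (leaves X) = A \<union> B \<Longrightarrow> postorder (plug C X) = us @ postorder X @ vs"
    using postorder_plug[of "A \<union> B" C] by blast
  then have po: "postorder T = us @ postorder l @ postorder r @ (c, A, B) # vs"
    "postorder ?T' = us @ postorder r @ postorder l @ (c, B, A) # vs"
    using C by (auto simp: Un_commute)
  have m: "mset (ps @ qs) = mset (us @ postorder l @ postorder r @ vs)" using T(2) po(1) by simp
  have d: "distinct (ps @ (c, A, B) # qs)" "distinct (ps @ (c, B, A) # qs)"
    using mset_eq_imp_distinct_iff[OF T(2)] labeled_trees_distinct_postorder[OF T(1)]
      mset_eq_imp_distinct_iff[of "ps @ (c, B, A) # qs" "postorder ?T'"] m po(2)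
      labeled_trees_distinct_postorder[OF T'] by simp_all
  have "list_sign (ps @ (c, A, B) # qs) ((us @ postorder l @ postorder r) @ (c, A, B) # vs) =
      (-1) ^ (length ps + length (us @ postorder l @ postorder r)) *
      (list_sign (ps @ qs) ((us @ postorder l @ postorder r) @ vs) :: 'k)"
    using m d by (intro list_sign_delete) auto
  moreover have "list_sign (ps @ (c, B, A) # qs) ((us @ postorder r @ postorder l) @ (c, B, A) # vs) =
      (-1) ^ (length ps + length (us @ postorder r @ postorder l)) *
      (list_sign (ps @ qs) ((us @ postorder r @ postorder l) @ vs) :: 'k)"
    using m d by (intro list_sign_delete) auto
  moreover have "list_sign (ps @ qs) (us @ postorder r @ postorder l @ vs) =
      (-1) ^ (length (postorder r) * length (postorder l)) *
      (list_sign (ps @ qs) (us @ postorder l @ postorder r @ vs) :: 'k)"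
    using m d by (intro list_sign_swap_blocks) auto
  ultimately have s: "list_sign (ps @ (c, B, A) # qs) (postorder ?T') =
      (list_sign (ps @ (c, A, B) # qs) (postorder T) :: 'k) * (-1) ^ (num_internal l * num_internal r)"
    by (simp add: po add_ac mult_ac)
  have "gen T - scale (sgn_pow (num_internal l * num_internal r)) (gen ?T') \<in> comb.span (relations n
      i :: (nat btree \<Rightarrow>\<^sub>0 'k) set)"
    using relations.swap[of C c l r n i] T(1) C(1) by (auto intro: comb.span_base)
  from comb.span_scale[OF this, of "list_sign (ps @ (c, A, B) # qs) (postorder T)"]
  have "scale (list_sign (ps @ (c, A, B) # qs) (postorder T)) (gen T) -
    scale (list_sign (ps @ (c, B, A) # qs) (postorder ?T')) (gen ?T')
      \<in> comb.span (relations n i :: (nat btree \<Rightarrow>\<^sub>0 'k) set)"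
    by (simp add: s comb.scale_right_diff_distrib comb.scale_scale)
  moreover have "mset (postorder ?T') = mset (ps @ (c, B, A) # qs)" using m po(2) by simp
  ultimately show ?thesis using T' by blast
qed

text \<open>The steps are reversed one at a time; \<open>ps\<close> is the part already
  treated.\<close>

lemma flip_trees:
  assumes "list_all2 flip_eq xs ys" "T \<in> labeled_trees n i" "mset (postorder T) = mset (ps @ xs)"
  shows "\<exists>T'\<in>labeled_trees n i. mset (postorder T') = mset (ps @ ys) \<and>
    scale (list_sign (ps @ xs) (postorder T)) (gen T) - scale (list_sign (ps @ ys) (postorder T')) (gen T')
      \<in> comb.span (relations n i :: (nat btree \<Rightarrow>\<^sub>0 'k::comm_ring_1) set)"
  using assms
proof (induction xs ys arbitrary: ps T rule: list_all2_induct)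
  case Nil
  then show ?case by (intro bexI[of _ T]) (auto simp: comb.span_zero)
next
  case (Cons m xs m' ys)
  obtain c A B where m: "m = (c, A, B)" by (cases m)
  have "m' = m \<or> m' = (c, B, A)" using Cons.hyps(1) m by (cases m') (auto simp: flip_eq_def)
  then obtain T1 where T1: "T1 \<in> labeled_trees n i" "mset (postorder T1) = mset (ps @ m' # xs)"
    "scale (list_sign (ps @ m # xs) (postorder T)) (gen T) - scale (list_sign (ps @ m' # xs)
        (postorder T1)) (gen T1)
      \<in> comb.span (relations n i :: (nat btree \<Rightarrow>\<^sub>0 'k) set)"
  proof
    assume "m' = m"
    then show ?thesis using that[of T] Cons.prems by (simp add: comb.span_zero)
  next
    assume m': "m' = (c, B, A)"
    show ?thesis using flip_tree[OF Cons.prems(1) Cons.prems(2)[unfolded m]] that m m' by blast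
  qed
  have "mset (postorder T1) = mset ((ps @ [m']) @ xs)" using T1(2) by simp
  from Cons.IH[OF T1(1) this] obtain T2 where T2: "T2 \<in> labeled_trees n i"
    "mset (postorder T2) = mset (ps @ m' # ys)"
    "scale (list_sign (ps @ m' # xs) (postorder T1)) (gen T1) - scale (list_sign (ps @ m' # ys)
        (postorder T2)) (gen T2)
      \<in> comb.span (relations n i :: (nat btree \<Rightarrow>\<^sub>0 'k) set)"
    by auto
  show ?case
    using T2 comb.span_add[OF T1(3) T2(3)] by (intro bexI[of _ T2]) auto
qed

text \<open>The map from chains to signed trees. The choice of \<open>ms\<close> is a real one,
  since steps can be reversed; for given \<open>ms\<close> the tree is unique.\<close>

definition chain_tree :: "nat \<Rightarrow> nat \<Rightarrow> weighted_partition list \<Rightarrow> (nat btree \<Rightarrow>\<^sub>0 'k::comm_ring_1)" where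
  "chain_tree n i xs =
     (let ms = SOME ms. ms \<in> step_lists n i \<and> inner n ms = xs;
          T = SOME T. T \<in> labeled_trees n i \<and> mset (postorder T) = mset ms
      in scale (list_sign ms (postorder T)) (gen T))"

text \<open>Makes \<open>chain_tree\<close> independent of the choices modulo the relations: step
  sequences of one chain agree up to reversals, which \<open>flip_trees\<close> absorbs.\<close>

lemma chain_tree_inner:
  assumes n: "2 \<le> n" and ms: "ms \<in> step_lists n i"
    and T: "T \<in> labeled_trees n i" "mset (postorder T) = mset ms"
  shows "(chain_tree n i (inner n ms) :: _ \<Rightarrow>\<^sub>0 'k::comm_ring_1) -
      scale (list_sign ms (postorder T)) (gen T) \<in> comb.span (relations n i)"
    and "(chain_tree n i (inner n ms) :: _ \<Rightarrow>\<^sub>0 'k) \<in> free_on (labeled_trees n i)"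
proof -
  define ms' where "ms' = (SOME ms'. ms' \<in> step_lists n i \<and> inner n ms' = inner n ms)"
  define T' where "T' = (SOME T. T \<in> labeled_trees n i \<and> mset (postorder T) = mset ms')"
  have ms': "ms' \<in> step_lists n i" "inner n ms' = inner n ms"
    using someI[of "\<lambda>ms'. ms' \<in> step_lists n i \<and> inner n ms' = inner n ms" ms] ms
    by (simp_all add: ms'_def)
  have "\<exists>T. T \<in> labeled_trees n i \<and> mset (postorder T) = mset ms'"
    using step_lists_tree[OF ms'(1)] n by auto
  then have T': "T' \<in> labeled_trees n i" "mset (postorder T') = mset ms'"
    using someI_ex[of "\<lambda>T. T \<in> labeled_trees n i \<and> mset (postorder T) = mset ms'"]
    by (simp_all add: T'_def)
  have ct: "chain_tree n i (inner n ms) = (scale (list_sign ms' (postorder T')) (gen T') :: _ \<Rightarrow>\<^sub>0 'k)"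
    by (simp add: chain_tree_def Let_def ms'_def T'_def)
  then show "(chain_tree n i (inner n ms) :: _ \<Rightarrow>\<^sub>0 'k) \<in> free_on (labeled_trees n i)"
    using T'(1) by (simp add: comb.subspace_scale subspace_free_on gen_in_free_on)
  have "merge_chain (wp_bot n) ms' = merge_chain (wp_bot n) ms"
    using merge_chain_inner[OF ms'(1) n] merge_chain_inner[OF ms n] ms'(2) by simp
  then have "list_all2 flip_eq ms' ms"
    using ms ms'(1) by (intro merge_chain_flip_eq[OF wp_bot_weighted_partition]) (auto simp: step_lists_def)
  from flip_trees[OF this T'(1), of "[]"] T'(2) obtain T'' where
    T'': "T'' \<in> labeled_trees n i" "mset (postorder T'') = mset ms"
    "scale (list_sign ms' (postorder T')) (gen T') - scale (list_sign ms (postorder T'')) (gen T'')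
      \<in> comb.span (relations n i :: (nat btree \<Rightarrow>\<^sub>0 'k) set)" by auto
  have "T'' = T" using labeled_trees_postorder_inject[OF T''(1) T(1)] T(2) T''(2) by simp
  then show "(chain_tree n i (inner n ms) :: _ \<Rightarrow>\<^sub>0 'k) -
      scale (list_sign ms (postorder T)) (gen T) \<in> comb.span (relations n i)"
    using T''(3) ct by simp
qed

abbreviation top_coboundaries :: "nat \<Rightarrow> nat \<Rightarrow> (weighted_partition list \<Rightarrow>\<^sub>0 'k::comm_ring_1) set" where
  "top_coboundaries n i \<equiv> coboundaries (proper_part n i) (wp_less n) (int n - 3)"

section \<open>Sorting linear extensions modulo coboundaries\<close>

lemma subspace_coboundaries: "comb.subspace (coboundaries P lt r)"
  unfolding coboundaries_def coboundary_def by (rule subspace_linear_image[OF subspace_free_on])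

text \<open>A step \<open>u\<close> that \<open>z\<close> overtakes makes a block not contained in
  that of \<open>z\<close>, hence not a child of \<open>z\<close>. So the two merges commute at the
  cost of a sign.\<close>

lemma move_step_front:
  assumes n: "2 \<le> n" "i \<le> n - 1" and ms: "ps @ us @ z # vs \<in> step_lists n i"
    and z: "\<forall>u\<in>set us. \<not> union_of u \<subseteq> union_of z"
  shows "ps @ z # us @ vs \<in> step_lists n i \<and>
    gen (inner n (ps @ us @ z # vs)) - scale ((-1) ^ length us) (gen (inner n (ps @ z # us @ vs)))
      \<in> (top_coboundaries n i :: (_ \<Rightarrow>\<^sub>0 'k::comm_ring_1) set)"
  using ms z
proof (induction us arbitrary: vs rule: rev_induct)
  case Nil
  then show ?case by (simp add: comb.subspace_0[OF subspace_coboundaries])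
next
  case (snoc u us)
  obtain c A B where u: "u = (c, A, B)" by (cases u)
  obtain d E F where zz: "z = (d, E, F)" by (cases z)
  have sep: "A \<union> B \<noteq> E" "A \<union> B \<noteq> F" using snoc.prems(2) u zz by auto
  have ms: "(ps @ us) @ [(c, A, B), (d, E, F)] @ vs \<in> step_lists n i" using snoc.prems(1) u zz by simp
  have 1: "ps @ us @ z # u # vs \<in> step_lists n i" using gap_sum_separate(1)[OF ms sep] u zz by simp
  have "Suc (length (ps @ us)) < length ((ps @ us) @ [(c, A, B), (d, E, F)] @ vs)" by simp
  from gap_sum_coboundary[OF ms n this, where ?'k = 'k]
  have 2: "gen (inner n (ps @ (us @ [u]) @ z # vs)) + gen (inner n (ps @ us @ z # u # vs))
      \<in> (top_coboundaries n i :: (_ \<Rightarrow>\<^sub>0 'k) set)"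
    using gap_sum_separate(2)[OF ms sep, where ?'k = 'k] u zz by simp
  have 3: "ps @ z # us @ u # vs \<in> step_lists n i"
    "gen (inner n (ps @ us @ z # u # vs)) - scale ((-1) ^ length us) (gen (inner n (ps @ z # us @ u # vs)))
      \<in> (top_coboundaries n i :: (_ \<Rightarrow>\<^sub>0 'k) set)"
    using snoc.IH[OF 1] snoc.prems(2) by auto
  show ?case using 3(1) comb.subspace_diff[OF subspace_coboundaries 2 3(2)] by simp
qed

text \<open>A selection sort along the recursion of \<open>list_sign\<close>: the next node of the
  postorder moves to the front of the unsorted part. The nodes it overtakes come later in postorder,
  so by \<open>postorder_sorted\<close> they do not feed it.\<close>

lemma sort_steps:
  assumes n: "2 \<le> n" "i \<le> n - 1" and T: "T \<in> labeled_trees n i"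
    and "postorder T = ps @ zs" "ps @ xs \<in> step_lists n i" "mset xs = mset zs"
  shows "gen (inner n (ps @ xs)) - scale (list_sign xs zs) (gen (inner n (postorder T)))
      \<in> (top_coboundaries n i :: (_ \<Rightarrow>\<^sub>0 'k::comm_ring_1) set)"
  using assms(4-)
proof (induction zs arbitrary: ps xs)
  case Nil
  then show ?case by (simp add: comb.subspace_0[OF subspace_coboundaries])
next
  case (Cons z zs)
  have "z \<in> set xs" using mset_eq_setD[OF Cons.prems(3)] by simp
  then obtain us vs where xs: "xs = us @ z # vs" "z \<notin> set us" by (meson split_list_first)
  have m: "mset (us @ vs) = mset zs" using Cons.prems(3) xs by simp
  have "sorted_wrt (\<lambda>x y. \<not> union_of y \<subseteq> union_of x) (ps @ z # zs)"
    using postorder_sorted[of T] T Cons.prems(1) by (simp add: labeled_trees_def)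
  then have "\<forall>u\<in>set zs. \<not> union_of u \<subseteq> union_of z" by (simp add: sorted_wrt_append)
  then have "\<forall>u\<in>set us. \<not> union_of u \<subseteq> union_of z" using mset_eq_setD[OF m] by auto
  from move_step_front[OF n _ this, of ps vs] Cons.prems(2) xs(1)
  have 1: "ps @ z # us @ vs \<in> step_lists n i"
    "gen (inner n (ps @ xs)) - scale ((-1) ^ length us) (gen (inner n (ps @ z # us @ vs)))
      \<in> (top_coboundaries n i :: (_ \<Rightarrow>\<^sub>0 'k) set)" by auto
  have "gen (inner n ((ps @ [z]) @ us @ vs)) - scale (list_sign (us @ vs) zs) (gen (inner n (postorder T)))
      \<in> (top_coboundaries n i :: (_ \<Rightarrow>\<^sub>0 'k) set)"
    using Cons.prems(1) 1(1) m by (intro Cons.IH) auto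
  from comb.subspace_add[OF subspace_coboundaries 1(2) comb.subspace_scale[OF subspace_coboundaries
      this, of "(-1) ^ length us"]]
  show ?case
    unfolding xs(1) list_sign_Cons[OF xs(2)] by (simp add: comb.scale_right_diff_distrib comb.scale_scale)
qed

lemma sort_step_list:
  assumes n: "2 \<le> n" "i \<le> n - 1" and T: "T \<in> labeled_trees n i" and ms: "ms \<in> step_lists n i"
    "mset ms = mset (postorder T)"
  shows "gen (inner n ms) - scale (list_sign ms (postorder T)) (gen (inner n (postorder T)))
      \<in> (top_coboundaries n i :: (_ \<Rightarrow>\<^sub>0 'k::comm_ring_1) set)"
  using sort_steps[OF n T, of "[]" "postorder T" ms] ms by simp

section \<open>The one-color and the two-color relation as gap sums\<close>

definition right_comb where "right_comb p q t1 t2 t3 = Node p t1 (Node q t2 t3)"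
definition left_comb where "left_comb p q t1 t2 t3 = Node p (Node q t1 t2) t3"

lemma combs_labeled_trees:
  assumes T: "plug C (right_comb co ci t1 t2 t3) \<in> labeled_trees n i" and pq: "(p, q) \<in> {(co, ci),
      (ci, co)}"
  shows "plug C (right_comb p q t1 t2 t3) \<in> labeled_trees n i"
    "plug C (left_comb p q t1 t2 t3) \<in> labeled_trees n i"
    "plug C (right_comb p q t2 t1 t3) \<in> labeled_trees n i"
  using pq by (auto intro!: labeled_trees_plug[OF T] simp: right_comb_def left_comb_def)

text \<open>Without the two merges in question, the postorders of the three trees agree up to
  exchanging the nodes of \<open>t1\<close> and \<open>t2\<close>. So the sign \<open>s0\<close> of
  the rest is common to all terms and both colorings, and what remains are the signs of the
  relations. The map from chains to trees needs any \<open>ms1\<close> and \<open>ms2\<close>; the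
  converse map needs a postorder, where \<open>s0 = 1\<close>.\<close>

lemma comb_signs:
  fixes t1 t2 t3 :: "nat btree"
  defines "A \<equiv> set (leaves t1)" and "B \<equiv> set (leaves t2)" and "E \<equiv> set (leaves t3)"
  assumes T: "plug C (right_comb co ci t1 t2 t3) \<in> labeled_trees n i"
    and ms: "mset (postorder (plug C (right_comb co ci t1 t2 t3))) =
      mset (ms1 @ [(ci, B, E), (co, A, B \<union> E)] @ ms2)"
  obtains s0 :: "'k::comm_ring_1" where
    "ms1 @ [(ci, B, E), (co, A, B \<union> E)] @ ms2 = postorder (plug C (right_comb co ci t1 t2 t3)) \<Longrightarrow> s0 = 1"
    "\<And>p q. (p, q) \<in> {(co, ci), (ci, co)} \<Longrightarrow>
      mset (postorder (plug C (right_comb p q t1 t2 t3))) = mset (ms1 @ [(q, B, E), (p, A, B \<union> E)] @ ms2) \<and>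
      mset (postorder (plug C (left_comb p q t1 t2 t3))) = mset (ms1 @ [(q, A, B), (p, A \<union> B, E)] @ ms2) \<and>
      mset (postorder (plug C (right_comb p q t2 t1 t3))) = mset (ms1 @ [(q, A, E), (p, B, A \<union> E)] @ ms2) \<and>
      list_sign (ms1 @ [(q, B, E), (p, A, B \<union> E)] @ ms2) (postorder (plug C (right_comb p q t1 t2
          t3))) = s0 \<and>
      list_sign (ms1 @ [(q, A, B), (p, A \<union> B, E)] @ ms2) (postorder (plug C (left_comb p q t1 t2 t3))) =
        s0 * (-1) ^ num_internal t3 \<and>
      list_sign (ms1 @ [(q, A, E), (p, B, A \<union> E)] @ ms2) (postorder (plug C (right_comb p q t2 t1 t3))) =
        s0 * (-1) ^ (num_internal t1 * num_internal t2)"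
proof -
  obtain us vs where uv: "\<And>X. set (leaves X) = A \<union> B \<union> E \<Longrightarrow> postorder (plug C X) = us @ postorder X @ vs"
    using postorder_plug[of "A \<union> B \<union> E" C] by blast
  have po: "postorder (plug C (right_comb p q t1 t2 t3)) =
      (us @ postorder t1 @ postorder t2 @ postorder t3) @ (q, B, E) # [] @ (p, A, B \<union> E) # vs"
    "postorder (plug C (left_comb p q t1 t2 t3)) =
      (us @ postorder t1 @ postorder t2) @ (q, A, B) # postorder t3 @ (p, A \<union> B, E) # vs"
    "postorder (plug C (right_comb p q t2 t1 t3)) =
      (us @ postorder t2 @ postorder t1 @ postorder t3) @ (q, A, E) # [] @ (p, B, A \<union> E) # vs" for p q
    by (subst uv; auto simp: right_comb_def left_comb_def A_def B_def E_def)+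
  have m: "mset (ms1 @ ms2) = mset (us @ postorder t1 @ postorder t2 @ postorder t3 @ vs)"
    using ms unfolding po by simp
  define s0 :: 'k where "s0 = list_sign (ms1 @ ms2) (us @ postorder t1 @ postorder t2 @ postorder t3 @ vs)"
  have d0: "distinct (us @ postorder t1 @ postorder t2 @ postorder t3 @ vs)"
    using labeled_trees_distinct_postorder[OF T] unfolding po by simp
  have d: "distinct (ms1 @ ms2)" using mset_eq_imp_distinct_iff[OF m] d0 by simp
  have sw: "list_sign (ms1 @ ms2) (us @ postorder t2 @ postorder t1 @ postorder t3 @ vs) =
      s0 * (-1) ^ (num_internal t1 * num_internal t2)"
    using list_sign_swap_blocks[of "ms1 @ ms2" us "postorder t2" "postorder t1" "postorder t3 @ vs",
        where ?'k = 'k] m d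
    by (simp add: s0_def mult_ac)
  show ?thesis
  proof (rule that[of s0])
    assume "ms1 @ [(ci, B, E), (co, A, B \<union> E)] @ ms2 = postorder (plug C (right_comb co ci t1 t2 t3))"
    then have e: "ms1 @ (ci, B, E) # (co, A, B \<union> E) # ms2 =
        (us @ postorder t1 @ postorder t2 @ postorder t3) @ (ci, B, E) # (co, A, B \<union> E) # vs"
      unfolding po by simp
    have "distinct (ms1 @ [(ci, B, E), (co, A, B \<union> E)] @ ms2)"
      using labeled_trees_distinct_postorder[OF T] mset_eq_imp_distinct_iff[OF ms] by blast
    \<comment> \<open>An element that occurs once splits the list in only one way.\<close>
    then have "(ci, B, E) \<notin> set ms1" "(ci, B, E) \<notin> set ((co, A, B \<union> E) # ms2)" by simp_all
    from iffD1[OF append_Cons_eq_iff[OF this] e]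
    have "ms1 = us @ postorder t1 @ postorder t2 @ postorder t3 \<and> ms2 = vs" by simp
    then show "s0 = 1" using d by (simp add: s0_def list_sign_self)
  next
    fix p q assume pq: "(p, q) \<in> {(co, ci), (ci, co)}"
    have m': "mset (postorder (plug C (right_comb p q t1 t2 t3))) = mset (ms1 @ [(q, B, E), (p, A, B
        \<union> E)] @ ms2)"
      "mset (postorder (plug C (left_comb p q t1 t2 t3))) = mset (ms1 @ [(q, A, B), (p, A \<union> B, E)] @ ms2)"
      "mset (postorder (plug C (right_comb p q t2 t1 t3))) = mset (ms1 @ [(q, A, E), (p, B, A \<union> E)] @ ms2)"
      unfolding po using m by simp_all
    note dd = combs_labeled_trees[OF T pq, THEN labeled_trees_distinct_postorder]
    have d': "distinct (ms1 @ [(q, B, E), (p, A, B \<union> E)] @ ms2)" "distinct (ms1 @ [(q, A, B), (p, A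
        \<union> B, E)] @ ms2)"
      "distinct (ms1 @ [(q, A, E), (p, B, A \<union> E)] @ ms2)"
      using dd m'[THEN mset_eq_imp_distinct_iff] by blast+
    have "list_sign (ms1 @ [(q, B, E), (p, A, B \<union> E)] @ ms2) (postorder (plug C (right_comb p q t1
        t2 t3))) = s0"
      unfolding po using m' d' list_sign_pair[OF _ d'(1), of "us @ postorder t1 @ postorder t2 @
          postorder t3" "[]" vs, where ?'k = 'k]
      unfolding po by (simp add: s0_def)
    moreover have "list_sign (ms1 @ [(q, A, B), (p, A \<union> B, E)] @ ms2) (postorder (plug C (left_comb
        p q t1 t2 t3))) =
        s0 * (-1) ^ num_internal t3"
      unfolding po using m' list_sign_pair[OF _ d'(2), of "us @ postorder t1 @ postorder t2"
          "postorder t3" vs, where ?'k = 'k]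
      unfolding po by (simp add: s0_def mult_ac)
    moreover have "list_sign (ms1 @ [(q, A, E), (p, B, A \<union> E)] @ ms2) (postorder (plug C (right_comb
        p q t2 t1 t3))) =
        s0 * (-1) ^ (num_internal t1 * num_internal t2)"
      unfolding po using m' list_sign_pair[OF _ d'(3), of "us @ postorder t2 @ postorder t1 @
          postorder t3" "[]" vs, where ?'k = 'k]
      unfolding po by (simp add: sw)
    ultimately show "mset (postorder (plug C (right_comb p q t1 t2 t3))) = mset (ms1 @ [(q, B, E),
        (p, A, B \<union> E)] @ ms2) \<and>
      mset (postorder (plug C (left_comb p q t1 t2 t3))) = mset (ms1 @ [(q, A, B), (p, A \<union> B, E)] @ ms2) \<and>
      mset (postorder (plug C (right_comb p q t2 t1 t3))) = mset (ms1 @ [(q, A, E), (p, B, A \<union> E)] @ ms2) \<and>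
      list_sign (ms1 @ [(q, B, E), (p, A, B \<union> E)] @ ms2) (postorder (plug C (right_comb p q t1 t2
          t3))) = s0 \<and>
      list_sign (ms1 @ [(q, A, B), (p, A \<union> B, E)] @ ms2) (postorder (plug C (left_comb p q t1 t2 t3))) =
        s0 * (-1) ^ num_internal t3 \<and>
      list_sign (ms1 @ [(q, A, E), (p, B, A \<union> E)] @ ms2) (postorder (plug C (right_comb p q t2 t1 t3))) =
        s0 * (-1) ^ (num_internal t1 * num_internal t2)"
      using m' by blast
  qed
qed

text \<open>For equal colors the index set has one element and the sum is the one-color relation;
  for different colors it is the two-color relation with its terms regrouped.\<close>

lemma relations_comb:
  assumes T: "plug C (right_comb co ci t1 t2 t3) \<in> labeled_trees n i"
  shows "(\<Sum>(p, q)\<in>{(co, ci), (ci, co)}.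
      gen (plug C (right_comb p q t1 t2 t3)) +
      scale (sgn_pow (num_internal t3)) (gen (plug C (left_comb p q t1 t2 t3))) +
      scale (sgn_pow (num_internal t1 * num_internal t2)) (gen (plug C (right_comb p q t2 t1 t3))))
    \<in> (relations n i :: (nat btree \<Rightarrow>\<^sub>0 'k::comm_ring_1) set)"
proof (cases "co = ci")
  case True
  then show ?thesis
    using relations.one_color[of C co t1 t2 t3 n i] T by (simp add: right_comb_def left_comb_def)
next
  case False
  then have s: "{(co, ci), (ci, co)} = {(Red, Blue), (Blue, Red)}"
    by (cases co; cases ci) auto
  have "plug C (right_comb Red Blue t1 t2 t3) \<in> labeled_trees n i"
    using combs_labeled_trees(1)[OF T, of Red Blue] unfolding s by simp
  from relations.two_color[OF this[unfolded right_comb_def], where ?'k = 'k]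
  show ?thesis unfolding s
    by (simp add: right_comb_def left_comb_def comb.scale_right_distrib algebra_simps)
qed

lemma relations_subset_free_on:
  "(relations n i :: (nat btree \<Rightarrow>\<^sub>0 'k::comm_ring_1) set) \<subseteq> free_on (labeled_trees n i)"
proof
  note add = comb.subspace_add[OF subspace_free_on] and sc = comb.subspace_scale[OF subspace_free_on]
    and diff = comb.subspace_diff[OF subspace_free_on]
  fix r :: "nat btree \<Rightarrow>\<^sub>0 'k" assume "r \<in> relations n i"
  then show "r \<in> free_on (labeled_trees n i)"
    by cases (auto intro!: add sc diff gen_in_free_on elim!: labeled_trees_plug)
qed

text \<open>If the second merge does not use the block of the first, both orders belong to one tree
  and their signs cancel. If it does, the two merges are parent and child in the tree, and modulo
  the relations the image is \<open>s0\<close> times a relation. A new block on the left is brought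
  to the right by reversing the second step.\<close>

lemma linear_extension_chain_tree_gap_sum:
  assumes n: "2 \<le> n" "i \<le> n - 1" and ms: "ms \<in> step_lists n i" and k: "Suc k < length ms"
  shows "linear_extension (chain_tree n i) (gap_sum n ms k) \<in>
    comb.span (relations n i :: (nat btree \<Rightarrow>\<^sub>0 'k::comm_ring_1) set)"
proof -
  let ?R = "comb.span (relations n i :: (nat btree \<Rightarrow>\<^sub>0 'k) set)"
  have nested: "linear_extension (chain_tree n i) (gap_sum n (ms1 @ [(ci, B, E), (co, A, B \<union> E)] @
      ms2) (length ms1)) \<in> ?R"
    if ms: "ms1 @ [(ci, B, E), (co, A, B \<union> E)] @ ms2 \<in> step_lists n i" for ms1 ci co A B E ms2
  proof -
    let ?ms = "ms1 @ [(ci, B, E), (co, A, B \<union> E)] @ ms2"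
    obtain T where T: "T \<in> labeled_trees n i" "mset (postorder T) = mset ?ms"
      using step_lists_tree[OF ms] n by auto
    have dT: "distinct (leaves T)" using T(1) by (simp add: labeled_trees_def)
    have in1: "(ci, B, E) \<in> set (postorder T)" "(co, A, B \<union> E) \<in> set (postorder T)"
      using mset_eq_setD[OF T(2)] by auto
    obtain C t1 r where C: "T = plug C (Node co t1 r)" "set (leaves t1) = A" "set (leaves r) = B \<union> E"
      using postorder_find[OF in1(2)] .
    have BE: "B \<noteq> {}" "E \<noteq> {}" "B \<inter> E = {}" using postorder_parts[OF in1(1) dT] by blast+
    \<comment> \<open>\<open>r\<close> has at least two labels, since \<open>B\<close> and
      \<open>E\<close> are nonempty and disjoint.\<close>
    obtain c' t2 t3 where r: "r = Node c' t2 t3"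
    proof (cases r)
      case (Leaf x)
      then have "B \<union> E = {x}" using C(3) by simp
      then show ?thesis using BE by (metis Int_absorb Un_empty_right insert_not_empty singleton_Un_iff)
    qed (use that in blast)
    obtain us vs where "\<And>X. set (leaves X) = A \<union> (B \<union> E) \<Longrightarrow> postorder (plug C X) = us @ postorder X @ vs"
      using postorder_plug[of "A \<union> (B \<union> E)" C] by blast
    then have "set (postorder (Node co t1 r)) \<subseteq> set (postorder T)" using C by auto
    then have "(c', set (leaves t2), set (leaves t3)) \<in> set (postorder T)" unfolding r by simp
    moreover have "union_of (c', set (leaves t2), set (leaves t3)) = union_of (ci, B, E)" using C(3)
        r by simp
    \<comment> \<open>Within a tree the block determines the node, so the root of \<open>r\<close>
      is the first merge, with its color and the order of its children.\<close>
    ultimately have e: "c' = ci" "set (leaves t2) = B" "set (leaves t3) = E"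
      using inj_onD[OF inj_union_of_postorder[OF dT]] in1(1) by blast+
    have T': "plug C (right_comb co ci t1 t2 t3) \<in> labeled_trees n i" and Teq: "T = plug C
        (right_comb co ci t1 t2 t3)"
      using T(1) C(1) r e(1) by (simp_all add: right_comb_def)
    note cs = comb_signs[OF T', of ms1 ms2, unfolded e(2,3) C(2), OF T(2)[unfolded Teq]]
    obtain s0 :: 'k where s0: "\<And>p q. (p, q) \<in> {(co, ci), (ci, co)} \<Longrightarrow>
      mset (postorder (plug C (right_comb p q t1 t2 t3))) = mset (ms1 @ [(q, B, E), (p, A, B \<union> E)] @ ms2) \<and>
      mset (postorder (plug C (left_comb p q t1 t2 t3))) = mset (ms1 @ [(q, A, B), (p, A \<union> B, E)] @ ms2) \<and>
      mset (postorder (plug C (right_comb p q t2 t1 t3))) = mset (ms1 @ [(q, A, E), (p, B, A \<union> E)] @ ms2) \<and>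
      list_sign (ms1 @ [(q, B, E), (p, A, B \<union> E)] @ ms2) (postorder (plug C (right_comb p q t1 t2
          t3))) = s0 \<and>
      list_sign (ms1 @ [(q, A, B), (p, A \<union> B, E)] @ ms2) (postorder (plug C (left_comb p q t1 t2 t3))) =
        s0 * (-1) ^ num_internal t3 \<and>
      list_sign (ms1 @ [(q, A, E), (p, B, A \<union> E)] @ ms2) (postorder (plug C (right_comb p q t2 t1 t3))) =
        s0 * (-1) ^ (num_internal t1 * num_internal t2)"
      using cs by metis
    let ?ct = "\<lambda>ms. chain_tree n i (inner n ms) :: nat btree \<Rightarrow>\<^sub>0 'k"
    let ?X1 = "\<lambda>p q. ms1 @ [(q, B, E), (p, A, B \<union> E)] @ ms2"
    let ?X2 = "\<lambda>p q. ms1 @ [(q, A, B), (p, A \<union> B, E)] @ ms2"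
    let ?X3 = "\<lambda>p q. ms1 @ [(q, A, E), (p, B, A \<union> E)] @ ms2"
    let ?J = "\<lambda>p q. gen (plug C (right_comb p q t1 t2 t3)) +
      scale (sgn_pow (num_internal t3)) (gen (plug C (left_comb p q t1 t2 t3))) +
      scale (sgn_pow (num_internal t1 * num_internal t2)) (gen (plug C (right_comb p q t2 t1 t3)))
          :: nat btree \<Rightarrow>\<^sub>0 'k"
    have eq: "linear_extension (chain_tree n i) (gap_sum n ?ms (length ms1)) =
        (\<Sum>(p, q)\<in>{(co, ci), (ci, co)}. ?ct (?X1 p q) + ?ct (?X2 p q) + ?ct (?X3 p q))"
      unfolding gap_sum_nested(2)[OF ms] linear_extension_sum_distrib
      by (intro sum.cong refl) (simp add: linear_extension_add case_prod_unfold)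
    have J: "?ct (?X1 p q) + ?ct (?X2 p q) + ?ct (?X3 p q) - scale s0 (?J p q) \<in> ?R"
      if pq: "(p, q) \<in> {(co, ci), (ci, co)}" for p q
    proof -
      note X = gap_sum_nested(1)[OF ms pq]
      note L = combs_labeled_trees[OF T' pq]
      have "?ct (?X1 p q) - scale s0 (gen (plug C (right_comb p q t1 t2 t3))) \<in> ?R"
        using chain_tree_inner(1)[OF n(1) conjunct1[OF X] L(1), where ?'k = 'k] s0[OF pq] by simp
      moreover have "?ct (?X2 p q) - scale (s0 * (-1) ^ num_internal t3) (gen (plug C (left_comb p q
          t1 t2 t3))) \<in> ?R"
        using chain_tree_inner(1)[OF n(1) conjunct1[OF conjunct2[OF X]] L(2), where ?'k = 'k] s0[OF
            pq] by simp
      moreover have "?ct (?X3 p q) - scale (s0 * (-1) ^ (num_internal t1 * num_internal t2)) (gen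
          (plug C (right_comb p q t2 t1 t3))) \<in> ?R"
        using chain_tree_inner(1)[OF n(1) conjunct2[OF conjunct2[OF X]] L(3), where ?'k = 'k] s0[OF
            pq] by simp
      ultimately have "(?ct (?X1 p q) - scale s0 (gen (plug C (right_comb p q t1 t2 t3)))) +
         (?ct (?X2 p q) - scale (s0 * (-1) ^ num_internal t3) (gen (plug C (left_comb p q t1 t2 t3)))) +
         (?ct (?X3 p q) - scale (s0 * (-1) ^ (num_internal t1 * num_internal t2)) (gen (plug C
             (right_comb p q t2 t1 t3)))) \<in> ?R"
        by (intro comb.span_add)
      then show ?thesis by (simp add: comb.scale_right_distrib comb.scale_scale algebra_simps)
    qed
    have "(\<Sum>(p, q)\<in>{(co, ci), (ci, co)}. ?ct (?X1 p q) + ?ct (?X2 p q) + ?ct (?X3 p q) - scale s0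
        (?J p q)) \<in> ?R"
      unfolding case_prod_unfold by (rule comb.span_sum) (use J in \<open>metis prod.collapse\<close>)
    moreover have "scale s0 (\<Sum>(p, q)\<in>{(co, ci), (ci, co)}. ?J p q) \<in> ?R"
      by (intro comb.span_scale comb.span_base relations_comb[OF T'])
    ultimately have "(\<Sum>(p, q)\<in>{(co, ci), (ci, co)}. ?ct (?X1 p q) + ?ct (?X2 p q) + ?ct (?X3 p q) -
        scale s0 (?J p q)) +
        scale s0 (\<Sum>(p, q)\<in>{(co, ci), (ci, co)}. ?J p q) \<in> ?R"
      by (rule comb.span_add)
    then show ?thesis
      unfolding eq comb.scale_sum_right sum.distrib[symmetric] case_prod_unfold by simp
  qed
  define ms1 where "ms1 = take k ms"
  define ms2 where "ms2 = drop (Suc (Suc k)) ms"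
  obtain c A B where m1: "ms ! k = (c, A, B)" by (cases "ms ! k")
  obtain d E F where m2: "ms ! Suc k = (d, E, F)" by (cases "ms ! Suc k")
  have dec: "ms = ms1 @ [(c, A, B), (d, E, F)] @ ms2" "k = length ms1"
    using k id_take_nth_drop[of k ms] Cons_nth_drop_Suc[of "Suc k" ms] m1 m2 by (simp_all add:
        ms1_def ms2_def)
  note ms' = ms[unfolded dec(1)]
  consider "A \<union> B \<noteq> E" "A \<union> B \<noteq> F" | "F = A \<union> B" | "E = A \<union> B" by blast
  then show ?thesis
  proof cases
    case 1
    let ?ms = "ms1 @ [(c, A, B), (d, E, F)] @ ms2" and ?ms' = "ms1 @ [(d, E, F), (c, A, B)] @ ms2"
    have n1: "1 \<le> n" using n by simp
    note g = gap_sum_separate[OF ms' 1]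
    obtain T where T: "T \<in> labeled_trees n i" "mset (postorder T) = mset ?ms"
      using step_lists_tree[OF ms' n1] by blast
    have T2: "mset (postorder T) = mset ?ms'" using T(2) by simp
    have s: "list_sign ?ms' (postorder T) = - (list_sign ?ms (postorder T) :: 'k)"
      using list_sign_swap_adjacent[of ms1 "(c, A, B)" "(d, E, F)" ms2 "postorder T", where ?'k = 'k]
        T labeled_trees_distinct_postorder by simp
    from comb.span_add[OF chain_tree_inner(1)[OF n(1) ms' T] chain_tree_inner(1)[OF n(1) g(1) T(1)
        T2, where ?'k = 'k]]
    show ?thesis
      unfolding dec(1) unfolding dec(2) g(2) linear_extension_add linear_extension_gen s by simp
  next
    case 2
    show ?thesis using nested[of ms1 c A B d E ms2] ms' unfolding dec(1) unfolding dec(2) 2 by blast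
  next
    case 3
    have "ms1 @ [(c, A, B), (d, F, E)] @ ms2 \<in> step_lists n i"
      using ms' step_lists_flip[of "ms1 @ [(c, A, B)]" d E F ms2 n i] by simp
    then have "linear_extension (chain_tree n i) (gap_sum n (ms1 @ [(c, A, B), (d, F, E)] @ ms2) k) \<in> ?R"
      using nested[of ms1 c A B d F ms2] 3 dec(2) by simp
    moreover have "gap_sum n (ms1 @ [(c, A, B), (d, F, E)] @ ms2) k = (gap_sum n ms k :: _ \<Rightarrow>\<^sub>0 'k)"
      using gap_sum_flip[of n "ms1 @ [(c, A, B)]" d E F ms2 k, where ?'a = 'k] dec(1) by simp
    ultimately show ?thesis by simp
  qed
qed

lemma linear_extension_chain_tree_coboundaries:
  assumes n: "2 \<le> n" "i \<le> n - 1" and d: "d \<in> top_coboundaries n i"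
  shows "linear_extension (chain_tree n i) d \<in>
    comb.span (relations n i :: (nat btree \<Rightarrow>\<^sub>0 'k::comm_ring_1) set)"
proof -
  let ?cob = "coboundary_of_chain (proper_part n i) (wp_less n) :: _ \<Rightarrow> _ \<Rightarrow>\<^sub>0 'k"
  let ?V = "{f. linear_extension ?cob f \<in>
    {d. linear_extension (chain_tree n i) d \<in> comb.span (relations n i :: (nat btree \<Rightarrow>\<^sub>0 'k) set)}}"
  obtain f where f: "f \<in> free_on (chains (proper_part n i) (wp_less n) (int n - 3 - 1))"
    "d = linear_extension ?cob f"
    using d by (auto simp: coboundaries_def coboundary_def)
  have "f \<in> ?V"
  proof (rule free_on_induct[OF f(1)])
    show "comb.subspace ?V"
      by (intro subspace_linear_preimage comb.subspace_span)
    fix xs assume "xs \<in> chains (proper_part n i) (wp_less n) (int n - 3 - 1)"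
    from coboundary_of_chain_gap_sum[OF this n, where ?'k = 'k]
    have "linear_extension (chain_tree n i) (?cob xs) \<in> comb.span (relations n i :: (nat btree \<Rightarrow>\<^sub>0 'k) set)"
    proof (elim disjE bexE exE conjE)
      assume "?cob xs = 0"
      then show ?thesis by (simp only: linear_extension_zero comb.span_zero)
    next
      fix ms k assume "ms \<in> step_lists n i" "Suc k < length ms" and e: "?cob xs = scale ((-1) ^ k)
          (gap_sum n ms k)"
      then have "linear_extension (chain_tree n i) (gap_sum n ms k) \<in> comb.span (relations n i ::
          (nat btree \<Rightarrow>\<^sub>0 'k) set)"
        using linear_extension_chain_tree_gap_sum[OF n] by blast
      then show ?thesis unfolding e linear_extension_scale by (rule comb.span_scale)
    qed
    then show "gen xs \<in> ?V" by simp
  qed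
  then show ?thesis using f(2) by simp
qed

text \<open>In the postorder of a right comb the inner node directly precedes the root. The gap
  between these two merges has the terms of the relation as fillings, and sorting each filling into
  the postorder of its own tree produces the coefficients.\<close>

lemma comb_image_coboundaries:
  assumes n: "2 \<le> n" "i \<le> n - 1" and T: "plug C (right_comb co ci t1 t2 t3) \<in> labeled_trees n i"
  shows "(\<Sum>(p, q)\<in>{(co, ci), (ci, co)}.
      gen (inner n (postorder (plug C (right_comb p q t1 t2 t3)))) +
      scale (sgn_pow (num_internal t3)) (gen (inner n (postorder (plug C (left_comb p q t1 t2 t3))))) +
      scale (sgn_pow (num_internal t1 * num_internal t2))
        (gen (inner n (postorder (plug C (right_comb p q t2 t1 t3))))))
    \<in> (top_coboundaries n i :: (_ \<Rightarrow>\<^sub>0 'k::comm_ring_1) set)"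
proof -
  let ?D = "top_coboundaries n i :: (_ \<Rightarrow>\<^sub>0 'k) set"
  let ?A = "set (leaves t1)" and ?B = "set (leaves t2)" and ?E = "set (leaves t3)"
  note Dsub = subspace_coboundaries[of "proper_part n i" "wp_less n" "int n - 3"]
  obtain us vs where "\<And>X. set (leaves X) = ?A \<union> (?B \<union> ?E) \<Longrightarrow> postorder (plug C X) = us @ postorder X @ vs"
    using postorder_plug[of "?A \<union> (?B \<union> ?E)" C] by blast
  then have "postorder (plug C (right_comb co ci t1 t2 t3)) =
      (us @ postorder t1 @ postorder t2 @ postorder t3) @ [(ci, ?B, ?E), (co, ?A, ?B \<union> ?E)] @ vs"
    by (simp add: right_comb_def)
  then obtain ms1 ms2 where ms:
    "postorder (plug C (right_comb co ci t1 t2 t3)) = ms1 @ [(ci, ?B, ?E), (co, ?A, ?B \<union> ?E)] @ ms2"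
        by blast
  have SL: "ms1 @ [(ci, ?B, ?E), (co, ?A, ?B \<union> ?E)] @ ms2 \<in> step_lists n i"
    using postorder_step_lists[OF T] unfolding ms .
  let ?X1 = "\<lambda>p q. ms1 @ [(q, ?B, ?E), (p, ?A, ?B \<union> ?E)] @ ms2"
  let ?X2 = "\<lambda>p q. ms1 @ [(q, ?A, ?B), (p, ?A \<union> ?B, ?E)] @ ms2"
  let ?X3 = "\<lambda>p q. ms1 @ [(q, ?A, ?E), (p, ?B, ?A \<union> ?E)] @ ms2"
  note cs = comb_signs[OF T arg_cong[OF ms, of mset], where ?'k = 'k]
  have sg: "mset (postorder (plug C (right_comb p q t1 t2 t3))) = mset (?X1 p q) \<and>
      mset (postorder (plug C (left_comb p q t1 t2 t3))) = mset (?X2 p q) \<and>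
      mset (postorder (plug C (right_comb p q t2 t1 t3))) = mset (?X3 p q) \<and>
      list_sign (?X1 p q) (postorder (plug C (right_comb p q t1 t2 t3))) = (1 :: 'k) \<and>
      list_sign (?X2 p q) (postorder (plug C (left_comb p q t1 t2 t3))) = ((-1) ^ num_internal t3 :: 'k) \<and>
      list_sign (?X3 p q) (postorder (plug C (right_comb p q t2 t1 t3))) =
        ((-1) ^ (num_internal t1 * num_internal t2) :: 'k)"
    if "(p, q) \<in> {(co, ci), (ci, co)}" for p q
    using cs ms that by (metis mult_1)
  let ?g = "\<lambda>ms. gen (inner n ms) :: _ \<Rightarrow>\<^sub>0 'k"
  let ?J = "\<lambda>p q. gen (inner n (postorder (plug C (right_comb p q t1 t2 t3)))) +
      scale (sgn_pow (num_internal t3)) (gen (inner n (postorder (plug C (left_comb p q t1 t2 t3))))) +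
      scale (sgn_pow (num_internal t1 * num_internal t2))
        (gen (inner n (postorder (plug C (right_comb p q t2 t1 t3))))) :: _ \<Rightarrow>\<^sub>0 'k"
  have J: "?g (?X1 p q) + ?g (?X2 p q) + ?g (?X3 p q) - ?J p q \<in> ?D"
    if pq: "(p, q) \<in> {(co, ci), (ci, co)}" for p q
  proof -
    note X = gap_sum_nested(1)[OF SL pq]
    note L = combs_labeled_trees[OF T pq]
    have "?g (?X1 p q) - gen (inner n (postorder (plug C (right_comb p q t1 t2 t3)))) \<in> ?D"
      using sort_step_list[OF n L(1) conjunct1[OF X], where ?'k = 'k] sg[OF pq] by simp
    moreover have "?g (?X2 p q) - scale (sgn_pow (num_internal t3)) (gen (inner n (postorder (plug C
        (left_comb p q t1 t2 t3))))) \<in> ?D"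
      using sort_step_list[OF n L(2) conjunct1[OF conjunct2[OF X]], where ?'k = 'k] sg[OF pq] by simp
    moreover have "?g (?X3 p q) - scale (sgn_pow (num_internal t1 * num_internal t2))
        (gen (inner n (postorder (plug C (right_comb p q t2 t1 t3))))) \<in> ?D"
      using sort_step_list[OF n L(3) conjunct2[OF conjunct2[OF X]], where ?'k = 'k] sg[OF pq] by simp
    ultimately have "(?g (?X1 p q) - gen (inner n (postorder (plug C (right_comb p q t1 t2 t3))))) +
      (?g (?X2 p q) - scale (sgn_pow (num_internal t3)) (gen (inner n (postorder (plug C (left_comb
          p q t1 t2 t3)))))) +
      (?g (?X3 p q) - scale (sgn_pow (num_internal t1 * num_internal t2))
        (gen (inner n (postorder (plug C (right_comb p q t2 t1 t3)))))) \<in> ?D"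
      by (intro comb.subspace_add[OF Dsub])
    then show ?thesis by (simp add: algebra_simps)
  qed
  have "(\<Sum>(p, q)\<in>{(co, ci), (ci, co)}. ?g (?X1 p q) + ?g (?X2 p q) + ?g (?X3 p q) - ?J p q) \<in> ?D"
    unfolding case_prod_unfold by (rule comb.subspace_sum[OF Dsub]) (use J in \<open>metis prod.collapse\<close>)
  moreover have "gap_sum n (ms1 @ [(ci, ?B, ?E), (co, ?A, ?B \<union> ?E)] @ ms2) (length ms1) \<in> ?D"
    by (rule gap_sum_coboundary[OF SL n]) simp
  then have "(\<Sum>(p, q)\<in>{(co, ci), (ci, co)}. ?g (?X1 p q) + ?g (?X2 p q) + ?g (?X3 p q)) \<in> ?D"
    unfolding gap_sum_nested(2)[OF SL] .
  ultimately have "(\<Sum>(p, q)\<in>{(co, ci), (ci, co)}. ?g (?X1 p q) + ?g (?X2 p q) + ?g (?X3 p q)) -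
      (\<Sum>(p, q)\<in>{(co, ci), (ci, co)}. ?g (?X1 p q) + ?g (?X2 p q) + ?g (?X3 p q) - ?J p q) \<in> ?D"
    using comb.subspace_diff[OF Dsub] by blast
  then show ?thesis
    by (simp only: case_prod_unfold sum_subtractf diff_diff_eq2 add_diff_cancel_left')
qed

text \<open>Reversing the step of the swapped node in the postorder of one tree keeps the chain and
  gives a linear extension of the other tree; sorting that exchanges the nodes of \<open>l\<close>
  and \<open>r\<close>.\<close>

lemma swap_image_coboundaries:
  assumes n: "2 \<le> n" "i \<le> n - 1" and T: "plug C (Node c l r) \<in> labeled_trees n i"
  shows "gen (inner n (postorder (plug C (Node c l r)))) -
      scale (sgn_pow (num_internal l * num_internal r)) (gen (inner n (postorder (plug C (Node c r l)))))
    \<in> (top_coboundaries n i :: (_ \<Rightarrow>\<^sub>0 'k::comm_ring_1) set)"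
proof -
  let ?A = "set (leaves l)" and ?B = "set (leaves r)"
  have T': "plug C (Node c r l) \<in> labeled_trees n i" by (rule labeled_trees_plug[OF T]) auto
  obtain us vs where "\<And>X. set (leaves X) = ?A \<union> ?B \<Longrightarrow> postorder (plug C X) = us @ postorder X @ vs"
    using postorder_plug[of "?A \<union> ?B" C] by blast
  then have po: "postorder (plug C (Node c l r)) = (us @ postorder l @ postorder r) @ (c, ?A, ?B) # vs"
    "postorder (plug C (Node c r l)) = us @ postorder r @ postorder l @ (c, ?B, ?A) # vs"
    by (auto simp: Un_commute)
  let ?ms = "(us @ postorder l @ postorder r) @ (c, ?B, ?A) # vs"
  have d: "distinct ?ms" using labeled_trees_distinct_postorder[OF T'] unfolding po by auto
  have "?ms \<in> step_lists n i"
    using postorder_step_lists[OF T] step_lists_flip[of "us @ postorder l @ postorder r"] unfolding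
        po by blast
  from sort_step_list[OF n T' this]
  have "gen (inner n ?ms) - scale (list_sign ?ms (postorder (plug C (Node c r l)))) (gen (inner n
      (postorder (plug C (Node c r l)))))
      \<in> (top_coboundaries n i :: (_ \<Rightarrow>\<^sub>0 'k) set)"
    unfolding po by simp
  moreover have "list_sign ?ms (postorder (plug C (Node c r l))) = ((-1) ^ (num_internal l *
      num_internal r) :: 'k)"
    using list_sign_swap_blocks[of ?ms us "postorder r" "postorder l" "(c, ?B, ?A) # vs", where ?'k = 'k] d
      list_sign_self[OF d, where ?'b = 'k] unfolding po by (simp add: mult.commute)
  moreover have "inner n ?ms = inner n (postorder (plug C (Node c l r)))"
    unfolding po by (rule inner_flip)
  ultimately show ?thesis by simp
qed

lemma relations_image_coboundaries:
  assumes n: "2 \<le> n" "i \<le> n - 1" and r: "r \<in> relations n i"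
  shows "linear_extension (\<lambda>T. gen (inner n (postorder T))) r
    \<in> (top_coboundaries n i :: (_ \<Rightarrow>\<^sub>0 'k::comm_ring_1) set)"
  using r
proof cases
  case (swap C c l r)
  show ?thesis unfolding swap(1)
    using swap_image_coboundaries[OF n swap(2), where ?'k = 'k]
    by (simp add: linear_extension_diff linear_extension_scale)
next
  case (one_color C c t1 t2 t3)
  show ?thesis unfolding one_color(1)
    using comb_image_coboundaries[OF n, of C c c t1 t2 t3, where ?'k = 'k] one_color(2)
    by (simp add: linear_extension_add linear_extension_scale right_comb_def left_comb_def)
next
  case (two_color C t1 t2 t3)
  show ?thesis unfolding two_color(1)
    using comb_image_coboundaries[OF n, of C Red Blue t1 t2 t3, where ?'k = 'k] two_color(2)
    by (simp add: linear_extension_add linear_extension_scale right_comb_def left_comb_def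
        comb.scale_right_distrib algebra_simps)
qed

text \<open>A chain of this degree meets every rank, so there is no gap to fill.\<close>

lemma cocycles_top:
  assumes n: "2 \<le> n" "i \<le> n - 1"
  shows "cocycles (proper_part n i) (wp_less n) (int n - 3) =
    (free_on (chains (proper_part n i) (wp_less n) (int n - 3)) :: (_ \<Rightarrow>\<^sub>0 'k::comm_ring_1) set)"
proof -
  have z: "coboundary_of_chain (proper_part n i) (wp_less n) xs = (0 :: _ \<Rightarrow>\<^sub>0 'k)"
    if xs: "xs \<in> chains (proper_part n i) (wp_less n) (int n - 3)" for xs
  proof -
    obtain ms where ms: "ms \<in> step_lists n i" "inner n ms = xs" using chains_imp_inner[OF xs n] by blast
    have f: "(wp_bot n # xs @ [wp_top n i]) ! j = apply_steps (wp_bot n) (take j ms)" if "j \<le> length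
        ms" for j
      using merge_chain_inner[OF ms(1) n(1)] merge_chain_nth[OF that, of "wp_bot n"] ms(2) by simp
    have l: "Suc (length xs) = length ms" using length_inner[OF ms(1)] length_step_lists[OF ms(1)]
        ms(2) n by simp
    have "between n ((wp_bot n # xs @ [wp_top n i]) ! j) ((wp_bot n # xs @ [wp_top n i]) ! Suc j) = {}"
      if j: "j \<le> length xs" for j
    proof -
      have j': "j \<le> length ms" "Suc j \<le> length ms" using j l by simp_all
      show ?thesis unfolding f[OF j'(1)] f[OF j'(2)]
        using take_steps(2)[OF ms(1) j'(1)] take_steps(2)[OF ms(1) j'(2)]
        by (intro between_empty take_steps(1)[OF ms(1)]) simp
    qed
    moreover have "set xs \<subseteq> proper_part n i" "sorted_wrt (wp_less n) xs" using xs by (auto simp: chains_def)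
    ultimately show ?thesis
      using coboundary_of_chain_between[OF _ _ n, of xs] by simp
  qed
  have "linear_extension (coboundary_of_chain (proper_part n i) (wp_less n)) f = (0 :: _ \<Rightarrow>\<^sub>0 'k)"
    if "f \<in> free_on (chains (proper_part n i) (wp_less n) (int n - 3))" for f
    using linear_extension_free_on[OF that, of _ "{0}"] z comb.subspace_single_0 by blast
  then show ?thesis by (auto simp: cocycles_def coboundary_def)
qed

text \<open>The integers and a field are instances of this. For \<open>n = 1\<close> bottom and top
  coincide and the degenerate convention replaces the cochain complex, so that case is computed
  directly: one tree, no relations, one generator.\<close>

lemma presented_by_trees:
  assumes n: "1 \<le> n" "i \<le> n - 1"
  shows "presented_by
           (interval_cohomology (weighted_partitions n) (wp_less n) (wp_bot n) (wp_top n i)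
              (int n - 3) :: ('k::comm_ring_1, (weighted_partition list \<Rightarrow>\<^sub>0 'k) set) module)
           (labeled_trees n i)
           (\<lambda>T. chain_class (weighted_partitions n) (wp_less n) (wp_bot n) (wp_top n i)
              (int n - 3) (open_tree_chain n i T))
           (relations n i)"
proof (cases "n = 1")
  case True
  have i: "i = 0" using n True by simp
  have bt: "wp_bot n = wp_top n i" using True i by (simp add: wp_bot_def wp_top_def)
  have lt: "labeled_trees n i = {Leaf 1}"
  proof -
    have "T = Leaf 1" if T: "T \<in> labeled_trees n i" for T
    proof (cases T)
      case (Leaf a)
      then show ?thesis using T True by (auto simp: labeled_trees_def)
    next
      case (Node c l r)
      then have "set (leaves l) \<inter> set (leaves r) = {}" "set (leaves l) \<union> set (leaves r) = {1}"
        using T True by (auto simp: labeled_trees_def)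
      then show ?thesis
        using hd_in_set[OF leaves_nonempty[of l]] hd_in_set[OF leaves_nonempty[of r]]
        by (metis IntI UnI1 UnI2 emptyE singletonD)
    qed
    moreover have "Leaf 1 \<in> labeled_trees n i" using True i by (simp add: labeled_trees_def)
    ultimately show ?thesis by blast
  qed
  have oc: "open_tree_chain n i (Leaf 1) = []"
    by (simp add: open_tree_chain_def tree_chain_def bt)
  have plug_leaf: "plug C (Node c l r) \<noteq> Leaf a" for C c l r and a :: nat
    by (cases C) auto
  have R: "(relations n i :: (nat btree \<Rightarrow>\<^sub>0 'k) set) = {}"
  proof -
    have "False" if "r \<in> relations n i" for r :: "nat btree \<Rightarrow>\<^sub>0 'k"
      using that by cases (auto simp: lt plug_leaf)
    then show ?thesis by blast
  qed
  have "presented_by (quotient_module (free_on {[]}) {0}) {Leaf 1}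
      (\<lambda>T. gen (open_tree_chain n i T) +o {0 :: weighted_partition list \<Rightarrow>\<^sub>0 'k}) {}"
    by (rule presented_by_quotient[where \<psi> = "\<lambda>xs. gen (Leaf 1)"])
      (auto simp: oc[unfolded One_nat_def] comb.subspace_single_0 gen_in_free_on comb.span_zero)
  then show ?thesis
    unfolding interval_cohomology_def interval_cocycles_def interval_coboundaries_def chain_class_def lt R
    using bt True by simp
next
  case False
  then have n2: "2 \<le> n" using n by simp
  have bt: "wp_bot n \<noteq> wp_top n i" using wp_bot_less_wp_top[OF n2 n(2)] by (simp add: wp_less_def)
  let ?H = "chains (proper_part n i) (wp_less n) (int n - 3)"
  have oc: "open_tree_chain n i T = inner n (postorder T)" if "T \<in> labeled_trees n i" for T
    using open_tree_chain_eq_inner[OF that n2] .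
  have "presented_by (quotient_module (free_on ?H) (top_coboundaries n i)) (labeled_trees n i)
      (\<lambda>T. gen (open_tree_chain n i T) +o (top_coboundaries n i :: (_ \<Rightarrow>\<^sub>0 'k) set)) (relations n i)"
  proof (rule presented_by_quotient[where \<psi> = "chain_tree n i"])
    fix T assume T: "T \<in> labeled_trees n i"
    show "open_tree_chain n i T \<in> ?H"
      unfolding oc[OF T] by (rule inner_in_chains[OF postorder_step_lists[OF T] n2])
    show "chain_tree n i (open_tree_chain n i T) - gen T \<in> comb.span (relations n i :: (_ \<Rightarrow>\<^sub>0 'k) set)"
      using chain_tree_inner(1)[OF n2 postorder_step_lists[OF T] T refl, where ?'k = 'k]
        list_sign_self[OF labeled_trees_distinct_postorder[OF T], where ?'b = 'k]
      unfolding oc[OF T] by simp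
  next
    fix xs assume "xs \<in> ?H"
    then obtain ms where ms: "ms \<in> step_lists n i" "inner n ms = xs"
      using chains_imp_inner[OF _ n2 n(2)] by blast
    obtain T where T: "T \<in> labeled_trees n i" "mset (postorder T) = mset ms"
      using step_lists_tree[OF ms(1) n(1)] by blast
    show "(chain_tree n i xs :: _ \<Rightarrow>\<^sub>0 'k) \<in> free_on (labeled_trees n i)"
      using chain_tree_inner(2)[OF n2 ms(1) T, where ?'k = 'k] ms(2) by simp
    let ?L = "linear_extension (\<lambda>T. gen (inner n (postorder T)) :: _ \<Rightarrow>\<^sub>0 'k)"
    \<comment> \<open>\<open>open_tree_chain\<close> has been identified with \<open>inner\<close>
      on labeled trees only, hence the restriction on the support.\<close>
    have L: "linear_extension (\<lambda>T. gen (open_tree_chain n i T) :: _ \<Rightarrow>\<^sub>0 'k) f = ?L f"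
      if "f \<in> free_on (labeled_trees n i)" for f :: "nat btree \<Rightarrow>\<^sub>0 'k"
      using that oc by (auto simp: linear_extension_def free_on_def intro!: sum.cong)
    have "?L (chain_tree n i xs - scale (list_sign ms (postorder T)) (gen T)) \<in> top_coboundaries n i"
    proof -
      have "comb.span (relations n i) \<subseteq> {f. ?L f \<in> top_coboundaries n i}"
        using relations_image_coboundaries[OF n2 n(2), where ?'k = 'k]
        by (intro comb.span_minimal subspace_linear_preimage subspace_coboundaries) blast
      then show ?thesis using chain_tree_inner(1)[OF n2 ms(1) T, where ?'k = 'k] ms(2) by blast
    qed
    moreover have "gen xs - scale (list_sign ms (postorder T)) (gen (inner n (postorder T))) \<in>
        (top_coboundaries n i :: (_ \<Rightarrow>\<^sub>0 'k) set)"
      using sort_step_list[OF n2 n(2) T(1) ms(1), where ?'k = 'k] T(2) ms(2) by simp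
    \<comment> \<open>The multiples of \<open>gen (inner n (postorder T))\<close> cancel in this
      difference.\<close>
    ultimately have "?L (chain_tree n i xs - scale (list_sign ms (postorder T)) (gen T)) -
        (gen xs - scale (list_sign ms (postorder T)) (gen (inner n (postorder T)))) \<in> top_coboundaries n i"
      by (rule comb.subspace_diff[OF subspace_coboundaries])
    then show "linear_extension (\<lambda>T. gen (open_tree_chain n i T)) (chain_tree n i xs) - gen xs
        \<in> (top_coboundaries n i :: (_ \<Rightarrow>\<^sub>0 'k) set)"
      using L \<open>chain_tree n i xs \<in> free_on _\<close>
      by (simp add: linear_extension_diff linear_extension_scale)
  next
    fix r :: "nat btree \<Rightarrow>\<^sub>0 'k" assume r: "r \<in> relations n i"
    then have "r \<in> free_on (labeled_trees n i)" using relations_subset_free_on by blast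
    then have "linear_extension (\<lambda>T. gen (open_tree_chain n i T) :: _ \<Rightarrow>\<^sub>0 'k) r =
        linear_extension (\<lambda>T. gen (inner n (postorder T))) r"
      using oc by (auto simp: linear_extension_def free_on_def intro!: sum.cong)
    then show "linear_extension (\<lambda>T. gen (open_tree_chain n i T)) r \<in> top_coboundaries n i"
      using relations_image_coboundaries[OF n2 n(2) r] by simp
  qed (use relations_subset_free_on subspace_coboundaries
      linear_extension_chain_tree_coboundaries[OF n2 n(2)] in auto)
  then show ?thesis
    unfolding interval_cohomology_def interval_cocycles_def interval_coboundaries_def chain_class_def
    using bt cocycles_top[OF n2 n(2), where ?'k = 'k] by simp
qed

theorem theorem4p4:
  fixes n i :: nat
  assumes "1 \<le> n" and "i \<le> n - 1"
  shows "presented_by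
           (interval_cohomology (weighted_partitions n) (wp_less n) (wp_bot n) (wp_top n i)
              (int n - 3) :: (int, (weighted_partition list \<Rightarrow>\<^sub>0 int) set) module)
           (labeled_trees n i)
           (\<lambda>T. chain_class (weighted_partitions n) (wp_less n) (wp_bot n) (wp_top n i)
              (int n - 3) (open_tree_chain n i T))
           (relations n i)
         \<and>
         presented_by
           (interval_cohomology (weighted_partitions n) (wp_less n) (wp_bot n) (wp_top n i)
              (int n - 3) :: ('k::field, (weighted_partition list \<Rightarrow>\<^sub>0 'k) set) module)
           (labeled_trees n i)
           (\<lambda>T. chain_class (weighted_partitions n) (wp_less n) (wp_bot n) (wp_top n i)
              (int n - 3) (open_tree_chain n i T))
           (relations n i)"
  by (intro conjI presented_by_trees assms)

end
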